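(* Let $n\ge1$ be an integer, let $a,b,c\in\mathbb{C}$ and $\sigma>0$ be fixed, such that $c-(i-1)/\sigma$ is not zero or a negative integer for $1\le i\le n$. Then, with $p_1(\mathbf{x})=x_1+\dots+x_n$, as $N\to\infty$ through the positive integers, $${}_2F_1^{(\sigma)}\Big(a-N,b-N;c;\frac{1}{N^2}\mathbf{x}\Big)={}_0F_1^{(\sigma)}(;c;\mathbf{x})+\frac1N(c-a-b)\,\mathrm{E}_1\big\{{}_0F_1^{(\sigma)}(;c;\mathbf{x})\big\}-\frac1N p_1(\mathbf{x})\,{}_0F_1^{(\sigma)}(;c;\mathbf{x})+O\Big(\frac1{N^2}\Big),$$ where $\mathrm{E}_1=\sum_{i=1}^n x_i\frac{\partial}{\partial x_i}$, and the error estimate is uniform for $\mathbf{x}=(x_1,\dots,x_n)$ in compact subsets of $\mathbb{C}^n$, but may depend on $a,b,c,\sigma,n$.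
   Context: Jack polynomials: let $\sigma>0$, $\mathbf{x}=(x_1,\dots,x_n)$, and let $\lambda=(\lambda_1\ge\dots\ge\lambda_n\ge0)$ be an integer partition of size $|\lambda|=\lambda_1+\dots+\lambda_n$. $C_\lambda^{(\sigma)}(\mathbf{x})$ is the homogeneous symmetric polynomial of degree $|\lambda|$ determined by: (i) it is an eigenfunction of $\sum_{i}x_i^2\frac{\partial^2}{\partial x_i^2}+\frac{2}{\sigma}\sum_{i\ne j}\frac{x_i^2}{x_i-x_j}\frac{\partial}{\partial x_i}$ with eigenvalue $\rho_\lambda+\frac{2}{\sigma}|\lambda|(n-1)$, where $\rho_\lambda=\sum_{i=1}^n\lambda_i(\lambda_i-1-\frac{2}{\sigma}(i-1))$; (ii) in the basis of monomial symmetric functions $m_\mu$ only $\mu\le\lambda$ in dominance order occur; (iii) $\sum_{|\lambda|=k}C^{(\sigma)}_\lambda(\mathbf{x})=(x_1+\dots+x_n)^k$ for all $k$. Multivariate hypergeometric functions: with $(a)_m=\prod_{j=0}^{m-1}(a+j)$ and $[a]_\lambda^{(\sigma)}=\prod_{i=1}^n\big(a-\frac{i-1}{\sigma}\big)_{\lambda_i}$, $${}_pF_q^{(\sigma)}(a_1,\dots,a_p;b_1,\dots,b_q;\mathbf{x})=\sum_\lambda\frac{[a_1]_\lambda^{(\sigma)}\cdots[a_p]_\lambda^{(\sigma)}}{[b_1]_\lambda^{(\sigma)}\cdots[b_q]_\lambda^{(\sigma)}|\lambda|!}C_\lambda^{(\sigma)}(\mathbf{x}),$$ the sum being over all partitions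 with at most $n$ parts. It converges absolutely for all $\mathbf{x}\in\mathbb{C}^n$ if $p\le q$, and in some ball around $\mathbf{0}$ if $p=q+1$. *)

theory Defs
  imports "HOL-Analysis.Analysis" "HOL-Library.Nonpos_Ints"
begin

section \<open>Partitions\<close>

text \<open>A partition with at most \<open>n\<close> parts is a function \<open>\<lambda>\<close> whose entries
  \<open>\<lambda> 1 \<ge> \<dots> \<ge> \<lambda> n\<close> are the parts; it vanishes outside \<open>{1..n}\<close>, so that equality
  of partitions is equality of functions.\<close>

definition partitions :: "nat \<Rightarrow> (nat \<Rightarrow> nat) set" where
  "partitions n = {lam. (\<forall>i. i \<notin> {1..n} \<longrightarrow> lam i = 0) \<and>
                        (\<forall>i\<in>{1..n}. \<forall>j\<in>{1..n}. i \<le> j \<longrightarrow> lam j \<le> lam i)}"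

definition psize :: "nat \<Rightarrow> (nat \<Rightarrow> nat) \<Rightarrow> nat" where
  "psize n lam = (\<Sum>i=1..n. lam i)"

definition dominance_le :: "nat \<Rightarrow> (nat \<Rightarrow> nat) \<Rightarrow> (nat \<Rightarrow> nat) \<Rightarrow> bool" where
  "dominance_le n mu lam \<longleftrightarrow> psize n mu = psize n lam \<and>
     (\<forall>j\<in>{1..n}. (\<Sum>i=1..j. mu i) \<le> (\<Sum>i=1..j. lam i))"

section \<open>Functions of \<open>n\<close> complex variables\<close>

text \<open>Points of complex \<open>n\<close>-space have type \<open>complex ^ 'n\<close>, with \<open>n = CARD('n)\<close>.\<close>

definition partial :: "'n \<Rightarrow> (complex ^ 'n \<Rightarrow> complex) \<Rightarrow> complex ^ 'n::finite \<Rightarrow> complex" where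
  "partial i f x = deriv (\<lambda>t. f (x + axis i t)) 0"

definition p1 :: "complex ^ 'n::finite \<Rightarrow> complex" where
  "p1 x = (\<Sum>i\<in>UNIV. x $ i)"

definition E1 :: "(complex ^ 'n::finite \<Rightarrow> complex) \<Rightarrow> complex ^ 'n \<Rightarrow> complex" where
  "E1 f x = (\<Sum>i\<in>UNIV. x $ i * partial i f x)"

text \<open>The exponent vectors in \<open>monomial_sym mu\<close> are the distinct rearrangements of \<open>mu\<close>;
  they form a set, so each monomial has coefficient 1.\<close>

definition monomial_sym :: "(nat \<Rightarrow> nat) \<Rightarrow> complex ^ 'n::finite \<Rightarrow> complex" where
  "monomial_sym mu x =
     (\<Sum>e\<in>{e :: 'n \<Rightarrow> nat. \<exists>g. bij_betw g UNIV {1..CARD('n)} \<and> e = mu \<circ> g}.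
        \<Prod>i\<in>UNIV. (x $ i) ^ e i)"

section \<open>Jack polynomials\<close>

definition jack_op :: "real \<Rightarrow> (complex ^ 'n::finite \<Rightarrow> complex) \<Rightarrow> complex ^ 'n \<Rightarrow> complex" where
  "jack_op \<sigma> f x =
     (\<Sum>i\<in>UNIV. (x $ i)\<^sup>2 * partial i (partial i f) x) +
     of_real (2 / \<sigma>) *
       (\<Sum>i\<in>UNIV. \<Sum>j\<in>UNIV - {i}. (x $ i)\<^sup>2 / (x $ i - x $ j) * partial i f x)"

definition rho :: "nat \<Rightarrow> real \<Rightarrow> (nat \<Rightarrow> nat) \<Rightarrow> real" where
  "rho n \<sigma> lam =
     (\<Sum>i=1..n. real (lam i) * (real (lam i) - 1 - 2 / \<sigma> * (real i - 1)))"

definition jack_eigenvalue :: "nat \<Rightarrow> real \<Rightarrow> (nat \<Rightarrow> nat) \<Rightarrow> real" where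
  "jack_eigenvalue n \<sigma> lam = rho n \<sigma> lam + 2 / \<sigma> * real (psize n lam) * (real n - 1)"

text \<open>The three conditions determining the Jack polynomials in the C-normalization.
  The first one contains both the restriction to monomial symmetric functions below \<open>lam\<close> in
  dominance order and the fact that \<open>C lam\<close> is a homogeneous symmetric polynomial of
  degree \<open>psize n lam\<close>. The eigenvalue equation is an identity of rational functions, hence
  required only off the poles of the coefficients.\<close>

definition is_jack_family ::
  "real \<Rightarrow> ((nat \<Rightarrow> nat) \<Rightarrow> complex ^ 'n::finite \<Rightarrow> complex) \<Rightarrow> bool" where
  "is_jack_family \<sigma> C \<longleftrightarrow>
     (\<forall>lam\<in>partitions CARD('n). \<exists>u :: (nat \<Rightarrow> nat) \<Rightarrow> complex. \<forall>x.
        C lam x = (\<Sum>mu\<in>{mu \<in> partitions CARD('n). dominance_le CARD('n) mu lam}.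
                     u mu * monomial_sym mu x)) \<and>
     (\<forall>lam\<in>partitions CARD('n). \<forall>x. (\<forall>i j. i \<noteq> j \<longrightarrow> x $ i \<noteq> x $ j) \<longrightarrow>
        jack_op \<sigma> (C lam) x = of_real (jack_eigenvalue CARD('n) \<sigma> lam) * C lam x) \<and>
     (\<forall>k x. (\<Sum>lam\<in>{lam \<in> partitions CARD('n). psize CARD('n) lam = k}. C lam x) = p1 x ^ k)"

text \<open>For \<open>\<sigma> > 0\<close> and \<open>lam\<close> a partition the description is proper: eigenvalues of
  distinct comparable partitions differ, so the first two conditions fix \<open>C lam\<close> up to a factor,
  and the third one fixes the factors. In particular \<open>C lam \<noteq> 0\<close> need not be required.\<close>

definition jack_C :: "real \<Rightarrow> (nat \<Rightarrow> nat) \<Rightarrow> complex ^ 'n::finite \<Rightarrow> complex" where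
  "jack_C \<sigma> lam = (THE f. \<exists>C. is_jack_family \<sigma> C \<and> f = C lam)"

section \<open>Multivariate hypergeometric functions\<close>

definition gen_pochhammer :: "nat \<Rightarrow> real \<Rightarrow> complex \<Rightarrow> (nat \<Rightarrow> nat) \<Rightarrow> complex" where
  "gen_pochhammer n \<sigma> a lam =
     (\<Prod>i=1..n. pochhammer (a - of_real ((real i - 1) / \<sigma>)) (lam i))"

text \<open>The lists \<open>as\<close> and \<open>bs\<close> hold the upper and lower parameters, so \<open>p\<close> and \<open>q\<close> are their
  lengths. The unordered sum is \<open>0\<close> where the series does not converge absolutely.\<close>

definition hypergeom ::
  "real \<Rightarrow> complex list \<Rightarrow> complex list \<Rightarrow> complex ^ 'n::finite \<Rightarrow> complex" where
  "hypergeom \<sigma> as bs x =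
     (\<Sum>\<^sub>\<infinity>lam\<in>partitions CARD('n).
        (\<Prod>a\<leftarrow>as. gen_pochhammer CARD('n) \<sigma> a lam) /
        ((\<Prod>b\<leftarrow>bs. gen_pochhammer CARD('n) \<sigma> b lam) * fact (psize CARD('n) lam)) *
        jack_C \<sigma> lam x)"

end

(* With gamma = 1/sigma, the Jack polynomials are the symmetric joint eigenvectors of symmetric
   functions of commuting Cherednik operators, which are built from the Dunkl operators
   T_i = d/dx_i + gamma sum_{j ~= i} (1 - s_ij)/(x_i - x_j).  The Hermitian form in which T_i is
   adjoint to multiplication by x_i makes these operators self-adjoint.  It is positive, so Jack
   polynomials of equal degree are orthogonal, and the component C_lambda of p_1^k is bounded in
   the form norm by p_1^k itself; a Bernstein-type inequality turns this into
   |C_lambda(x)| <= (const max|x_i|)^|lambda|.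

   Put tau_lambda = C_lambda(x) / ([c]_lambda |lambda|!).  The expansion parameter enters through
   [a-N]_lambda [b-N]_lambda / N^(2|lambda|) = prod (1 + w/N), over two weights w per box of
   lambda, and for N >= N0 the error of 1 + (sum w)/N is at most (N0/N)^2 prod (1 + |w|/N0).  The
   growth bound makes the resulting series of errors converge once N0 is large.  The weights of
   lambda sum to -(a+b)|lambda| - rho_lambda, so the first-order term is as claimed because 0F1
   solves sum_lambda (rho_lambda + c|lambda|) tau_lambda = p_1 sum_lambda tau_lambda.  This
   equation comes from the identity Z(u) x_i (u + zeta_i) = x_i (u + 1 + zeta_i) Z(u), where Z(u)
   is the generating function of the symmetric functions of the Cherednik operators: comparing
   coefficients of C_mu and C_lambda shows that the coefficients of p_1 C_mu and of
   sum_i x_i zeta_i C_mu determine the quotient [c]_lambda / [c]_mu. *)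
theory Submission imports Defs "HOL-Complex_Analysis.Cauchy_Integral_Formula"
begin

section \<open>Polynomial functions and permutations of the variables\<close>

text \<open>Positivity of the form and the bound of values by the form norm rest on one identity. In
  degree k, sum_i x_i T_i f equals (k + (gamma/2) n (n-1)) f minus gamma/2 times the sum of the n
  (n-1) transposed copies of f. The coefficient of f exceeds the total weight of these copies by k,
  so for k > 0 the polynomial f is controlled by the T_i f of lower degree. This drives inductions
  on the degree in which quantities are maximized over all permutations of the variables.

  The quotients [c]_lambda / [c]_mu are read off from the numbers lambda_i + gamma (n-i): the
  eigenvalue of Z(u) on C_lambda is the product of u plus these numbers, and [c]_lambda is, up to a
  constant factor, the product of Gamma at c - gamma (n-1) plus these numbers. The intertwining
  identity forces the multisets of lambda and mu to differ by a shift of one element by 1, which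
  changes the Gamma product by a linear factor. Summing over mu then leads to the explicit
  polynomials p_1^k, on which the operators can be evaluated directly.\<close>

inductive_set polyfuns :: "(complex ^ 'n::finite \<Rightarrow> complex) set" where
  polyfuns_const: "(\<lambda>_. c) \<in> polyfuns"
| polyfuns_var: "f \<in> polyfuns \<Longrightarrow> (\<lambda>x. x $ i * f x) \<in> polyfuns"
| polyfuns_add: "f \<in> polyfuns \<Longrightarrow> g \<in> polyfuns \<Longrightarrow> (\<lambda>x. f x + g x) \<in> polyfuns"

lemma polyfuns_scale: "f \<in> polyfuns \<Longrightarrow> (\<lambda>x. c * f x) \<in> polyfuns"
proof (induction rule: polyfuns.induct)
  case (polyfuns_var f i)
  then show ?case using polyfuns.polyfuns_var[of "\<lambda>x. c * f x" i] by (simp add: mult.left_commute)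
qed (auto intro: polyfuns.intros simp: distrib_left)

lemma polyfuns_mult: "f \<in> polyfuns \<Longrightarrow> g \<in> polyfuns \<Longrightarrow> (\<lambda>x. f x * g x) \<in> polyfuns"
proof (induction rule: polyfuns.induct)
  case (polyfuns_var f i)
  then show ?case using polyfuns.polyfuns_var[of "\<lambda>x. f x * g x" i] by (simp add: mult.assoc)
qed (auto intro: polyfuns.intros polyfuns_scale simp: distrib_right)

text \<open>Identifying polynomials with the functions they define allows identities to be checked
  pointwise; as a type of their own they form a ring, so that operators on them can be handled with
  \<open>algebra_simps\<close>.\<close>

typedef (overloaded) 'n pol = "polyfuns :: (complex ^ 'n::finite \<Rightarrow> complex) set"
  morphisms ev Abs_pol
  by (rule exI[of _ "\<lambda>_. 0"]) (rule polyfuns_const)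

setup_lifting type_definition_pol

instantiation pol :: (finite) comm_ring_1
begin
lift_definition zero_pol :: "'a pol" is "\<lambda>_. 0" by (rule polyfuns_const)
lift_definition one_pol :: "'a pol" is "\<lambda>_. 1" by (rule polyfuns_const)
lift_definition plus_pol :: "'a pol \<Rightarrow> 'a pol \<Rightarrow> 'a pol" is "\<lambda>f g x. f x + g x" by (rule polyfuns_add)
lift_definition times_pol :: "'a pol \<Rightarrow> 'a pol \<Rightarrow> 'a pol" is "\<lambda>f g x. f x * g x" by (rule polyfuns_mult)
lift_definition uminus_pol :: "'a pol \<Rightarrow> 'a pol" is "\<lambda>f x. - f x" using polyfuns_scale[of _ "-1"] by simp
lift_definition minus_pol :: "'a pol \<Rightarrow> 'a pol \<Rightarrow> 'a pol" is "\<lambda>f g x. f x - g x"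
  using polyfuns_add[OF _ polyfuns_scale[of _ "-1"]] by simp
instance by standard (transfer; auto simp: algebra_simps fun_eq_iff)+
end

lift_definition X :: "'n::finite \<Rightarrow> 'n pol" is "\<lambda>i x. x $ i"
  using polyfuns_var[OF polyfuns_const[of 1]] by simp
lift_definition CC :: "complex \<Rightarrow> 'n::finite pol" is "\<lambda>c _. c" by (rule polyfuns_const)

lemma ev_simps [simp]:
  "ev 0 x = 0" "ev 1 x = 1" "ev (f + g) x = ev f x + ev g x" "ev (f * g) x = ev f x * ev g x"
  "ev (- f) x = - ev f x" "ev (f - g) x = ev f x - ev g x" "ev (X i) x = x $ i" "ev (CC c) x = c"
  by (transfer; simp)+

lemma ev_sum [simp]: "ev (sum f A) x = (\<Sum>a\<in>A. ev (f a) x)"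
  by (induction A rule: infinite_finite_induct) auto

lemma ev_prod [simp]: "ev (prod f A) x = (\<Prod>a\<in>A. ev (f a) x)"
  by (induction A rule: infinite_finite_induct) auto

lemma ev_power [simp]: "ev (f ^ n) x = ev f x ^ n"
  by (induction n) auto

lemma pol_eqI: "(\<And>x. ev f x = ev g x) \<Longrightarrow> f = g"
  by (metis ev_inject ext)

lemma CC_simps: "CC (a + b) = CC a + CC b" "CC (a * b) = CC a * CC b" "CC 0 = 0" "CC 1 = 1"
   "CC (- a) = - CC a" "CC (a - b) = CC a - CC b"
  by (rule pol_eqI; simp)+

lemma CC_sum: "CC (sum f A) = (\<Sum>a\<in>A. CC (f a))"
  by (rule pol_eqI) simp

lemma of_nat_pol: "of_nat n = CC (of_nat n)"
  by (induction n) (simp_all add: CC_simps)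

lemma pol_induct [case_names const var add]:
  assumes "\<And>c. P (CC c)" "\<And>i f. P f \<Longrightarrow> P (X i * f)" "\<And>f g. P f \<Longrightarrow> P g \<Longrightarrow> P (f + g)"
  shows "P f"
proof -
  have "g \<in> polyfuns \<Longrightarrow> P (Abs_pol g)" for g
  proof (induction rule: polyfuns.induct)
    case (polyfuns_const c)
    then show ?case using assms(1)[of c] by (simp add: CC_def)
  next
    case (polyfuns_var f i)
    have "Abs_pol (\<lambda>x. x $ i * f x) = X i * Abs_pol f"
      by (rule pol_eqI) (simp add: Abs_pol_inverse polyfuns_var polyfuns.intros)
    then show ?case using assms(2) polyfuns_var by simp
  next
    case (polyfuns_add f g)
    have "Abs_pol (\<lambda>x. f x + g x) = Abs_pol f + Abs_pol g"
      by (rule pol_eqI) (simp add: Abs_pol_inverse polyfuns_add polyfuns.intros)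
    then show ?case using assms(3) polyfuns_add by simp
  qed
  from this[OF ev[of f]] show ?thesis by (simp add: ev_inverse)
qed

lemma continuous_ev: "continuous_on UNIV (ev f)"
  by (induction f rule: pol_induct) (simp_all add: continuous_intros)

text \<open>The values agree off the hyperplane x_i = x_j, and each point of it is a limit of points
  off it. Uniqueness of divided differences depends on this.\<close>

lemma X_diff_cancel:
  assumes "i \<noteq> j" "(X i - X j) * f = (X i - X j) * g"
  shows "f = g"
proof (rule pol_eqI)
  fix x
  have eq: "ev f y = ev g y" if "y $ i \<noteq> y $ j" for y
    using arg_cong[OF assms(2), of "\<lambda>h. ev h y"] that by simp
  show "ev f x = ev g x"
  proof (cases "x $ i = x $ j")
    case True
    \<comment> \<open>Changing only coordinate i leaves the hyperplane for every nonzero t.\<close>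
    define p where "p = (\<lambda>t::real. x + t *\<^sub>R axis i 1)"
    have lim: "((\<lambda>t. ev h (p t)) \<longlongrightarrow> ev h x) (at 0)" for h
    proof -
      have "continuous_on UNIV (\<lambda>t. ev h (p t))"
        unfolding p_def
        by (rule continuous_on_compose2[OF continuous_ev]) (auto intro!: continuous_intros)
      then have "((\<lambda>t. ev h (p t)) \<longlongrightarrow> ev h (p 0)) (at 0)"
        by (simp add: continuous_on_def)
      moreover have "p 0 = x" by (simp add: p_def axis_def vec_eq_iff)
      ultimately show ?thesis by simp
    qed
    have "\<forall>\<^sub>F t in at 0. ev f (p t) = ev g (p t)"
      unfolding eventually_at_filter
      by (rule always_eventually) (use True assms(1) in \<open>auto intro!: eq simp: p_def axis_def\<close>)
    then have "((\<lambda>t. ev g (p t)) \<longlongrightarrow> ev f x) (at 0)"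
      using lim[of f] by (rule Lim_transform_eventually[rotated])
    then show ?thesis using lim[of g] by (metis LIM_unique)
  qed (rule eq)
qed

lift_definition act :: "('n::finite \<Rightarrow> 'n) \<Rightarrow> 'n pol \<Rightarrow> 'n pol" is "\<lambda>p f x. f (\<chi> i. x $ p i)"
  subgoal premises prems for p f
    using prems by (induction rule: polyfuns.induct) (auto intro: polyfuns.intros)
  done

lemma ev_act: "ev (act p f) x = ev f (\<chi> i. x $ p i)"
  by transfer simp

lemma act_simps [simp]:
  "act p (f + g) = act p f + act p g" "act p (f * g) = act p f * act p g" "act p (f - g) = act p f - act p g"
  "act p (- f) = - act p f" "act p (X i) = X (p i)" "act p (CC c) = CC c" "act p 0 = 0" "act p 1 = 1"
  "act id f = f" "act p (f ^ m) = act p f ^ m"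
  by (rule pol_eqI; simp add: ev_act)+

lemma act_sum [simp]: "act p (sum f A) = (\<Sum>a\<in>A. act p (f a))"
  by (rule pol_eqI) (simp add: ev_act)

lemma act_prod [simp]: "act p (prod f A) = (\<Prod>a\<in>A. act p (f a))"
  by (rule pol_eqI) (simp add: ev_act)

lemma act_act: "act p (act q f) = act (p \<circ> q) f"
  by (rule pol_eqI) (simp add: ev_act)

abbreviation tr :: "'n \<Rightarrow> 'n \<Rightarrow> 'n \<Rightarrow> 'n" where "tr \<equiv> Transposition.transpose"

lemma act_tr_tr [simp]: "act (tr i j) (act (tr i j) f) = f"
  by (simp add: act_act)

lemma tr_conj: "bij p \<Longrightarrow> p \<circ> tr i j = tr (p i) (p j) \<circ> p"
  by (auto simp: fun_eq_iff Transposition.transpose_def bij_def inj_eq)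

lemma act_tr_conj: "bij p \<Longrightarrow> act p (act (tr i j) f) = act (tr (p i) (p j)) (act p f)"
  by (simp add: act_act tr_conj)

section \<open>Dunkl operators\<close>

lemma partial_exists:
  "\<exists>g. \<forall>x. ((\<lambda>t. ev f (x + axis i t)) has_field_derivative ev g x) (at 0)"
proof (induction f rule: pol_induct)
  case (const c)
  show ?case by (rule exI[of _ 0]) simp
next
  case (var l f)
  then obtain g where g: "\<And>x. ((\<lambda>t. ev f (x + axis i t)) has_field_derivative ev g x) (at 0)" by blast
  show ?case
  proof (rule exI[of _ "X l * g + (if l = i then f else 0)"], intro allI)
    fix x :: "complex ^ 'a"
    have z: "x + axis i 0 = x" by (simp add: vec_eq_iff axis_def)
    have 1: "((\<lambda>t. (x + axis i t) $ l) has_field_derivative (if l = i then 1 else 0)) (at 0)"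
      by (auto simp: axis_def intro!: derivative_eq_intros)
    show "((\<lambda>t. ev (X l * f) (x + axis i t)) has_field_derivative
       ev (X l * g + (if l = i then f else 0)) x) (at 0)"
      using DERIV_mult[OF 1 g[of x]] by (auto simp: z algebra_simps split: if_splits)
  qed
next
  case (add f1 f2)
  then obtain g1 g2 where "\<And>x. ((\<lambda>t. ev f1 (x + axis i t)) has_field_derivative ev g1 x) (at 0)"
    "\<And>x. ((\<lambda>t. ev f2 (x + axis i t)) has_field_derivative ev g2 x) (at 0)" by blast
  then show ?case by (intro exI[of _ "g1 + g2"]) (auto intro!: derivative_eq_intros)
qed

definition dd :: "'n::finite \<Rightarrow> 'n pol \<Rightarrow> 'n pol" where
  "dd i f = (SOME g. \<forall>x. ((\<lambda>t. ev f (x + axis i t)) has_field_derivative ev g x) (at 0))"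

lemma dd_deriv: "((\<lambda>t. ev f (x + axis i t)) has_field_derivative ev (dd i f) x) (at 0)"
  unfolding dd_def using someI_ex[OF partial_exists[of f i]] by blast

lemma dd_eqI:
  assumes "\<And>x. ((\<lambda>t. ev f (x + axis i t)) has_field_derivative ev g x) (at 0)"
  shows "dd i f = g"
  by (rule pol_eqI) (rule DERIV_unique[OF dd_deriv assms])

lemma partial_ev: "partial i (ev f) = ev (dd i f)"
  unfolding partial_def by (rule ext, rule DERIV_imp_deriv, rule dd_deriv)

lemma dd_CC [simp]: "dd i (CC c) = 0"
  by (rule dd_eqI) simp

lemma dd_add [simp]: "dd i (f + g) = dd i f + dd i g"
  by (rule dd_eqI) (auto intro!: derivative_eq_intros dd_deriv)

lemma dd_mult: "dd i (f * g) = dd i f * g + f * dd i g"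
proof (rule dd_eqI)
  fix x :: "complex ^ 'a"
  have z: "x + axis i 0 = x" by (simp add: vec_eq_iff axis_def)
  show "((\<lambda>t. ev (f * g) (x + axis i t)) has_field_derivative ev (dd i f * g + f * dd i g) x) (at 0)"
    using DERIV_mult[OF dd_deriv[of f x i] dd_deriv[of g x i]] by (simp add: z algebra_simps)
qed

lemma dd_X [simp]: "dd i (X l) = (if l = i then 1 else 0)"
  by (rule dd_eqI) (auto simp: axis_def intro!: derivative_eq_intros)

lemma dd_X_mult: "dd i (X l * f) = (if l = i then f else 0) + X l * dd i f"
  by (simp add: dd_mult)

lemma dd_CC_mult [simp]: "dd i (CC c * f) = CC c * dd i f"
  by (simp add: dd_mult)

text \<open>Divisibility propagates by a twisted Leibniz rule: a quotient for \<open>f\<close>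
  yields one for \<open>X l * f\<close>, with a correction when l is i or j.\<close>

lemma del_exists:
  fixes f :: "'n::finite pol"
  shows "\<exists>g. (X i - X j) * g = f - act (tr i j) f"
proof (induction f rule: pol_induct)
  case (const c)
  show ?case by (rule exI[of _ 0]) simp
next
  case (var l f)
  then obtain g where g: "(X i - X j) * g = f - act (tr i j) f" by blast
  have s: "act (tr i j) f = f - (X i - X j) * g" using g by simp
  consider "l = i" | "l = j" "l \<noteq> i" | "l \<noteq> i" "l \<noteq> j" by blast
  then show ?case
  proof cases
    case 1
    then show ?thesis by (intro exI[of _ "f + X j * g"]) (simp add: s algebra_simps)
  next
    case 2
    then show ?thesis by (intro exI[of _ "X i * g - f"]) (simp add: s algebra_simps)
  next
    case 3
    then show ?thesis by (intro exI[of _ "X l * g"]) (simp add: s algebra_simps)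
  qed
next
  case (add f1 f2)
  then obtain g1 g2 where "(X i - X j) * g1 = f1 - act (tr i j) f1" "(X i - X j) * g2 = f2 - act (tr i j) f2" by blast
  then show ?case by (intro exI[of _ "g1 + g2"]) (auto simp: algebra_simps)
qed

definition del :: "'n \<Rightarrow> 'n \<Rightarrow> 'n::finite pol \<Rightarrow> 'n pol" where
  "del i j f = (SOME g. (X i - X j) * g = f - act (tr i j) f)"

lemma del_eq: "(X i - X j) * del i j f = f - act (tr i j) f"
  unfolding del_def by (rule someI_ex[OF del_exists])

lemma del_eqI: "i \<noteq> j \<Longrightarrow> (X i - X j) * g = f - act (tr i j) f \<Longrightarrow> del i j f = g"
  by (rule X_diff_cancel[of i j]) (simp_all add: del_eq)

lemma del_CC [simp]: "i \<noteq> j \<Longrightarrow> del i j (CC c) = 0"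
  by (rule del_eqI) auto

lemma del_add [simp]: "i \<noteq> j \<Longrightarrow> del i j (f + g) = del i j f + del i j g"
  by (rule del_eqI) (auto simp: distrib_left del_eq)

lemma del_CC_mult [simp]: "i \<noteq> j \<Longrightarrow> del i j (CC c * f) = CC c * del i j f"
  by (rule del_eqI) (auto simp: mult.left_commute[of _ "CC c"] del_eq right_diff_distrib)

lemma del_X_mult:
  assumes "i \<noteq> j"
  shows "del i j (X l * f) = X l * del i j f +
    (if l = i then act (tr i j) f else if l = j then - act (tr i j) f else 0)"
proof (rule del_eqI[OF assms])
  have s: "act (tr i j) f = f - (X i - X j) * del i j f" by (simp add: del_eq)
  show "(X i - X j) * (X l * del i j f + (if l = i then act (tr i j) f else if l = j then - act (tr i j) f else 0)) =
    X l * f - act (tr i j) (X l * f)"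
    using assms by (cases "l = i"; cases "l = j") (simp_all add: s algebra_simps)
qed

lemma del_swap: "i \<noteq> j \<Longrightarrow> del j i f = - del i j f"
  using del_eq[of i j f] by (intro del_eqI) (auto simp: transpose_commute[of j i] left_diff_distrib)

lemma del_act_tr: "i \<noteq> j \<Longrightarrow> del i j (act (tr i j) f) = - del i j f"
  by (rule del_eqI) (simp_all add: del_eq)

lemma act_del:
  assumes "i \<noteq> j" "bij p"
  shows "act p (del i j f) = del (p i) (p j) (act p f)"
proof -
  have "p i \<noteq> p j" using assms by (simp add: bij_def inj_eq)
  moreover have "(X (p i) - X (p j)) * act p (del i j f) = act p ((X i - X j) * del i j f)" by simp
  ultimately show ?thesis
    by (intro del_eqI[symmetric]) (simp_all add: del_eq act_tr_conj assms)
qed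

lemma act_dd: "bij p \<Longrightarrow> act p (dd i f) = dd (p i) (act p f)"
  by (induction f rule: pol_induct) (auto simp: dd_X_mult bij_def inj_eq)

text \<open>Each operator below obtains its rules for 0, differences and finite sums from additivity
  alone, by instantiating these three lemmas.\<close>

lemma additive_diff: "(\<And>f g. L (f + g) = L f + L g) \<Longrightarrow> L (f - g) = L f - L g"
  for L :: "'a::ab_group_add \<Rightarrow> 'b::ab_group_add"
  by (metis add_diff_cancel diff_add_cancel)

lemma additive_zero: "(\<And>f g. L (f + g) = L f + L g) \<Longrightarrow> L 0 = 0"
  for L :: "'a::ab_group_add \<Rightarrow> 'b::ab_group_add"
  by (metis add_cancel_right_right)

lemma additive_sum: "(\<And>f g. L (f + g) = L f + L g) \<Longrightarrow> L (\<Sum>a\<in>A. F a) = (\<Sum>a\<in>A. L (F a))"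
  for L :: "'a::ab_group_add \<Rightarrow> 'b::ab_group_add"
  by (induction A rule: infinite_finite_induct) (auto simp: additive_zero)

lemmas dd_sum [simp] = additive_sum[of "dd i" for i, OF dd_add]

section \<open>Dunkl operators: commutation with multiplication and with each other\<close>

locale jack = fixes \<gamma> :: real assumes gamma_pos: "\<gamma> > 0"
begin

abbreviation gam :: "'n::finite pol" where "gam \<equiv> CC (complex_of_real \<gamma>)"

definition T :: "'n \<Rightarrow> 'n::finite pol \<Rightarrow> 'n pol" where
  "T i f = dd i f + gam * (\<Sum>j\<in>UNIV - {i}. del i j f)"

lemma T_add [simp]: "T i (f + g) = T i f + T i g"
  by (simp add: T_def sum.distrib algebra_simps)

lemmas T_linear [simp] =
  additive_diff[of "T i" for i, OF T_add]
  additive_zero[of "T i" for i, OF T_add]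
  additive_sum[of "T i" for i, OF T_add]

lemma T_CC [simp]: "T i (CC c) = 0"
  by (simp add: T_def)

lemma T_CC_mult [simp]: "T i (CC c * f) = CC c * T i f"
  by (simp add: T_def distrib_left mult.left_commute[of _ "CC c"] flip: sum_distrib_left)

text \<open>With \<open>T_X_mult_same\<close> these are the relations of the rational Cherednik
  algebra, from which the commutation of the Dunkl and Cherednik operators is derived.\<close>

lemma T_X_mult:
  assumes "i \<noteq> l"
  shows "T i (X l * f) = X l * T i f - gam * act (tr i l) f"
proof -
  have "(\<Sum>j\<in>UNIV - {i}. del i j (X l * f)) =
     (\<Sum>j\<in>UNIV - {i}. X l * del i j f + (if j = l then - act (tr i l) f else 0))"
    by (rule sum.cong) (use assms in \<open>auto simp: del_X_mult\<close>)
  also have "\<dots> = X l * (\<Sum>j\<in>UNIV - {i}. del i j f) - act (tr i l) f"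
    using assms by (simp add: sum.distrib sum_distrib_left)
  finally have eq: "(\<Sum>j\<in>UNIV - {i}. del i j (X l * f)) = X l * (\<Sum>j\<in>UNIV - {i}. del i j f) - act (tr i l) f" .
  show ?thesis using assms unfolding T_def dd_X_mult eq by (simp add: algebra_simps)
qed

lemma T_X_mult_same: "T i (X i * f) = X i * T i f + f + gam * (\<Sum>j\<in>UNIV - {i}. act (tr i j) f)"
proof -
  have "(\<Sum>j\<in>UNIV - {i}. del i j (X i * f)) = (\<Sum>j\<in>UNIV - {i}. X i * del i j f + act (tr i j) f)"
    by (rule sum.cong) (auto simp: del_X_mult)
  also have "\<dots> = X i * (\<Sum>j\<in>UNIV - {i}. del i j f) + (\<Sum>j\<in>UNIV - {i}. act (tr i j) f)"
    by (simp add: sum.distrib sum_distrib_left)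
  finally show ?thesis unfolding T_def dd_X_mult by (simp add: algebra_simps)
qed

lemma act_T:
  assumes "bij p"
  shows "act p (T i f) = T (p i) (act p f)"
proof -
  have "(\<Sum>j\<in>UNIV - {i}. del (p i) (p j) (act p f)) = (\<Sum>j\<in>UNIV - {p i}. del (p i) j (act p f))"
    by (rule sum.reindex_bij_betw, unfold bij_betw_def)
      (metis assms bij_is_inj bij_is_surj image_insert image_empty image_set_diff inj_on_subset subset_UNIV)
  then show ?thesis using assms by (simp add: T_def act_del act_dd)
qed

lemma act_tr_T: "act (tr i j) (T l f) = T (tr i j l) (act (tr i j) f)"
  by (rule act_T) simp

lemma T_comm_aux:
  assumes "i \<noteq> j" and IH: "T i (T j f) = T j (T i f)"
  shows "T i (T j (X i * f)) = T j (T i (X i * f))"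
proof -
  \<comment> \<open>For m other than i and j, s_im commutes with T_j, so these terms coincide on
    both sides and only those with s_ij have to be compared.\<close>
  define R where "R = (\<Sum>m\<in>UNIV - {i} - {j}. act (tr i m) (T j f))"
  have 1: "(\<Sum>m\<in>UNIV - {i}. act (tr i m) (T j f)) = act (tr i j) (T j f) + R"
    unfolding R_def using assms by (subst sum.remove[of _ j]) auto
  have "(\<Sum>m\<in>UNIV - {i}. T j (act (tr i m) f)) = T j (act (tr i j) f) + (\<Sum>m\<in>UNIV - {i} - {j}. T j (act (tr i m) f))"
    using assms by (subst sum.remove[of _ j]) auto
  also have "(\<Sum>m\<in>UNIV - {i} - {j}. T j (act (tr i m) f)) = R"
    unfolding R_def using assms by (intro sum.cong) (auto simp: act_tr_T)
  finally have 2: "(\<Sum>m\<in>UNIV - {i}. T j (act (tr i m) f)) = T j (act (tr i j) f) + R" .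
  have "T i (T j (X i * f)) = X i * T i (T j f) + T j f + gam * (act (tr i j) (T j f) + R) - gam * T i (act (tr i j) f)"
    using assms(1) by (simp add: T_X_mult T_X_mult_same transpose_commute[of j i] 1)
  moreover have "T j (T i (X i * f)) = X i * T j (T i f) - gam * act (tr i j) (T i f) + T j f + gam * (T j (act (tr i j) f) + R)"
    using assms(1) by (simp add: T_X_mult T_X_mult_same transpose_commute[of j i] 2)
  moreover have "act (tr i j) (T j f) = T i (act (tr i j) f)" "act (tr i j) (T i f) = T j (act (tr i j) f)"
    by (simp_all add: act_tr_T)
  ultimately show ?thesis by (simp add: IH algebra_simps)
qed

text \<open>The commutator of T_i and T_j kills constants and commutes with multiplication by every
  variable, hence vanishes. The only delicate variables are X_i and X_j, treated in
  \<open>T_comm_aux\<close>.\<close>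

lemma T_comm: "T i (T j f) = T j (T i f)"
proof (cases "i = j")
  case False
  show ?thesis
  proof (induction f rule: pol_induct)
    case (var l f)
    consider "l = i" | "l = j" | "l \<noteq> i" "l \<noteq> j" by blast
    then show ?case
    proof cases
      case 1
      then show ?thesis using T_comm_aux[OF False var] by simp
    next
      case 2
      then show ?thesis using T_comm_aux[OF False[symmetric] var[symmetric]] by simp
    next
      case 3
      then show ?thesis using False var by (simp add: T_X_mult act_tr_T)
    qed
  qed simp_all
qed simp

end

section \<open>The invariant Hermitian form\<close>

inductive homi :: "nat \<Rightarrow> 'n::finite pol \<Rightarrow> bool" where
  homi_const: "homi 0 (CC c)"
| homi_X: "homi k f \<Longrightarrow> homi (Suc k) (X i * f)"
| homi_add: "homi k f \<Longrightarrow> homi k g \<Longrightarrow> homi k (f + g)"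

lemma homi_0E: "homi 0 f \<Longrightarrow> \<exists>c. f = CC c"
  by (induction "0::nat" f rule: homi.induct) (auto simp flip: CC_simps(1))

lemma homi_scale: "homi k f \<Longrightarrow> homi k (CC c * f)"
proof (induction rule: homi.induct)
  case (homi_const c')
  then show ?case using homi.homi_const[of "c * c'"] by (simp add: CC_simps)
next
  case (homi_X k f i)
  then show ?case using homi.homi_X[of k "CC c * f" i] by (simp add: mult.left_commute)
qed (auto simp: distrib_left intro: homi.homi_add)

lemma homi_zero [simp]: "homi k 0"
proof (induction k)
  case 0
  then show ?case using homi_const[of 0] by (simp add: CC_simps)
next
  case (Suc k)
  then show ?case using homi_X[of k 0 undefined] by simp
qed

lemma homi_uminus: "homi k f \<Longrightarrow> homi k (- f)"
  using homi_scale[of k f "-1"] by (simp add: CC_simps)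

lemma homi_diff: "homi k f \<Longrightarrow> homi k g \<Longrightarrow> homi k (f - g)"
  using homi_add[OF _ homi_uminus] by fastforce

lemma homi_sum: "(\<And>a. a \<in> S \<Longrightarrow> homi k (f a)) \<Longrightarrow> homi k (sum f S)"
  by (induction S rule: infinite_finite_induct) (auto intro: homi_add)

lemma homi_act: "homi k f \<Longrightarrow> homi k (act p f)"
  by (induction rule: homi.induct) (auto intro: homi.intros)

lemma euler_identity: "homi k f \<Longrightarrow> (\<Sum>i\<in>UNIV. X i * dd i f) = CC (of_nat k) * f"
proof (induction rule: homi.induct)
  case (homi_X k f l)
  have "(\<Sum>i\<in>UNIV. X i * dd i (X l * f)) = (\<Sum>i\<in>UNIV. (if i = l then X l * f else 0) + X l * (X i * dd i f))"
    unfolding dd_X_mult by (intro sum.cong) (auto simp: distrib_left mult.left_commute)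
  also have "\<dots> = X l * f + X l * (\<Sum>i\<in>UNIV. X i * dd i f)"
    by (simp add: sum.distrib sum_distrib_left)
  finally show ?case by (simp add: homi_X CC_simps algebra_simps)
qed (simp_all add: CC_simps distrib_left sum.distrib)

lemma sum_offdiag_swap: "(\<Sum>i\<in>UNIV. \<Sum>j\<in>UNIV - {i}. F i j) = (\<Sum>i\<in>UNIV. \<Sum>j\<in>UNIV - {i}. F j i)"
  for F :: "'n::finite \<Rightarrow> 'n \<Rightarrow> 'b::comm_monoid_add"
  unfolding sum.Sigma[OF finite ballI[OF finite]]
  by (rule sum.reindex_bij_witness[of _ "\<lambda>(i,j). (j,i)" "\<lambda>(i,j). (j,i)"]) auto

lemma sum_offdiag_const: "(\<Sum>i\<in>(UNIV::'n::finite set). \<Sum>j\<in>UNIV - {i}. c) = of_nat (CARD('n) * (CARD('n) - 1)) * (c::'b::comm_ring_1)"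
  by (simp add: card_Diff_singleton of_nat_diff mult.assoc)

context jack
begin

lemma homi_T_aux: "homi m f \<Longrightarrow> (m = 0 \<longrightarrow> T i f = 0) \<and> (\<forall>k. m = Suc k \<longrightarrow> homi k (T i f))"
proof (induction rule: homi.induct)
  case (homi_X k f l)
  have 1: "homi k (X l * T i f)"
    by (cases k) (use homi_X in \<open>auto intro: homi.homi_X\<close>)
  have 2: "homi k (gam * act (tr i l) f)" "homi k (gam * (\<Sum>j\<in>UNIV - {i}. act (tr i j) f))"
    using homi_X.hyps by (auto intro!: homi_scale homi_act homi_sum)
  show ?case using 1 2 homi_X.hyps
    by (cases "i = l") (auto simp: T_X_mult T_X_mult_same intro: homi_add homi_diff)
qed (auto intro: homi_add)

lemma homi_T: "homi (Suc k) f \<Longrightarrow> homi k (T i f)"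
  using homi_T_aux by blast

text \<open>By the Euler identity a homogeneous f of degree k + 1 is 1/(k+1) times sum_i x_i d_i f;
  moving x_i to the other argument as T_i gives this recursion. It treats the arguments differently,
  so hermitian symmetry is a theorem.\<close>

primrec form :: "nat \<Rightarrow> 'n::finite pol \<Rightarrow> 'n pol \<Rightarrow> complex" where
  "form 0 f g = ev f 0 * cnj (ev g 0)"
| "form (Suc k) f g = (\<Sum>i\<in>UNIV. form k (dd i f) (T i g)) / of_nat (Suc k)"

lemma form_add_left [simp]: "form k (f + f') g = form k f g + form k f' g"
  by (induction k arbitrary: f f' g) (simp_all add: distrib_right sum.distrib add_divide_distrib del: of_nat_Suc)

lemma form_add_right [simp]: "form k f (g + g') = form k f g + form k f g'"
  by (induction k arbitrary: f g g') (simp_all add: distrib_left sum.distrib add_divide_distrib del: of_nat_Suc)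

lemma form_CC_left [simp]: "form k (CC c * f) g = c * form k f g"
  by (induction k arbitrary: f g) (simp_all add: sum_distrib_left del: of_nat_Suc)

lemma form_CC_right [simp]: "form k f (CC c * g) = cnj c * form k f g"
  by (induction k arbitrary: f g) (simp_all add: sum_distrib_left del: of_nat_Suc)

lemmas form_linear [simp] =
  additive_diff[of "\<lambda>f. form k f g" for k g, OF form_add_left]
  additive_zero[of "\<lambda>f. form k f g" for k g, OF form_add_left]
  additive_sum[of "\<lambda>f. form k f g" for k g, OF form_add_left]
  additive_diff[of "form k f" for k f, OF form_add_right]
  additive_zero[of "form k f" for k f, OF form_add_right]
  additive_sum[of "form k f" for k f, OF form_add_right]

declare form.simps(2) [simp del]

text \<open>Commutativity of the Dunkl operators carries T_j past T_i in the terms coming from X_j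
  d_i f. Together with the term from d_j X_j = 1 they give k + 2 equal copies in degree k + 2, which
  cancel the normalizing factor.\<close>

lemma form_X: "form (Suc k) (X j * f) g = form k f (T j g)"
proof (induction k arbitrary: f g)
  case 0
  have "(\<Sum>i\<in>UNIV. ev (dd i (X j * f)) 0 * cnj (ev (T i g) 0)) =
     (\<Sum>i\<in>UNIV. if i = j then ev f 0 * cnj (ev (T j g) 0) else 0)"
    by (rule sum.cong) (auto simp: dd_X_mult)
  then show ?case by (simp add: form.simps(2))
next
  case (Suc k)
  have "(\<Sum>i\<in>UNIV. form (Suc k) (dd i (X j * f)) (T i g)) =
    (\<Sum>i\<in>UNIV. (if i = j then form (Suc k) f (T j g) else 0) + form k (dd i f) (T i (T j g)))"
  proof (rule sum.cong)
    fix i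
    have "form (Suc k) (X j * dd i f) (T i g) = form k (dd i f) (T i (T j g))"
      by (simp only: Suc.IH T_comm[of i])
    then show "form (Suc k) (dd i (X j * f)) (T i g) =
       (if i = j then form (Suc k) f (T j g) else 0) + form k (dd i f) (T i (T j g))"
      by (simp add: dd_X_mult)
  qed simp
  also have "\<dots> = form (Suc k) f (T j g) + of_nat (Suc k) * form (Suc k) f (T j g)"
    by (simp add: sum.distrib form.simps(2)[of k f] del: of_nat_Suc)
  also have "\<dots> = of_nat (Suc (Suc k)) * form (Suc k) f (T j g)" 
    by (subst of_nat_Suc[of "Suc k"]) (simp add: distrib_right del: of_nat_Suc)
  finally show ?case by (subst form.simps(2)) (simp del: of_nat_Suc)
qed

lemma form_act: "bij p \<Longrightarrow> form k (act p f) (act p g) = form k f g"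
proof (induction k arbitrary: f g)
  case 0
  then show ?case by (simp add: ev_act zero_vec_def)
next
  case (Suc k)
  have "(\<Sum>i\<in>UNIV. form k (dd i (act p f)) (T i (act p g))) =
     (\<Sum>i\<in>UNIV. form k (dd (p i) (act p f)) (T (p i) (act p g)))"
    using Suc.prems by (intro sum.reindex_bij_betw[symmetric]) (simp add: bij_def bij_betw_def)
  then show ?case using Suc by (simp add: form.simps(2) flip: act_T act_dd del: of_nat_Suc)
qed

lemma form_act_tr: "form k (act (tr i j) f) g = form k f (act (tr i j) g)"
  using form_act[of "tr i j" k "act (tr i j) f" g] form_act[of "tr i j" k f "act (tr i j) g"] by simp

definition AA :: "'n::finite pol \<Rightarrow> 'n pol" where "AA f = (\<Sum>i\<in>UNIV. X i * T i f)"

definition SS :: "'n::finite pol \<Rightarrow> 'n pol" where "SS f = (\<Sum>i\<in>UNIV. \<Sum>j\<in>UNIV - {i}. act (tr i j) f)"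

abbreviation npairs :: "'n itself \<Rightarrow> real" where "npairs t \<equiv> real (card (UNIV::'n set) * (card (UNIV :: 'n set) - 1))"

text \<open>A deformed Euler identity. Adding the double sum to itself with i and j exchanged turns
  X_i del_ij f + X_j del_ji f into f - s_ij f. The coefficient of f exceeds gamma/2 * npairs, the
  total weight of the transpositions, by exactly k; the estimates below live on this gap.\<close>

lemma AA_eq:
  fixes f :: "'n::finite pol"
  assumes "homi k f"
  shows "AA f = CC (complex_of_real (real k + \<gamma> / 2 * npairs TYPE('n))) * f - CC (complex_of_real (\<gamma> / 2)) * SS f"
proof -
  define Q where "Q = (\<Sum>i\<in>(UNIV::'n set). \<Sum>j\<in>UNIV - {i}. X i * del i j f)"
  have "Q + Q = (\<Sum>i\<in>(UNIV::'n set). \<Sum>j\<in>UNIV - {i}. X i * del i j f) + (\<Sum>i\<in>(UNIV::'n set). \<Sum>j\<in>UNIV - {i}. X j * del j i f)"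
    unfolding Q_def using sum_offdiag_swap[of "\<lambda>i j. X i * del i j f"] by simp
  also have "\<dots> = (\<Sum>i\<in>(UNIV::'n set). \<Sum>j\<in>UNIV - {i}. f - act (tr i j) f)"
    unfolding sum.distrib[symmetric]
  proof (intro sum.cong refl)
    fix i j :: 'n assume "j \<in> UNIV - {i}"
    then have "del j i f = - del i j f" by (intro del_swap) auto
    then show "X i * del i j f + X j * del j i f = f - act (tr i j) f"
      using del_eq[of i j f] by (simp add: algebra_simps)
  qed
  also have "\<dots> = CC (of_real (npairs TYPE('n))) * f - SS f"
    unfolding sum_subtractf sum_offdiag_const SS_def by (simp add: of_nat_pol)
  finally have "CC (1/2) * (Q + Q) = CC (1/2) * (CC (of_real (npairs TYPE('n))) * f - SS f)" by simp
  also have "CC (1/2) * (Q + Q) = (CC (1/2) + CC (1/2)) * Q" by (simp only: distrib_left distrib_right)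
  also have "\<dots> = Q" by (simp flip: CC_simps(1)) (simp add: CC_simps)
  finally have Q: "Q = CC (1/2) * (CC (of_real (npairs TYPE('n))) * f - SS f)" .
  have "AA f = (\<Sum>i\<in>UNIV. X i * dd i f) + gam * Q"
    by (simp add: AA_def T_def Q_def distrib_left sum.distrib sum_distrib_left mult.left_commute)
  also have "\<dots> = CC (of_nat k) * f + gam * CC (1/2) * (CC (of_real (npairs TYPE('n))) * f - SS f)"
    using assms by (simp add: euler_identity Q)
  also have "\<dots> = CC (complex_of_real (real k + \<gamma> / 2 * npairs TYPE('n))) * f - CC (complex_of_real (\<gamma> / 2)) * SS f"
    by (rule pol_eqI) (simp add: algebra_simps)
  finally show ?thesis .
qed

lemma homi_SS: "homi k f \<Longrightarrow> homi k (SS f)"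
  unfolding SS_def by (intro homi_sum homi_act)

lemma form_SS: "form k (SS f) g = form k f (SS g)"
  by (simp add: SS_def form_act_tr)

lemma act_AA: "bij p \<Longrightarrow> act p (AA f) = AA (act p f)"
proof -
  assume p: "bij p"
  have "AA (act p f) = (\<Sum>i\<in>UNIV. X (p i) * T (p i) (act p f))"
    unfolding AA_def using p by (intro sum.reindex_bij_betw[symmetric]) (simp add: bij_def bij_betw_def)
  then show ?thesis using p by (simp add: AA_def act_T)
qed

lemma form_AA: "form (Suc k) (AA f) g = (\<Sum>i\<in>UNIV. form k (T i f) (T i g))"
  by (simp add: AA_def form_X)

lemma form_AA_sym: "homi k f \<Longrightarrow> homi k g \<Longrightarrow> form k (AA f) g = form k f (AA g)"
  by (simp add: AA_eq form_SS)

definition perms :: "('n::finite \<Rightarrow> 'n) set" where "perms = {p. bij p}"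

lemma perms_comp: "p \<in> perms \<Longrightarrow> q \<in> perms \<Longrightarrow> p \<circ> q \<in> perms"
  unfolding perms_def by (auto intro: bij_comp)

lemma perms_props [simp]: "finite (perms :: ('n::finite \<Rightarrow> 'n) set)" "id \<in> perms"
  "p \<in> perms \<Longrightarrow> p \<circ> tr i j \<in> perms" "p \<in> perms \<Longrightarrow> bij p"
  by (auto simp: perms_def bij_comp)

text \<open>Every summand of \<open>SS f\<close> is a permuted copy of f, so a bound valid on the
  whole orbit under permutations reproduces itself with the number of summands as factor.\<close>

lemma act_SS_bound:
  fixes F :: "'n::finite pol \<Rightarrow> complex"
  assumes add: "\<And>f g. F (f + g) = F f + F g" and M: "\<And>p. p \<in> perms \<Longrightarrow> norm (F (act p f)) \<le> M" and p: "p \<in> perms"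
  shows "norm (F (act p (SS f))) \<le> npairs TYPE('n) * M"
proof -
  have "norm (F (act p (SS f))) \<le> (\<Sum>i\<in>(UNIV::'n set). \<Sum>j\<in>UNIV - {i}. norm (F (act p (act (tr i j) f))))"
    by (simp add: SS_def additive_sum[of F, OF add] order_trans[OF norm_sum sum_mono] norm_sum)
  also have "\<dots> \<le> (\<Sum>i\<in>(UNIV::'n set). \<Sum>j\<in>UNIV - {i}. M)"
    using M p by (intro sum_mono) (simp add: act_act)
  finally show ?thesis unfolding sum_offdiag_const by simp
qed

text \<open>The symmetry defect F, for fixed g, is linear and vanishes on the image of
  \<open>AA\<close> by the induction hypothesis. Hence \<open>AA_eq\<close> expresses F on f through
  F on the transposed copies of f, and a copy where |F| is maximal shows that the maximum is
  0.\<close>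

lemma form_hermitian_step:
  fixes f g :: "'n::finite pol"
  assumes herm: "\<And>f g :: 'n pol. homi k f \<Longrightarrow> homi k g \<Longrightarrow> form k f g = cnj (form k g f)"
    and f: "homi (Suc k) f" and g: "homi (Suc k) g"
  shows "form (Suc k) f g = cnj (form (Suc k) g f)"
proof -
  define F where "F = (\<lambda>h. form (Suc k) h g - cnj (form (Suc k) g h))"
  have add: "F (h + h') = F h + F h'" for h h'
    by (simp add: F_def)
  have CC: "F (CC c * h) = c * F h" for c h
    by (simp add: F_def right_diff_distrib)
  have FA: "F (AA h) = 0" if h: "homi (Suc k) h" for h
  proof -
    have "form (Suc k) g (AA h) = form (Suc k) (AA g) h" using form_AA_sym[OF g h] by simp
    also have "\<dots> = (\<Sum>i\<in>UNIV. form k (T i g) (T i h))" by (rule form_AA)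
    also have "\<dots> = (\<Sum>i\<in>UNIV. cnj (form k (T i h) (T i g)))"
      by (intro sum.cong herm homi_T g h refl)
    finally show ?thesis by (simp add: F_def form_AA)
  qed
  define M where "M = Max ((\<lambda>p. norm (F (act p f))) ` perms)"
  have M: "norm (F (act p f)) \<le> M" if "p \<in> perms" for p
    unfolding M_def using that by (intro Max_ge) auto
  have "M \<in> (\<lambda>p. norm (F (act p f))) ` perms"
    unfolding M_def by (rule Max_in) (auto intro: perms_props(2))
  then obtain p where p: "p \<in> perms" "M = norm (F (act p f))" by blast
  define al where "al = real (Suc k) + \<gamma> / 2 * npairs TYPE('n)"
  have "AA (act p f) = CC (of_real al) * act p f - CC (of_real (\<gamma> / 2)) * SS (act p f)"
    unfolding al_def by (rule AA_eq) (rule homi_act[OF f])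
  then have "CC (of_real al) * act p f = AA (act p f) + CC (of_real (\<gamma> / 2)) * SS (act p f)"
    by simp
  then have "F (CC (of_real al) * act p f) = F (AA (act p f)) + F (CC (of_real (\<gamma> / 2)) * SS (act p f))"
    unfolding add[symmetric] by (rule arg_cong)
  then have eq: "of_real al * F (act p f) = of_real (\<gamma> / 2) * F (SS (act p f))"
    unfolding CC FA[OF homi_act[OF f]] by (simp only: add_0)
  have M': "norm (F (act q (act p f))) \<le> M" if "q \<in> perms" for q
  proof -
    have "q \<circ> p \<in> perms" using that p(1) by (rule perms_comp)
    then show ?thesis using M by (simp add: act_act)
  qed
  have "norm (F (act id (SS (act p f)))) \<le> npairs TYPE('n) * M"
    using act_SS_bound[of F "act p f" M id, OF add M'] by simp
  then have "\<gamma> / 2 * norm (F (SS (act p f))) \<le> \<gamma> / 2 * (npairs TYPE('n) * M)"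
    using gamma_pos by (intro mult_left_mono) auto
  moreover have "al > 0" unfolding al_def using gamma_pos by (intro add_pos_nonneg) auto
  ultimately have "al * M \<le> \<gamma> / 2 * npairs TYPE('n) * M"
    using arg_cong[OF eq, of norm] gamma_pos p(2) by (simp add: norm_mult)
  \<comment> \<open>The weight of the transpositions cancels and leaves the gap k + 1.\<close>
  then have "real (Suc k) * M \<le> 0" by (simp add: al_def algebra_simps)
  moreover have "M \<ge> 0" using p by simp
  ultimately have "M = 0" by (simp add: mult_le_0_iff)
  then show ?thesis using M[of id] by (simp add: F_def)
qed

text \<open>Write AA h = al (h - L h), where L is a positive multiple of the sum of transpositions.
  The form does not increase from h to L h, while its value at the iterates L^m f tends to 0; so its
  value at f is at least 0.\<close>

lemma form_psd_step:
  fixes f :: "'n::finite pol"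
  assumes herm: "\<And>f g :: 'n pol. homi k f \<Longrightarrow> homi k g \<Longrightarrow> form k f g = cnj (form k g f)"
    and psd: "\<And>f :: 'n pol. homi k f \<Longrightarrow> Re (form k f f) \<ge> 0"
    and f: "homi (Suc k) f"
  shows "Re (form (Suc k) f f) \<ge> 0"
proof -
  define N where "N = npairs TYPE('n)"
  define al where "al = real (Suc k) + \<gamma> / 2 * N"
  have al: "al > 0" "\<gamma> / 2 * N < al" "N \<ge> 0" unfolding al_def N_def using gamma_pos by (auto intro!: add_pos_nonneg)
  define L where "L = (\<lambda>h::'n pol. CC (of_real (\<gamma> / 2 / al)) * SS h)"
  define \<theta> where "\<theta> = \<gamma> / 2 * N / al"
  have th: "0 \<le> \<theta>" "\<theta> < 1" using al gamma_pos by (auto simp: \<theta>_def field_simps)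
  have homL: "homi (Suc k) (L h)" if "homi (Suc k) h" for h
    unfolding L_def by (intro homi_scale homi_SS that)
  define H where "H = (\<lambda>f g::'n pol. form (Suc k) (AA f) g)"
  have H_psd: "Re (H h h) \<ge> 0" if "homi (Suc k) h" for h
    unfolding H_def form_AA by (simp add: sum_nonneg psd homi_T[OF that])
  have H_herm: "H h h' = cnj (H h' h)" if "homi (Suc k) h" "homi (Suc k) h'" for h h'
    unfolding H_def form_AA cnj_sum by (intro sum.cong herm homi_T that refl)
  have H_act: "H (act (tr i j) h) (act (tr i j) h') = H h h'" for i j h h'
    unfolding H_def by (simp add: form_act flip: act_AA)
  have H_add: "H (h1 + h2) (h1 + h2) = H h1 h1 + H h1 h2 + H h2 h1 + H h2 h2" for h1 h2
    unfolding H_def form_AA by (simp add: sum.distrib)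
  \<comment> \<open>\<open>H\<close> is the form after \<open>AA\<close>, a sum of forms of degree
    k, and so positive semidefinite by hypothesis. Expanding \<open>H\<close> at h + s_ij h bounds
    the mixed term from below.\<close>
  have H_tr: "Re (H h (act (tr i j) h)) \<ge> - Re (H h h)" if h: "homi (Suc k) h" for i j h
  proof -
    have "H (act (tr i j) h) h = cnj (H h (act (tr i j) h))" using h by (intro H_herm homi_act)
    then have "Re (H (h + act (tr i j) h) (h + act (tr i j) h)) = 2 * Re (H h h) + 2 * Re (H h (act (tr i j) h))"
      unfolding H_add by (simp add: H_act)
    moreover have "Re (H (h + act (tr i j) h) (h + act (tr i j) h)) \<ge> 0"
      by (intro H_psd homi_add h homi_act)
    ultimately show ?thesis by simp
  qed
  \<comment> \<open>By the symmetry of L the difference of the two values is the form of h - L h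
    with h + L h, that is, 1/al times H h (h + L h). The transpositions in L h can lower H h h by
    the factor \<theta> < 1 at most.\<close>
  have decr: "Re (form (Suc k) (L h) (L h)) \<le> Re (form (Suc k) h h)" if h: "homi (Suc k) h" for h
  proof -
    have "AA h = CC (of_real al) * h - CC (of_real (\<gamma> / 2)) * SS h"
      unfolding al_def N_def by (rule AA_eq[OF h])
    also have "\<dots> = CC (of_real al) * (h - L h)"
      using al by (intro pol_eqI) (simp add: L_def algebra_simps)
    finally have AA: "AA h = CC (of_real al) * (h - L h)" .
    have sym: "form (Suc k) h (L h) = form (Suc k) (L h) h"
      by (simp add: L_def form_SS)
    have "al * (Re (form (Suc k) h h) - Re (form (Suc k) (L h) (L h))) = Re (H h (h + L h))"
      unfolding H_def AA by (simp add: sym) (simp add: algebra_simps)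
    also have "\<dots> = Re (H h h) + \<gamma> / 2 / al * (\<Sum>i\<in>(UNIV::'n set). \<Sum>j\<in>UNIV - {i}. Re (H h (act (tr i j) h)))"
      unfolding H_def L_def SS_def by simp
    also have "\<dots> \<ge> Re (H h h) + \<gamma> / 2 / al * (\<Sum>i\<in>(UNIV::'n set). \<Sum>j\<in>UNIV - {i}. - Re (H h h))"
      using al gamma_pos by (intro add_left_mono mult_left_mono sum_mono H_tr h) auto
    also have "Re (H h h) + \<gamma> / 2 / al * (\<Sum>i\<in>(UNIV::'n set). \<Sum>j\<in>UNIV - {i}. - Re (H h h)) = (1 - \<theta>) * Re (H h h)"
      unfolding sum_offdiag_const N_def[symmetric] by (simp add: \<theta>_def algebra_simps)
    finally have "al * (Re (form (Suc k) h h) - Re (form (Suc k) (L h) (L h))) \<ge> (1 - \<theta>) * Re (H h h)" .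
    moreover have "(1 - \<theta>) * Re (H h h) \<ge> 0" using th H_psd[OF h] by simp
    ultimately show ?thesis using al(1) by (smt (verit) mult_pos_neg)
  qed
  have homLm: "homi (Suc k) ((L ^^ m) f)" for m
    by (induction m) (auto intro: homL f)
  have mono: "Re (form (Suc k) ((L ^^ m) f) ((L ^^ m) f)) \<le> Re (form (Suc k) f f)" for m
  proof (induction m)
    case (Suc m)
    show ?case using decr[OF homLm[of m]] Suc by simp
  qed simp
  \<comment> \<open>With no norm at hand, the decay of L^m f is measured by the form on pairs of
    permuted copies; each L, in either argument, gains a factor \<theta>.\<close>
  define M where "M = Max ((\<lambda>(p,q). norm (form (Suc k) (act p f) (act q f))) ` (perms \<times> perms))"
  have M0: "norm (form (Suc k) (act p f) (act q f)) \<le> M" if "p \<in> perms" "q \<in> perms" for p q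
    unfolding M_def using that by (intro Max_ge) auto
  have Lbound: "norm (F (act p (L h))) \<le> \<theta> * C"
    if "\<And>f g. F (f + g) = F f + F g" "\<And>c f. norm (F (CC c * f)) = norm c * norm (F f)"
      "\<And>p. p \<in> perms \<Longrightarrow> norm (F (act p h)) \<le> C" "p \<in> perms" for F :: "'n pol \<Rightarrow> complex" and C h p
  proof -
    have "norm (F (act p (L h))) = \<gamma> / 2 / al * norm (F (act p (SS h)))"
      unfolding L_def act_simps that(2) norm_of_real using al gamma_pos by simp
    also have "\<dots> \<le> \<gamma> / 2 / al * (N * C)"
      unfolding N_def using al gamma_pos by (intro mult_left_mono act_SS_bound[of F, OF that(1,3,4)]) auto
    finally show ?thesis by (simp add: \<theta>_def)
  qed
  have bound: "norm (form (Suc k) (act p ((L ^^ m) f)) (act q ((L ^^ m) f))) \<le> \<theta> ^ m * (\<theta> ^ m * M)"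
    if "p \<in> perms" "q \<in> perms" for p q m
  proof -
    have 1: "norm (form (Suc k) (act p ((L ^^ m) f)) (act q f)) \<le> \<theta> ^ m * M" if "p \<in> perms" "q \<in> perms" for p q
      using that
    proof (induction m arbitrary: p)
      case (Suc m)
      show ?case
        using Lbound[of "\<lambda>h. form (Suc k) h (act q f)", OF _ _ Suc.IH] Suc.prems
        by (simp add: norm_mult mult.assoc)
    qed (use M0 in \<open>simp\<close>)
    have "norm (form (Suc k) (act p ((L ^^ m) f)) (act q ((L ^^ l) f))) \<le> \<theta> ^ l * (\<theta> ^ m * M)" for l
      using that
    proof (induction l arbitrary: q)
      case (Suc l)
      show ?case
        using Lbound[of "form (Suc k) (act p ((L ^^ m) f))", OF _ _ Suc.IH] Suc.prems
        by (simp add: norm_mult mult.assoc)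
    qed (use 1 in \<open>simp\<close>)
    then show ?thesis .
  qed
  have lower: "- (\<theta> ^ m * (\<theta> ^ m * M)) \<le> Re (form (Suc k) f f)" for m
    using mono[of m] bound[of id id m] abs_Re_le_cmod[of "form (Suc k) ((L ^^ m) f) ((L ^^ m) f)"]
    by simp
  have "(\<lambda>m. - (\<theta> ^ m * (\<theta> ^ m * M))) \<longlonglongrightarrow> - (0 * (0 * M))"
    using th by (intro tendsto_intros LIMSEQ_realpow_zero) auto
  then have "- (0 * (0 * M)) \<le> Re (form (Suc k) f f)"
    by (rule LIMSEQ_le_const2) (use lower in blast)
  then show ?thesis by simp
qed

lemma form_herm_psd:
  fixes f g :: "'n::finite pol"
  shows "(homi k f \<longrightarrow> homi k g \<longrightarrow> form k f g = cnj (form k g f)) \<and> (homi k f \<longrightarrow> Re (form k f f) \<ge> 0)"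
proof (induction k arbitrary: f g)
  case (Suc k)
  have herm: "form k f g = cnj (form k g f)" if "homi k f" "homi k g" for f g :: "'n pol"
    by (rule mp[OF mp[OF conjunct1[OF Suc.IH]]]) (use that in auto)
  have psd: "Re (form k f f) \<ge> 0" if "homi k f" for f :: "'n pol"
    by (rule mp[OF conjunct2[OF Suc.IH]]) (use that in auto)
  show ?case
    by (intro conjI impI form_hermitian_step[OF herm] form_psd_step[OF herm psd])
qed simp

lemma form_hermitian: "homi k f \<Longrightarrow> homi k g \<Longrightarrow> form k f g = cnj (form k g f)"
  by (rule mp[OF mp[OF conjunct1[OF form_herm_psd]]])

definition qf :: "nat \<Rightarrow> 'n::finite pol \<Rightarrow> real" where "qf k f = Re (form k f f)"

lemma qf_nonneg: "homi k f \<Longrightarrow> qf k f \<ge> 0"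
  unfolding qf_def by (rule mp[OF conjunct2[OF form_herm_psd]])

lemma form_self: "homi k f \<Longrightarrow> form k f f = of_real (qf k f)"
  using arg_cong[OF form_hermitian[of k f f], of Im] by (simp add: qf_def complex_eq_iff)

lemma qf_act: "bij p \<Longrightarrow> qf k (act p f) = qf k f"
  by (simp add: qf_def form_act)

text \<open>The left side is the form of \<open>AA f\<close> with f. Nonnegativity at f + s_ij f
  bounds the contribution of each transposition. The final coarsening separates the factor k + 1,
  which builds up the factorial in \<open>ev_le_qf\<close>.\<close>

lemma qf_T_sum:
  fixes f :: "'n::finite pol"
  assumes f: "homi (Suc k) f"
  shows "(\<Sum>i\<in>UNIV. qf k (T i f)) \<le> real (Suc k) * (1 + \<gamma> * npairs TYPE('n)) * qf (Suc k) f"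
proof -
  define N where "N = npairs TYPE('n)"
  have N: "N \<ge> 0" by (simp add: N_def)
  have ge: "Re (form (Suc k) (act (tr i j) f) f) \<ge> - qf (Suc k) f" for i j
  proof -
    have "form (Suc k) (act (tr i j) f) f = form (Suc k) f (act (tr i j) f)" by (rule form_act_tr)
    then have "qf (Suc k) (f + act (tr i j) f) = 2 * qf (Suc k) f + 2 * Re (form (Suc k) (act (tr i j) f) f)"
      by (simp add: qf_def form_act)
    moreover have "qf (Suc k) (f + act (tr i j) f) \<ge> 0" by (intro qf_nonneg homi_add homi_act f)
    ultimately show ?thesis by simp
  qed
  have "(\<Sum>i\<in>UNIV. qf k (T i f)) = Re (form (Suc k) (AA f) f)"
    by (simp add: form_AA qf_def)
  also have "\<dots> = (real (Suc k) + \<gamma> / 2 * N) * qf (Suc k) f - \<gamma> / 2 * Re (form (Suc k) (SS f) f)"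
    unfolding AA_eq[OF f] by (simp add: qf_def N_def)
  also have "Re (form (Suc k) (SS f) f) = (\<Sum>i\<in>(UNIV::'n set). \<Sum>j\<in>UNIV - {i}. Re (form (Suc k) (act (tr i j) f) f))"
    by (simp add: SS_def)
  also have "(real (Suc k) + \<gamma> / 2 * N) * qf (Suc k) f - \<gamma> / 2 * \<dots> \<le> (real (Suc k) + \<gamma> / 2 * N) * qf (Suc k) f
      - \<gamma> / 2 * (\<Sum>i\<in>(UNIV::'n set). \<Sum>j\<in>UNIV - {i}. - qf (Suc k) f)"
    using gamma_pos by (intro diff_left_mono mult_left_mono sum_mono ge) auto
  also have "\<dots> = (real (Suc k) + \<gamma> * N) * qf (Suc k) f"
    unfolding sum_offdiag_const N_def[symmetric] by (simp add: algebra_simps)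
  also have "\<dots> \<le> real (Suc k) * (1 + \<gamma> * N) * qf (Suc k) f"
    using N gamma_pos qf_nonneg[OF f] by (intro mult_right_mono) (auto simp: algebra_simps)
  finally show ?thesis by (simp add: N_def)
qed

text \<open>The cost of one induction step of \<open>ev_le_qf\<close>: a sum over n variables times
  the square root of the constant in \<open>qf_T_sum\<close>.\<close>

definition bern :: "'n::finite itself \<Rightarrow> real" where
  "bern t = real CARD('n) * sqrt (1 + \<gamma> * npairs TYPE('n))"

lemma bern_nonneg: "bern TYPE('n::finite) \<ge> 0"
  unfolding bern_def using gamma_pos by simp

text \<open>At a permuted copy h of f with maximal |h(x)|, the transposed copies in
  \<open>AA_eq\<close> are no larger at x, so (k+1) |h(x)| is at most |AA h(x)|, hence at most the
  sum of |x_i| |T_i h(x)|. Induction applies to T_i h, and \<open>qf_T_sum\<close> bounds its norm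
  by that of h, which equals the norm of f.\<close>

lemma ev_le_qf:
  fixes f :: "'n::finite pol"
  assumes "homi k f" "\<And>i. norm (x $ i) \<le> R" "R \<ge> 0"
  shows "norm (ev f x) * sqrt (fact k) \<le> (bern TYPE('n) * R) ^ k * sqrt (qf k f)"
  using assms
proof (induction k arbitrary: f)
  case 0
  then obtain c where "f = CC c" using homi_0E by blast
  then show ?case by (simp add: qf_def complex_mult_cnj cmod_def)
next
  case (Suc k)
  define N where "N = npairs TYPE('n)"
  define b where "b = bern TYPE('n) * R"
  have b: "b \<ge> 0" using bern_nonneg[where 'n='n] Suc.prems by (simp add: b_def)
  define M where "M = Max ((\<lambda>p. norm (ev (act p f) x)) ` perms)"
  have M: "norm (ev (act p f) x) \<le> M" if "p \<in> perms" for p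
    unfolding M_def using that by (intro Max_ge) auto
  have "M \<in> (\<lambda>p. norm (ev (act p f) x)) ` perms"
    unfolding M_def by (rule Max_in) (auto intro: perms_props(2))
  then obtain p where p: "p \<in> perms" "M = norm (ev (act p f) x)" by blast
  define h where "h = act p f"
  have h: "homi (Suc k) h" unfolding h_def by (rule homi_act) (rule Suc.prems)
  have qh: "qf (Suc k) h = qf (Suc k) f" unfolding h_def using p by (intro qf_act) simp
  have M': "norm (ev (act q h) x) \<le> M" if "q \<in> perms" for q
  proof -
    have "q \<circ> p \<in> perms" using that p(1) by (rule perms_comp)
    then show ?thesis unfolding h_def using M by (simp add: act_act)
  qed
  have "norm (ev (act id (SS h)) x) \<le> N * M"
    unfolding N_def using act_SS_bound[of "\<lambda>h. ev h x" h M id, OF _ M'] by simp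
  then have "\<gamma> / 2 * norm (ev (SS h) x) \<le> \<gamma> / 2 * (N * M)"
    using gamma_pos by (intro mult_left_mono) auto
  moreover have "(real (Suc k) + \<gamma> / 2 * N) * M \<le> norm (ev (AA h) x) + \<gamma> / 2 * norm (ev (SS h) x)"
  proof -
    have "complex_of_real (real (Suc k) + \<gamma> / 2 * N) * ev h x = ev (AA h) x + of_real (\<gamma> / 2) * ev (SS h) x"
      unfolding AA_eq[OF h] N_def by simp
    then have "norm (complex_of_real (real (Suc k) + \<gamma> / 2 * N) * ev h x) \<le> norm (ev (AA h) x) + norm (complex_of_real (\<gamma> / 2) * ev (SS h) x)"
      by (metis norm_triangle_ineq)
    moreover have "real (Suc k) + \<gamma> / 2 * N \<ge> 0" using gamma_pos by (simp add: N_def)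
    ultimately show ?thesis using gamma_pos p unfolding norm_mult norm_of_real h_def by simp
  qed
  ultimately have "real (Suc k) * M \<le> norm (ev (AA h) x)" by (simp add: algebra_simps)
  also have "\<dots> \<le> (\<Sum>i\<in>UNIV. norm (x $ i) * norm (ev (T i h) x))"
    unfolding AA_def by (simp add: norm_mult norm_sum order_trans[OF norm_sum])
  finally have "real (Suc k) * M * sqrt (fact k) \<le> (\<Sum>i\<in>UNIV. norm (x $ i) * norm (ev (T i h) x)) * sqrt (fact k)"
    by (intro mult_right_mono) auto
  also have "\<dots> = (\<Sum>i\<in>UNIV. norm (x $ i) * (norm (ev (T i h) x) * sqrt (fact k)))"
    by (simp add: sum_distrib_right mult.assoc)
  also have "\<dots> \<le> (\<Sum>i\<in>(UNIV::'n set). R * (b ^ k * sqrt (real (Suc k) * (1 + \<gamma> * N) * qf (Suc k) f)))"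
  proof (rule sum_mono, rule mult_mono)
    fix i
    have "qf k (T i h) \<le> (\<Sum>i\<in>UNIV. qf k (T i h))"
      by (intro member_le_sum qf_nonneg homi_T h) auto
    also have "\<dots> \<le> real (Suc k) * (1 + \<gamma> * N) * qf (Suc k) h" unfolding N_def by (rule qf_T_sum[OF h])
    finally have "sqrt (qf k (T i h)) \<le> sqrt (real (Suc k) * (1 + \<gamma> * N) * qf (Suc k) f)" by (simp add: qh)
    then show "norm (ev (T i h) x) * sqrt (fact k) \<le> b ^ k * sqrt (real (Suc k) * (1 + \<gamma> * N) * qf (Suc k) f)"
      using Suc.prems b
      by (intro order_trans[OF Suc.IH[OF homi_T[OF h]]]) (auto simp: b_def intro!: mult_left_mono)
  qed (use Suc.prems in auto)
  also have "\<dots> = sqrt (real (Suc k)) * (b ^ Suc k * sqrt (qf (Suc k) f))"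
    by (simp add: b_def bern_def N_def real_sqrt_mult)
  finally have le: "real (Suc k) * M * sqrt (fact k) \<le> sqrt (real (Suc k)) * (b ^ Suc k * sqrt (qf (Suc k) f))" .
  have "sqrt (real (Suc k)) * (M * (sqrt (real (Suc k)) * sqrt (fact k))) = (sqrt (real (Suc k)) * sqrt (real (Suc k))) * M * sqrt (fact k)"
    by (simp only: mult_ac)
  also have "sqrt (real (Suc k)) * sqrt (real (Suc k)) = real (Suc k)"
    by (rule real_sqrt_mult_self[THEN trans]) simp
  finally have "sqrt (real (Suc k)) * (M * (sqrt (real (Suc k)) * sqrt (fact k))) \<le> sqrt (real (Suc k)) * (b ^ Suc k * sqrt (qf (Suc k) f))"
    using le by (simp only:)
  then have "M * (sqrt (real (Suc k)) * sqrt (fact k)) \<le> b ^ Suc k * sqrt (qf (Suc k) f)"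
    by (rule mult_left_le_imp_le) simp
  then have "M * sqrt (fact (Suc k)) \<le> b ^ Suc k * sqrt (qf (Suc k) f)"
    by (simp add: real_sqrt_mult)
  moreover have "norm (ev f x) * sqrt (fact (Suc k)) \<le> M * sqrt (fact (Suc k))"
    using M[of id] by (intro mult_right_mono) auto
  ultimately show ?case unfolding b_def by linarith
qed

text \<open>Semidefiniteness becomes definiteness because the norm controls all values.\<close>

lemma qf_eq_0D: "homi k f \<Longrightarrow> qf k f = 0 \<Longrightarrow> f = 0"
  for f :: "'n::finite pol"
proof (rule pol_eqI)
  fix x :: "complex ^ 'n" assume f: "homi k f" "qf k f = 0"
  have "norm (ev f x) * sqrt (fact k) \<le> (bern TYPE('n) * (\<Sum>i\<in>UNIV. norm (x $ i))) ^ k * sqrt (qf k f)"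
    by (rule ev_le_qf[OF f(1)]) (auto intro: member_le_sum sum_nonneg)
  then show "ev f x = ev 0 x" using f fact_gt_zero[of k, where 'a = real] by (auto simp: mult_le_0_iff)
qed

end

section \<open>Cherednik operators\<close>

context jack
begin

definition y :: "'n \<Rightarrow> 'n::finite pol \<Rightarrow> 'n pol" where "y i f = X i * T i f"

lemma y_add [simp]: "y i (f + g) = y i f + y i g" and y_CC_mult [simp]: "y i (CC c * f) = CC c * y i f"
  by (simp_all add: y_def distrib_left mult.left_commute)

lemmas y_sum [simp] = additive_sum[of "y i" for i, OF y_add]

lemma act_y: "bij p \<Longrightarrow> act p (y i f) = y (p i) (act p f)"
  by (simp add: y_def act_T)

lemma homi_y: "homi k f \<Longrightarrow> homi k (y i f)"
  using homi_T_aux[of k f i] by (cases k) (auto simp: y_def intro: homi_X)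

lemma form_y:
  assumes "homi k f" "homi k g"
  shows "form k (y i f) g = form k f (y i g)"
proof (cases k)
  case 0
  then show ?thesis using homi_T_aux[OF assms(1)] homi_T_aux[OF assms(2)] by (simp add: y_def)
next
  case (Suc m)
  \<comment> \<open>\<open>form_X\<close> removes a variable from the first argument only; hermitian
    symmetry brings the second argument there.\<close>
  have "form (Suc m) f (X i * T i g) = cnj (form (Suc m) (X i * T i g) f)"
    by (rule form_hermitian) (use assms Suc in \<open>auto intro: homi_X homi_T\<close>)
  also have "\<dots> = cnj (form m (T i g) (T i f))" by (simp add: form_X)
  also have "\<dots> = form m (T i f) (T i g)"
    by (rule form_hermitian[symmetric]) (use assms Suc in \<open>auto intro: homi_T\<close>)
  finally show ?thesis by (simp add: y_def Suc form_X)
qed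

lemma y_y: "i \<noteq> j \<Longrightarrow> y i (y j f) = X i * X j * T i (T j f) - gam * y i (act (tr i j) f)"
proof -
  assume ij: "i \<noteq> j"
  have "act (tr i j) (T j f) = T i (act (tr i j) f)" by (simp add: act_tr_T)
  then show ?thesis using ij
    by (simp add: y_def T_X_mult right_diff_distrib mult.assoc mult.left_commute[of "X i" gam])
qed

text \<open>If S consists of the variables preceding a in some order, this is the Cherednik operator
  of a for that order. Keeping S as a parameter allows different orders to be compared.\<close>

definition xi :: "'n set \<Rightarrow> 'n \<Rightarrow> 'n::finite pol \<Rightarrow> 'n pol" where
  "xi S a f = y a f + gam * (\<Sum>l\<in>S. act (tr a l) f)"

lemma xi_add [simp]: "xi S a (f + g) = xi S a f + xi S a g"
  and xi_CC_mult [simp]: "xi S a (CC c * f) = CC c * xi S a f"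
  by (simp_all add: xi_def sum.distrib distrib_left mult.left_commute[of _ "CC c"] flip: sum_distrib_left)

lemmas xi_linear [simp] =
  additive_diff[of "xi S i" for S i, OF xi_add]
  additive_sum[of "xi S i" for S i, OF xi_add]

lemma act_xi:
  assumes "bij p"
  shows "act p (xi S a f) = xi (p ` S) (p a) (act p f)"
proof -
  have "(\<Sum>l\<in>p ` S. act (tr (p a) l) (act p f)) = (\<Sum>l\<in>S. act (tr (p a) (p l)) (act p f))"
    by (rule sum.reindex_cong[of p]) (use assms in \<open>auto intro: inj_on_subset bij_is_inj\<close>)
  then show ?thesis using assms by (simp add: xi_def act_y act_tr_conj)
qed

lemma act_tr_xi: "a \<notin> S \<Longrightarrow> b \<notin> S \<Longrightarrow> act (tr a b) (xi S c f) = xi S (tr a b c) (act (tr a b) f)"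
  by (subst act_xi) (auto intro!: arg_cong2[of _ _ _ _ "\<lambda>S. xi S _"] simp: image_iff Transposition.transpose_def)

lemma homi_xi: "homi k f \<Longrightarrow> homi k (xi S a f)"
  unfolding xi_def by (intro homi_add homi_y homi_scale homi_sum homi_act)

lemma form_xi: "homi k f \<Longrightarrow> homi k g \<Longrightarrow> form k (xi S a f) g = form k f (xi S a g)"
  by (simp add: xi_def form_y form_act_tr)

lemma xi_insert: "b \<notin> S \<Longrightarrow> xi (insert b S) a f = xi S a f + gam * act (tr a b) f"
  by (simp add: xi_def distrib_left)

lemma tr_three_cycle:
  assumes "a \<noteq> b" "l \<noteq> a" "l \<noteq> b"
  shows "tr a l \<circ> tr b l = tr b l \<circ> tr a b" "tr b l \<circ> tr a l = tr a l \<circ> tr a b"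
  using assms by (auto simp: fun_eq_iff Transposition.transpose_def)

lemma tr_disjoint_comm: "{a, l} \<inter> {b, m} = {} \<Longrightarrow> tr a l \<circ> tr b m = tr b m \<circ> tr a l"
  by (auto simp: fun_eq_iff Transposition.transpose_def)

lemma xi_xi:
  assumes "a \<noteq> b" "a \<notin> S" "b \<notin> S"
  shows "xi S a (xi S b f) = y a (y b f) + gam * (\<Sum>l\<in>S. act (tr b l) (y a f)) + gam * (\<Sum>l\<in>S. act (tr a l) (y b f))
     + gam * (gam * (\<Sum>l\<in>S. \<Sum>m\<in>S. act (tr a l) (act (tr b m) f)))"
proof -
  have "(\<Sum>l\<in>S. y a (act (tr b l) f)) = (\<Sum>l\<in>S. act (tr b l) (y a f))"
    by (intro sum.cong refl) (use assms in \<open>auto simp: act_y Transposition.transpose_def\<close>)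
  then show ?thesis unfolding xi_def
    by (simp add: distrib_left sum.distrib flip: sum_distrib_left)
qed

text \<open>Without its transpositions, [y_a, y_b] is given by \<open>y_y\<close>; the double sum
  over S adds the same kind of term for each l in S.\<close>

lemma xi_commutator:
  assumes "a \<noteq> b" "a \<notin> S" "b \<notin> S"
  shows "xi S a (xi S b f) - xi S b (xi S a f) = - gam * (xi S a (act (tr a b) f) - xi S b (act (tr a b) f))"
proof -
  define R where "R = (\<lambda>l. act (tr a l) (act (tr a b) f) - act (tr b l) (act (tr a b) f))"
  have "(\<Sum>l\<in>S. \<Sum>m\<in>S. act (tr a l) (act (tr b m) f)) - (\<Sum>l\<in>S. \<Sum>m\<in>S. act (tr b l) (act (tr a m) f))
    = (\<Sum>l\<in>S. \<Sum>m\<in>S. act (tr a l) (act (tr b m) f) - act (tr b m) (act (tr a l) f))"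
    unfolding sum_subtractf by (subst sum.swap[of "\<lambda>l m. act (tr b m) (act (tr a l) f)"]) simp
  \<comment> \<open>Disjoint transpositions commute, so only the diagonal survives, where products
    of two transpositions are three-cycles that can be rewritten with s_ab on the right.\<close>
  also have "\<dots> = (\<Sum>l\<in>S. \<Sum>m\<in>S. if m = l then - R l else 0)"
  proof (intro sum.cong refl)
    fix l m assume lm: "l \<in> S" "m \<in> S"
    show "act (tr a l) (act (tr b m) f) - act (tr b m) (act (tr a l) f) = (if m = l then - R l else 0)"
    proof (cases "m = l")
      case True
      have "l \<noteq> a" "l \<noteq> b" using lm assms by auto
      then show ?thesis using True assms tr_three_cycle[of a b l] by (simp add: R_def act_act)
    next
      case False
      have "tr a l \<circ> tr b m = tr b m \<circ> tr a l"
        by (rule tr_disjoint_comm) (use False lm assms in auto)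
      then show ?thesis using False by (simp add: act_act)
    qed
  qed
  also have "\<dots> = - sum R S"
    by (simp add: sum_negf)
  finally have 1: "(\<Sum>l\<in>S. \<Sum>m\<in>S. act (tr a l) (act (tr b m) f)) = (\<Sum>l\<in>S. \<Sum>m\<in>S. act (tr b l) (act (tr a m) f)) - sum R S"
    by (simp add: algebra_simps)
  have 2: "xi S a (act (tr a b) f) - xi S b (act (tr a b) f) = y a (act (tr a b) f) - y b (act (tr a b) f) + gam * sum R S"
    unfolding xi_def R_def sum_subtractf by (simp add: algebra_simps)
  have 3: "y a (y b f) = X a * X b * T a (T b f) - gam * y a (act (tr a b) f)"
    "y b (y a f) = X a * X b * T a (T b f) - gam * y b (act (tr a b) f)"
    using y_y[OF assms(1)] y_y[OF assms(1)[symmetric]]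
    by (simp_all add: T_comm[of b a] transpose_commute[of b a] mult.commute[of "X b" "X a"])
  show ?thesis
    unfolding 2 xi_xi[OF assms] xi_xi[OF assms(1)[symmetric] assms(3,2)] 1 3
    by (simp add: algebra_simps)
qed

definition opu :: "complex \<Rightarrow> 'n set \<Rightarrow> 'n \<Rightarrow> 'n::finite pol \<Rightarrow> 'n pol" where
  "opu u S a f = CC u * f + xi S a f"

lemma opu_add [simp]: "opu u S a (f + g) = opu u S a f + opu u S a g"
  and opu_CC_mult [simp]: "opu u S a (CC c * f) = CC c * opu u S a f"
  by (simp_all add: opu_def distrib_left mult.left_commute)

text \<open>Exchanging two neighbours in the order changes which of the two operators carries s_ab,
  and \<open>xi_commutator\<close> is exactly the compensation.\<close>

lemma opu_swap:
  assumes "a \<noteq> b" "a \<notin> S" "b \<notin> S"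
  shows "opu u S a (opu u (insert a S) b f) = opu u S b (opu u (insert b S) a f)"
  using xi_commutator[OF assms, of f] assms
  by (simp add: opu_def xi_insert transpose_commute[of b a]) (simp add: algebra_simps)

text \<open>Cherednik operators of one order commute. Apart from S, the larger set S' contains a,
  whose transposition cancels the commutator over S, and further indices, whose transpositions with
  b commute with \<open>xi S a\<close>.\<close>

lemma xi_comm:
  assumes "insert a S \<subseteq> S'" "a \<notin> S" "b \<notin> S'"
  shows "xi S a (xi S' b f) = xi S' b (xi S a f)"
proof -
  define R where "R = S' - insert a S"
  have S': "xi S' b g = xi S b g + gam * act (tr b a) g + gam * (\<Sum>r\<in>R. act (tr b r) g)" for g
  proof -
    have "S' = insert a S \<union> R" "insert a S \<inter> R = {}" using assms by (auto simp: R_def)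
    then have "(\<Sum>l\<in>S'. act (tr b l) g) = (\<Sum>l\<in>insert a S. act (tr b l) g) + (\<Sum>r\<in>R. act (tr b r) g)"
      by (metis finite sum.union_disjoint)
    then show ?thesis using assms by (simp add: xi_def distrib_left)
  qed
  have "b \<notin> S" "a \<noteq> b" using assms by auto
  have "(\<Sum>r\<in>R. xi S a (act (tr b r) f)) = (\<Sum>r\<in>R. act (tr b r) (xi S a f))"
  proof (intro sum.cong refl)
    fix r assume "r \<in> R"
    then show "xi S a (act (tr b r) f) = act (tr b r) (xi S a f)"
      using assms by (subst act_tr_xi) (auto simp: R_def Transposition.transpose_def)
  qed
  moreover have "act (tr b a) (xi S a f) = xi S b (act (tr b a) f)"
    using \<open>b \<notin> S\<close> assms by (subst act_tr_xi) auto
  ultimately show ?thesis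
    using xi_commutator[OF \<open>a \<noteq> b\<close> \<open>a \<notin> S\<close> \<open>b \<notin> S\<close>, of f]
    by (simp add: S' transpose_commute[of a b]) (simp add: algebra_simps)
qed

lemma opu_comm:
  assumes "insert a S \<subseteq> S'" "a \<notin> S" "b \<notin> S'"
  shows "opu u S a (opu u S' b f) = opu u S' b (opu u S a f)"
  using xi_comm[OF assms, of f] by (simp add: opu_def) (simp add: algebra_simps)

text \<open>The product of the factors u + xi along a list, each xi taken relative to S and the
  preceding entries; as a polynomial in u it generates the elementary symmetric functions of the
  Cherednik operators.\<close>

primrec zop :: "complex \<Rightarrow> 'n set \<Rightarrow> 'n list \<Rightarrow> 'n::finite pol \<Rightarrow> 'n pol" where
  "zop u S [] f = f"
| "zop u S (a # as) f = opu u S a (zop u (insert a S) as f)"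

lemma zop_add [simp]: "zop u S as (f + g) = zop u S as f + zop u S as g"
  and zop_CC_mult [simp]: "zop u S as (CC c * f) = CC c * zop u S as f"
  by (induction as arbitrary: S) simp_all

lemma zop_move:
  "distinct (a # bs @ cs) \<Longrightarrow> set (a # bs @ cs) \<inter> S = {} \<Longrightarrow> zop u S (bs @ a # cs) f = zop u S (a # bs @ cs) f"
proof (induction bs arbitrary: S)
  case (Cons b bs)
  have "zop u S ((b # bs) @ a # cs) f = opu u S b (zop u (insert b S) (a # bs @ cs) f)"
    using Cons by auto
  also have "\<dots> = opu u S b (opu u (insert b S) a (zop u (insert a (insert b S)) (bs @ cs) f))"
    by simp
  also have "\<dots> = opu u S a (opu u (insert a S) b (zop u (insert a (insert b S)) (bs @ cs) f))"
    by (rule opu_swap) (use Cons.prems in auto)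
  finally show ?case by (simp add: insert_commute)
qed simp

text \<open>Independence of the order is the source of the later flexibility: for every monomial and
  every variable the most convenient order may be chosen.\<close>

lemma zop_mset_cong:
  "mset as = mset bs \<Longrightarrow> distinct as \<Longrightarrow> set as \<inter> S = {} \<Longrightarrow> zop u S as f = zop u S bs f"
proof (induction as arbitrary: bs S)
  case (Cons a as)
  then have "a \<in> set bs" by (metis list.set_intros(1) set_mset_mset)
  then obtain xs ys where bs: "bs = xs @ a # ys" by (meson split_list)
  have m: "mset as = mset (xs @ ys)" using Cons.prems(1) by (simp add: bs)
  then have "distinct (xs @ ys)" "set as = set (xs @ ys)" using Cons.prems(2)
    by (metis distinct.simps(2) mset_eq_imp_distinct_iff, metis mset_eq_setD)
  then have "zop u S bs f = zop u S (a # xs @ ys) f"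
    unfolding bs using Cons.prems by (intro zop_move) auto
  also have "\<dots> = zop u S (a # as) f"
    using Cons.IH[OF m, of "insert a S"] Cons.prems by simp
  finally show ?case by simp
qed simp

lemma act_zop: "bij p \<Longrightarrow> act p (zop u S as f) = zop u (p ` S) (map p as) (act p f)"
  by (induction as arbitrary: S) (simp_all add: opu_def act_xi)

lemma homi_zop: "homi k f \<Longrightarrow> homi k (zop u S as f)"
  by (induction as arbitrary: S) (auto simp: opu_def intro!: homi_add homi_scale homi_xi)

lemma opu_zop_comm:
  "insert a S \<subseteq> S' \<Longrightarrow> a \<notin> S \<Longrightarrow> set bs \<inter> S' = {} \<Longrightarrow> distinct bs \<Longrightarrow>
    opu u S a (zop u S' bs f) = zop u S' bs (opu u S a f)"
proof (induction bs arbitrary: S')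
  case (Cons b bs)
  have "opu u S a (zop u S' (b # bs) f) = opu u S' b (opu u S a (zop u (insert b S') bs f))"
    using Cons.prems opu_comm[of a S S' b u "zop u (insert b S') bs f"] by simp
  also have "opu u S a (zop u (insert b S') bs f) = zop u (insert b S') bs (opu u S a f)"
    by (rule Cons.IH) (use Cons.prems in auto)
  finally show ?case by simp
qed simp

text \<open>Taking adjoints reverses the order of the factors, and \<open>opu_zop_comm\<close>
  restores it. The parameter is real since the second argument conjugates scalars.\<close>

lemma form_zop:
  assumes "homi k f" "homi k g"
  shows "distinct as \<Longrightarrow> set as \<inter> S = {} \<Longrightarrow>
    form k (zop (complex_of_real u) S as f) g = form k f (zop (complex_of_real u) S as g)"
  using assms
proof (induction as arbitrary: S f g)
  case (Cons a as)
  have adj: "form k (opu (of_real u) S a f) g = form k f (opu (of_real u) S a g)" if "homi k f" "homi k g" for f g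
    using that by (simp add: opu_def form_xi)
  have "form k (zop (of_real u) S (a # as) f) g = form k (zop (of_real u) (insert a S) as f) (opu (of_real u) S a g)"
    using Cons.prems by (simp add: adj homi_zop)
  also have "\<dots> = form k f (zop (of_real u) (insert a S) as (opu (of_real u) S a g))"
    by (rule Cons.IH) (use Cons.prems in \<open>auto simp: opu_def intro!: homi_add homi_scale homi_xi\<close>)
  also have "zop (of_real u) (insert a S) as (opu (of_real u) S a g) = zop (of_real u) S (a # as) g"
    using Cons.prems by (auto simp: opu_zop_comm[of a S "insert a S"])
  finally show ?case .
qed simp

definition univ_list :: "'n::finite list" where
  "univ_list = (SOME as. distinct as \<and> set as = UNIV)"

lemma univ_list: "distinct (univ_list :: 'n::finite list)" "set (univ_list :: 'n list) = UNIV"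
  using someI_ex[OF finite_distinct_list[of "UNIV :: 'n set"], folded conj_commute]
  unfolding univ_list_def by (smt (verit, ccfv_threshold) finite_distinct_list finite someI_ex)+

definition Zop :: "complex \<Rightarrow> 'n::finite pol \<Rightarrow> 'n pol" where "Zop u f = zop u {} univ_list f"

lemma Zop_eq: "distinct as \<Longrightarrow> set as = UNIV \<Longrightarrow> Zop u f = zop u {} as f"
  unfolding Zop_def
  by (rule zop_mset_cong) (simp_all add: univ_list set_eq_iff_mset_eq_distinct[symmetric])

lemma Zop_add [simp]: "Zop u (f + g) = Zop u f + Zop u g"
  and Zop_CC_mult [simp]: "Zop u (CC c * f) = CC c * Zop u f"
  by (simp_all add: Zop_def)

lemmas Zop_sum [simp] = additive_sum[of "Zop u" for u, OF Zop_add]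

text \<open>Conjugation by p only reorders the list of variables.\<close>

lemma act_Zop: "bij p \<Longrightarrow> act p (Zop u f) = Zop u (act p f)"
proof -
  assume p: "bij p"
  have "act p (Zop u f) = zop u {} (map p univ_list) (act p f)"
    using p by (simp add: Zop_def act_zop)
  also have "\<dots> = Zop u (act p f)"
    using p by (intro Zop_eq[symmetric])
      (auto simp: distinct_map univ_list bij_is_surj intro: inj_on_subset[OF bij_is_inj])
  finally show ?thesis .
qed

lemma form_Zop: "homi k f \<Longrightarrow> homi k g \<Longrightarrow> form k (Zop (complex_of_real u) f) g = form k f (Zop (complex_of_real u) g)"
  unfolding Zop_def by (rule form_zop) (auto simp: univ_list)

text \<open>The term -gamma X_a s_ai from the Dunkl operator cancels the transposition with i in S,
  so pulling out X_i removes i from S.\<close>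

lemma xi_X_mult:
  assumes "a \<noteq> i" "i \<in> S" "a \<notin> S"
  shows "xi S a (X i * f) = X i * xi (S - {i}) a f"
proof -
  have "(\<Sum>l\<in>S. act (tr a l) (X i * f)) = act (tr a i) (X i * f) + (\<Sum>l\<in>S - {i}. act (tr a l) (X i * f))"
    using assms by (subst sum.remove[of _ i]) auto
  also have "(\<Sum>l\<in>S - {i}. act (tr a l) (X i * f)) = (\<Sum>l\<in>S - {i}. X i * act (tr a l) f)"
    by (intro sum.cong refl) (use assms in \<open>auto simp: Transposition.transpose_def\<close>)
  also have "\<dots> = X i * (\<Sum>l\<in>S - {i}. act (tr a l) f)" by (simp add: sum_distrib_left)
  finally have 1: "(\<Sum>l\<in>S. act (tr a l) (X i * f)) = X a * act (tr a i) f + X i * (\<Sum>l\<in>S - {i}. act (tr a l) f)"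
    using assms by simp
  have 2: "y a (X i * f) = X a * (X i * T a f - gam * act (tr a i) f)"
    using assms by (simp add: y_def T_X_mult)
  have "xi S a (X i * f) = X a * (X i * T a f - gam * act (tr a i) f)
     + gam * (X a * act (tr a i) f + X i * (\<Sum>l\<in>S - {i}. act (tr a l) f))"
    unfolding xi_def 1 2 ..
  then show ?thesis unfolding xi_def y_def by (simp add: algebra_simps)
qed

text \<open>The Cherednik operator of i when i comes last in the order.\<close>

definition ze :: "'n \<Rightarrow> 'n::finite pol \<Rightarrow> 'n pol" where "ze i f = xi (UNIV - {i}) i f"

lemma xi_X_mult_same: "xi {} i (X i * f) = X i * (f + ze i f)"
  unfolding ze_def xi_def y_def T_X_mult_same by (simp add: algebra_simps)

lemma zop_X_mult:
  "i \<in> S \<Longrightarrow> set as \<inter> S = {} \<Longrightarrow> distinct as \<Longrightarrow> zop u S as (X i * f) = X i * zop u (S - {i}) as f"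
proof (induction as arbitrary: S)
  case (Cons a as)
  have "zop u (insert a S) as (X i * f) = X i * zop u (insert a S - {i}) as f"
    using Cons.prems by (intro Cons.IH) auto
  moreover have "insert a S - {i} = insert a (S - {i})" "a \<noteq> i" using Cons.prems by auto
  ultimately show ?case using Cons.prems by (simp add: opu_def xi_X_mult) (simp add: algebra_simps)
qed simp

lemma zop_snoc: "zop u S (as @ [i]) f = zop u S as (opu u (S \<union> set as) i f)"
  by (induction as arbitrary: S) simp_all

text \<open>Put i first to pull X_i out of all factors: the first factor becomes u + 1 + ze_i, the
  others lose i from their sets. The remaining factors together with u + ze_i form
  \<open>Zop\<close> in an order with i last.\<close>

lemma Zop_X:
  fixes f :: "'n::finite pol"
  shows "Zop u (X i * (CC u * f + ze i f)) = X i * (CC (u + 1) * Zop u f + ze i (Zop u f))"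
proof -
  obtain as where as: "distinct as" "set as = (UNIV::'n set) - {i}"
    using finite_distinct_list[of "(UNIV::'n set) - {i}"] by auto
  define g where "g = CC u * f + ze i f"
  define h where "h = zop u {} as g"
  have "Zop u (X i * g) = zop u {} (i # as) (X i * g)"
    using as by (intro Zop_eq) auto
  also have "\<dots> = opu u {} i (X i * h)"
    using as by (simp add: zop_X_mult h_def)
  also have "\<dots> = X i * (CC (u + 1) * h + ze i h)"
    by (simp add: opu_def xi_X_mult_same CC_simps) (simp add: algebra_simps)
  also have "h = zop u {} (as @ [i]) f"
    by (simp add: h_def zop_snoc g_def opu_def ze_def as)
  also have "\<dots> = Zop u f"
    using as by (intro Zop_eq[symmetric]) auto
  finally show ?thesis by (simp add: g_def)
qed

section \<open>The Jack operator\<close>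

definition sym :: "'n::finite pol \<Rightarrow> bool" where "sym f \<longleftrightarrow> (\<forall>p. bij p \<longrightarrow> act p f = f)"

lemma symD: "sym f \<Longrightarrow> bij p \<Longrightarrow> act p f = f" by (simp add: sym_def)

lemma sym_tr [simp]: "sym f \<Longrightarrow> act (tr i j) f = f" by (simp add: sym_def)

text \<open>The bridge to the differential equation in the definition: on symmetric homogeneous
  polynomials it differs from \<open>jack_op\<close> by a scalar
  (\<open>jack_op_ev\<close>).\<close>

definition Y2 :: "'n::finite pol \<Rightarrow> 'n pol" where "Y2 f = (\<Sum>i\<in>UNIV. y i (y i f))"

lemma Y2_add [simp]: "Y2 (f + g) = Y2 f + Y2 g" and Y2_CC_mult [simp]: "Y2 (CC c * f) = CC c * Y2 f"
  by (simp_all add: Y2_def sum.distrib sum_distrib_left)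

lemmas Y2_sum [simp] = additive_sum[of Y2, OF Y2_add]

lemma act_Y2: "bij p \<Longrightarrow> act p (Y2 f) = Y2 (act p f)"
proof -
  assume p: "bij p"
  have "Y2 (act p f) = (\<Sum>i\<in>UNIV. y (p i) (y (p i) (act p f)))"
    unfolding Y2_def using p by (intro sum.reindex_bij_betw[symmetric]) (simp add: bij_def bij_betw_def)
  then show ?thesis using p by (simp add: Y2_def act_y)
qed

lemma form_Y2: "homi k f \<Longrightarrow> homi k g \<Longrightarrow> form k (Y2 f) g = form k f (Y2 g)"
  by (simp add: Y2_def form_y homi_y)

lemma T_sym: "sym f \<Longrightarrow> T i f = dd i f"
proof -
  assume s: "sym f"
  have "del i j f = 0" if "j \<noteq> i" for j
    by (rule del_eqI) (use that s in auto)
  then show ?thesis by (simp add: T_def)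
qed

lemma jack_op_ev:
  fixes f :: "'n::finite pol"
  assumes s: "sym f" and h: "homi k f" and x: "\<And>i j. i \<noteq> j \<Longrightarrow> x $ i \<noteq> x $ j"
  shows "jack_op (1 / \<gamma>) (ev f) x = ev (Y2 f) x + (of_real \<gamma> * (of_nat CARD('n) - 1) - 1) * of_nat k * ev f x"
proof -
  define g where "g = (\<lambda>i. x $ i * ev (dd i f) x)"
  have sumg: "(\<Sum>i\<in>UNIV. g i) = of_nat k * ev f x"
    using arg_cong[OF euler_identity[OF h], of "\<lambda>p. ev p x"] by (simp add: g_def)
  have delg: "ev (del i j (X i * dd i f)) x = (g i - g j) / (x $ i - x $ j)" if "j \<noteq> i" for i j
  proof -
    have "act (tr i j) (X i * dd i f) = X j * dd j f"
      using s by (simp add: act_dd)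
    then have "(x $ i - x $ j) * ev (del i j (X i * dd i f)) x = g i - g j"
      using arg_cong[OF del_eq[of i j "X i * dd i f"], of "\<lambda>p. ev p x"] by (simp add: g_def)
    then show ?thesis using x[of i j] that by (simp add: field_simps)
  qed
  have yy: "ev (y i (y i f)) x = g i + (x $ i)\<^sup>2 * ev (dd i (dd i f)) x
     + of_real \<gamma> * (\<Sum>j\<in>UNIV - {i}. x $ i * g i / (x $ i - x $ j) - x $ i * g j / (x $ i - x $ j))" for i
  proof -
    have "ev (y i (y i f)) x = x $ i * (ev (dd i f) x + x $ i * ev (dd i (dd i f)) x
       + of_real \<gamma> * (\<Sum>j\<in>UNIV - {i}. ev (del i j (X i * dd i f)) x))"
      unfolding y_def T_sym[OF s] by (simp add: T_def dd_X_mult)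
    also have "(\<Sum>j\<in>UNIV - {i}. ev (del i j (X i * dd i f)) x) = (\<Sum>j\<in>UNIV - {i}. (g i - g j) / (x $ i - x $ j))"
      by (intro sum.cong delg) auto
    also have "x $ i * (ev (dd i f) x + x $ i * ev (dd i (dd i f)) x + of_real \<gamma> * \<dots>)
      = g i + (x $ i)\<^sup>2 * ev (dd i (dd i f)) x + of_real \<gamma> * (x $ i * (\<Sum>j\<in>UNIV - {i}. (g i - g j) / (x $ i - x $ j)))"
      by (simp add: g_def power2_eq_square algebra_simps)
    also have "x $ i * (\<Sum>j\<in>UNIV - {i}. (g i - g j) / (x $ i - x $ j)) =
       (\<Sum>j\<in>UNIV - {i}. x $ i * g i / (x $ i - x $ j) - x $ i * g j / (x $ i - x $ j))"
      unfolding sum_distrib_left by (intro sum.cong) (auto simp: right_diff_distrib diff_divide_distrib)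
    finally show ?thesis .
  qed
  have "(\<Sum>i\<in>UNIV. \<Sum>j\<in>UNIV - {i}. x $ i * g i / (x $ i - x $ j) - x $ i * g j / (x $ i - x $ j)) =
    (\<Sum>i\<in>UNIV. \<Sum>j\<in>UNIV - {i}. x $ i * g i / (x $ i - x $ j)) - (\<Sum>i\<in>UNIV. \<Sum>j\<in>UNIV - {i}. x $ j * g i / (x $ j - x $ i))"
    unfolding sum_subtractf using sum_offdiag_swap[of "\<lambda>i j. x $ i * g j / (x $ i - x $ j)"] by simp
  \<comment> \<open>(x_i + x_j)/(x_i - x_j) equals 2 x_i/(x_i - x_j) - 1; the -1 yields, by Euler's
    identity, the scalar by which the two operators differ.\<close>
  also have "\<dots> = (\<Sum>i\<in>UNIV. \<Sum>j\<in>UNIV - {i}. 2 * (x $ i * g i / (x $ i - x $ j)) - g i)"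
    unfolding sum_subtractf[symmetric]
  proof (intro sum.cong refl)
    fix i j :: 'n assume "j \<in> UNIV - {i}"
    then have "x $ i - x $ j \<noteq> 0" "x $ j - x $ i \<noteq> 0" using x[of i j] by auto
    then show "x $ i * g i / (x $ i - x $ j) - x $ j * g i / (x $ j - x $ i) = 2 * (x $ i * g i / (x $ i - x $ j)) - g i"
      by (simp add: divide_simps) (simp add: algebra_simps)
  qed
  also have "\<dots> = 2 * (\<Sum>i\<in>UNIV. \<Sum>j\<in>UNIV - {i}. x $ i * g i / (x $ i - x $ j)) - (of_nat CARD('n) - 1) * (\<Sum>i\<in>UNIV. g i)"
    by (simp add: sum_subtractf sum_distrib_left card_Diff_singleton of_nat_diff)
  finally have off: "(\<Sum>i\<in>UNIV. \<Sum>j\<in>UNIV - {i}. x $ i * g i / (x $ i - x $ j) - x $ i * g j / (x $ i - x $ j)) = \<dots>" .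
  have "ev (Y2 f) x = of_nat k * ev f x + (\<Sum>i\<in>UNIV. (x $ i)\<^sup>2 * ev (dd i (dd i f)) x)
     + of_real \<gamma> * (2 * (\<Sum>i\<in>UNIV. \<Sum>j\<in>UNIV - {i}. x $ i * g i / (x $ i - x $ j)) - (of_nat CARD('n) - 1) * (of_nat k * ev f x))"
    unfolding Y2_def ev_sum yy sum.distrib sumg sum_distrib_left[symmetric] off ..
  moreover have "jack_op (1 / \<gamma>) (ev f) x = (\<Sum>i\<in>UNIV. (x $ i)\<^sup>2 * ev (dd i (dd i f)) x)
     + of_real (2 * \<gamma>) * (\<Sum>i\<in>UNIV. \<Sum>j\<in>UNIV - {i}. x $ i * g i / (x $ i - x $ j))"
    unfolding jack_op_def partial_ev g_def by (simp add: power2_eq_square mult.assoc)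
  ultimately show ?thesis by (simp add: algebra_simps)
qed

end

section \<open>Monomials and dominance\<close>

definition mon :: "('n \<Rightarrow> nat) \<Rightarrow> 'n::finite pol" where "mon e = (\<Prod>i\<in>UNIV. X i ^ e i)"

lemma act_mono: "bij p \<Longrightarrow> act p (mon e) = mon (e \<circ> inv p)"
proof -
  assume p: "bij p"
  have "mon (e \<circ> inv p) = (\<Prod>i\<in>UNIV. X (p i) ^ (e \<circ> inv p) (p i))"
    unfolding mon_def using p by (intro prod.reindex_bij_betw[symmetric]) (simp add: bij_def bij_betw_def)
  then show ?thesis using p by (simp add: mon_def bij_is_inj)
qed

lemma act_tr_mono: "act (tr i j) (mon e) = mon (e \<circ> tr i j)"
  by (subst act_mono) auto

lemma mono_upd2:
  assumes "i \<noteq> j"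
  shows "mon (e(i := a, j := b)) = (\<Prod>l\<in>UNIV - {i, j}. X l ^ e l) * X i ^ a * X j ^ b"
proof -
  have "mon (e(i := a, j := b)) = (\<Prod>l\<in>insert i (insert j (UNIV - {i, j})). X l ^ (e(i := a, j := b)) l)"
    unfolding mon_def by (rule prod.cong) auto
  also have "\<dots> = X i ^ a * (X j ^ b * (\<Prod>l\<in>UNIV - {i, j}. X l ^ e l))"
    using assms by (simp del: insert_Diff_single insert_Diff1)
  finally show ?thesis by (simp add: mult_ac)
qed

lemma del_mono:
  assumes "i \<noteq> j" "e j \<le> e i"
  shows "del i j (mon e) = (\<Sum>s<e i - e j. mon (e(i := e j + s, j := e i - 1 - s)))"
proof (rule del_eqI[OF assms(1)])
  define m where "m = (\<Prod>l\<in>UNIV - {i, j}. X l ^ e l)"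
  define d where "d = e i - e j"
  have ei: "e i = e j + d" using assms by (simp add: d_def)
  have "(X i - X j) * (\<Sum>s<d. mon (e(i := e j + s, j := e i - 1 - s)))
     = (X i - X j) * (\<Sum>s<d. (m * X i ^ e j * X j ^ e j) * (X j ^ (d - Suc s) * X i ^ s))"
  proof (intro arg_cong[of _ _ "\<lambda>t. (X i - X j) * t"] sum.cong refl)
    fix s assume "s \<in> {..<d}"
    then have "e i - 1 - s = e j + (d - Suc s)" by (simp add: ei)
    then show "mon (e(i := e j + s, j := e i - 1 - s)) = (m * X i ^ e j * X j ^ e j) * (X j ^ (d - Suc s) * X i ^ s)"
      by (simp only: mono_upd2[OF assms(1)] m_def[symmetric] power_add mult_ac)
  qed
  also have "\<dots> = (m * X i ^ e j * X j ^ e j) * (X i ^ d - X j ^ d)"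
    unfolding power_diff_sumr2 sum_distrib_left[symmetric] by (rule mult.left_commute)
  also have "\<dots> = mon (e(i := e i, j := e j)) - mon (e(i := e j, j := e i))"
    unfolding mono_upd2[OF assms(1)] m_def[symmetric] ei power_add by (simp add: algebra_simps)
  also have "e(i := e j, j := e i) = e \<circ> tr i j"
    using assms(1) by (auto simp: fun_eq_iff Transposition.transpose_def)
  finally show "(X i - X j) * (\<Sum>s<e i - e j. mon (e(i := e j + s, j := e i - 1 - s))) = mon e - act (tr i j) (mon e)"
    by (simp only: d_def act_tr_mono fun_upd_triv)
qed

text \<open>The exponents at i and j move between their old values; the last summand, if any, is
  \<open>mon e\<close> itself. In \<open>X_del_mono_lt\<close> it is the monomial with both
  exponents exchanged.\<close>

lemma X_del_mono_ge:
  assumes "i \<noteq> j" "e j \<le> e i"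
  shows "X i * del i j (mon e) = (\<Sum>s<e i - e j. mon (e(i := e j + s + 1, j := e i - 1 - s)))"
  unfolding del_mono[of i j e, OF assms] sum_distrib_left
  by (simp add: mono_upd2[OF assms(1)] mult_ac)

lemma X_del_mono_lt:
  assumes "i \<noteq> j" "e i < e j"
  shows "X i * del i j (mon e) = - (\<Sum>s<e j - e i. mon (e(i := e i + s + 1, j := e j - 1 - s)))"
proof -
  have "X i * del i j (mon e) = - (X i * del i j (mon (e \<circ> tr i j)))"
    using del_act_tr[OF assms(1), of "mon e"] by (simp add: act_tr_mono)
  also have "X i * del i j (mon (e \<circ> tr i j)) = (\<Sum>s<e j - e i. mon ((e \<circ> tr i j)(i := e i + s + 1, j := e j - 1 - s)))"
    using X_del_mono_ge[of i j "e \<circ> tr i j"] assms by simp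
  also have "\<dots> = (\<Sum>s<e j - e i. mon (e(i := e i + s + 1, j := e j - 1 - s)))"
    by (intro sum.cong arg_cong[of _ _ mon]) (auto simp: fun_eq_iff Transposition.transpose_def)
  finally show ?thesis .
qed

lemma X_dd_power: "X i * dd i (X l ^ k) = (if l = i then CC (of_nat k) else 0) * X l ^ k"
proof (induction k)
  case 0
  show ?case using dd_CC[of i 1] by (simp add: CC_simps)
next
  case (Suc k)
  have "X i * dd i (X l ^ Suc k) = (if l = i then X l ^ Suc k else 0) + X l * (X i * dd i (X l ^ k))"
    by (simp add: dd_X_mult distrib_left mult_ac)
  then show ?case unfolding Suc by (simp add: CC_simps algebra_simps)
qed

lemma X_dd_mono: "X i * dd i (mon e) = CC (of_nat (e i)) * mon e"
proof -
  have "X i * dd i (\<Prod>l\<in>A. X l ^ e l) = (if i \<in> A then CC (of_nat (e i)) else 0) * (\<Prod>l\<in>A. X l ^ e l)"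
    if "finite A" for A
    using that
  proof (induction A)
    case empty
    show ?case using dd_CC[of i 1] by (simp add: CC_simps)
  next
    case (insert l A)
    have *: "X i * dd i (P * Q) = (X i * dd i P) * Q + P * (X i * dd i Q)" for P Q
      unfolding dd_mult by (simp add: algebra_simps)
    show ?case unfolding prod.insert[OF insert.hyps] * insert.IH X_dd_power
      using insert.hyps by (auto simp: algebra_simps)
  qed
  from this[of UNIV] show ?thesis by (simp add: mon_def)
qed

inductive mspan :: "('n \<Rightarrow> nat) set \<Rightarrow> 'n::finite pol \<Rightarrow> bool" for D where
  mspan_zero: "mspan D 0"
| mspan_mono: "e \<in> D \<Longrightarrow> mspan D (CC c * mon e)"
| mspan_add: "mspan D f \<Longrightarrow> mspan D g \<Longrightarrow> mspan D (f + g)"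

lemma mspan_mono1: "e \<in> D \<Longrightarrow> mspan D (mon e)"
  using mspan_mono[of e D 1] by (simp add: CC_simps)

lemma mspan_scale: "mspan D f \<Longrightarrow> mspan D (CC c * f)"
proof (induction rule: mspan.induct)
  case (mspan_mono e c')
  then show ?case using mspan.mspan_mono[of e D "c * c'"] by (simp add: CC_simps mult_ac)
qed (auto simp: distrib_left intro: mspan.intros)

lemma mspan_uminus: "mspan D f \<Longrightarrow> mspan D (- f)"
  using mspan_scale[of D f "-1"] by (simp add: CC_simps)

lemma mspan_diff: "mspan D f \<Longrightarrow> mspan D g \<Longrightarrow> mspan D (f - g)"
  using mspan_add[OF _ mspan_uminus] by fastforce

lemma mspan_sum: "(\<And>a. a \<in> S \<Longrightarrow> mspan D (f a)) \<Longrightarrow> mspan D (sum f S)"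
  by (induction S rule: infinite_finite_induct) (auto intro: mspan.intros)

lemma mspan_subset: "mspan D f \<Longrightarrow> D \<subseteq> D' \<Longrightarrow> mspan D' f"
  by (induction rule: mspan.induct) (auto intro: mspan.intros)

lemma mspan_map:
  assumes "mspan D f" and add: "\<And>f g. L (f + g) = L f + L g" and CC: "\<And>c f. L (CC c * f) = CC c * L f"
    and L: "\<And>e. e \<in> D \<Longrightarrow> mspan D' (L (mon e))"
  shows "mspan D' (L f)"
  using assms(1)
proof (induction rule: mspan.induct)
  case mspan_zero
  then show ?case using additive_zero[of L, OF add] by (simp add: mspan.mspan_zero)
next
  case (mspan_mono e c)
  then show ?case unfolding CC by (intro mspan_scale L)
next
  case (mspan_add f g)
  then show ?case unfolding add by (intro mspan.mspan_add)
qed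

lemma homi_prod_power: "finite A \<Longrightarrow> homi (\<Sum>i\<in>A. e i) (\<Prod>i\<in>A. X i ^ e i)"
proof (induction A rule: finite_induct)
  case empty
  show ?case using homi_const[of 1] by (simp add: CC_simps)
next
  case (insert i A)
  have "homi (m + k) (X i ^ m * g)" if "homi k g" for m k and g :: "'a pol"
    using that by (induction m) (auto simp: mult.assoc intro: homi_X)
  then show ?case using insert by simp
qed

lemma mspan_homi: "mspan D f \<Longrightarrow> (\<And>e. e \<in> D \<Longrightarrow> (\<Sum>i\<in>UNIV. e i) = k) \<Longrightarrow> homi k f"
proof (induction rule: mspan.induct)
  case (mspan_mono e c)
  then show ?case using homi_scale[OF homi_prod_power[of UNIV e]] by (simp add: mon_def)
qed (auto intro: homi_add)

lemma homi_mspan: "homi k f \<Longrightarrow> mspan {e. (\<Sum>i\<in>UNIV. e i) = k} f"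
proof (induction rule: homi.induct)
  case (homi_const c)
  have "mon (\<lambda>_::'a. 0) = 1" by (simp add: mon_def)
  then show ?case using mspan_mono[of "\<lambda>_::'a. 0" "{e. (\<Sum>i\<in>UNIV. e i) = 0}" c] by simp
next
  case (homi_X k f i)
  show ?case
  proof (rule mspan_map[OF homi_X(2), of "\<lambda>f. X i * f"])
    fix e :: "'a \<Rightarrow> nat" assume e: "e \<in> {e. (\<Sum>i\<in>UNIV. e i) = k}"
    have "X i * mon e = mon (e(i := Suc (e i)))"
      unfolding mon_def by (subst (1 2) prod.remove[of _ i]) (auto intro!: prod.cong)
    moreover have "(\<Sum>l\<in>UNIV. (e(i := Suc (e i))) l) = Suc k"
      using e by (simp add: sum.remove[of UNIV i])
    ultimately show "mspan {e. (\<Sum>i\<in>UNIV. e i) = Suc k} (X i * mon e)"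
      by (auto intro: mspan_mono1)
  qed (auto simp: algebra_simps)
qed (auto intro: mspan_add)

text \<open>The exponent vectors whose decreasing rearrangement is dominated by \<open>lam\<close>
  (\<open>orbit_dset_iff\<close>). Sums over all index sets express dominance without
  sorting.\<close>

definition dset :: "(nat \<Rightarrow> nat) \<Rightarrow> ('n::finite \<Rightarrow> nat) set" where
  "dset lam = {e. (\<Sum>i\<in>UNIV. e i) = psize CARD('n) lam \<and> (\<forall>A. (\<Sum>i\<in>A. e i) \<le> (\<Sum>i=1..card A. lam i))}"

text \<open>The vectors strictly below \<open>lam\<close>; as a union of sets \<open>dset\<close> it
  inherits their closure properties.\<close>

definition lset :: "(nat \<Rightarrow> nat) \<Rightarrow> ('n::finite \<Rightarrow> nat) set" where
  "lset lam = (\<Union>mu\<in>{mu \<in> partitions CARD('n). dominance_le CARD('n) mu lam \<and> mu \<noteq> lam}. dset mu)"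

lemma dset_sum: "e \<in> dset lam \<Longrightarrow> (\<Sum>i\<in>UNIV. e i) = psize CARD('n) lam"
  for e :: "'n::finite \<Rightarrow> nat" by (simp add: dset_def)

lemma lset_sum: "e \<in> lset lam \<Longrightarrow> (\<Sum>i\<in>UNIV. e i) = psize CARD('n) lam"
  for e :: "'n::finite \<Rightarrow> nat" by (auto simp: lset_def dset_def dominance_le_def)

lemma sum_upd2:
  fixes e :: "'n::finite \<Rightarrow> nat"
  assumes "i \<noteq> j" "finite A"
  shows "(\<Sum>l\<in>A. (e(i := a, j := b)) l) = (\<Sum>l\<in>A - {i, j}. e l) + (if i \<in> A then a else 0) + (if j \<in> A then b else 0)"
proof -
  have "(\<Sum>l\<in>A. (e(i := a, j := b)) l) = (\<Sum>l\<in>A - {i,j}. (e(i := a, j := b)) l) + (\<Sum>l\<in>A \<inter> {i,j}. (e(i := a, j := b)) l)"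
    using sum.Int_Diff[OF assms(2), of "e(i := a, j := b)" "{i,j}"] by (simp only: add.commute)
  also have "(\<Sum>l\<in>A - {i,j}. (e(i := a, j := b)) l) = (\<Sum>l\<in>A - {i, j}. e l)"
    by (intro sum.cong) auto
  also have "(\<Sum>l\<in>A \<inter> {i,j}. (e(i := a, j := b)) l) = (if i \<in> A then a else 0) + (if j \<in> A then b else 0)"
    using assms(1) by (auto simp: Int_insert_right)
  finally show ?thesis by (simp only: add.assoc)
qed

text \<open>Only index sets containing exactly one of i and j matter. There the new entry is at most
  the larger old one, and the set of the same size containing the index of that larger entry
  supplies the bound.\<close>

lemma dset_move:
  fixes e :: "'n::finite \<Rightarrow> nat"
  assumes e: "e \<in> dset mu" and ij: "i \<noteq> j" and ab: "a + b = e i + e j" "a \<le> max (e i) (e j)" "b \<le> max (e i) (e j)"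
  shows "e(i := a, j := b) \<in> dset mu"
proof -
  have self: "(\<Sum>l\<in>A. e l) = (\<Sum>l\<in>A - {i, j}. e l) + (if i \<in> A then e i else 0) + (if j \<in> A then e j else 0)" for A
    using sum_upd2[OF ij, of A e "e i" "e j"] by simp
  have le: "(\<Sum>l\<in>A. e l) \<le> (\<Sum>i=1..card A. mu i)" for A using e by (simp add: dset_def)
  have "(\<Sum>l\<in>UNIV. (e(i := a, j := b)) l) = psize CARD('n) mu"
    using dset_sum[OF e] self[of UNIV] ab by (simp add: sum_upd2[OF ij] del: fun_upd_apply)
  moreover have "(\<Sum>l\<in>A. (e(i := a, j := b)) l) \<le> (\<Sum>i=1..card A. mu i)" for A
  proof -
    define B where "B = A - {i, j}"
    have B: "finite B" "i \<notin> B" "j \<notin> B" by (auto simp: B_def)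
    have sB: "(\<Sum>l\<in>insert i B. e l) = e i + sum e B" "(\<Sum>l\<in>insert j B. e l) = e j + sum e B"
       "card (insert i B) = card (insert j B)" using B by auto
    have mx: "max (e i) (e j) + sum e B \<le> (\<Sum>i=1..card (insert j B). mu i)"
      using le[of "insert i B"] le[of "insert j B"] unfolding sB by linarith
    consider "i \<in> A" "j \<in> A" | "i \<in> A" "j \<notin> A" | "i \<notin> A" "j \<in> A" | "i \<notin> A" "j \<notin> A" by blast
    then show ?thesis
    proof cases
      case 1
      then show ?thesis using le[of A] self[of A] ab by (simp add: sum_upd2[OF ij] del: fun_upd_apply)
    next
      case 2
      then have A: "A = insert i B" by (auto simp: B_def)
      have "(\<Sum>l\<in>A. (e(i := a, j := b)) l) = sum e B + a"
        using 2 by (simp add: sum_upd2[OF ij] B_def del: fun_upd_apply)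
      then show ?thesis using mx ab(2) unfolding A sB(3) by linarith
    next
      case 3
      then have A: "A = insert j B" by (auto simp: B_def)
      have "(\<Sum>l\<in>A. (e(i := a, j := b)) l) = sum e B + b"
        using 3 by (simp add: sum_upd2[OF ij] B_def del: fun_upd_apply)
      then show ?thesis using mx ab(3) unfolding A by linarith
    next
      case 4
      then show ?thesis using le[of A] by (simp add: sum_upd2[OF ij] del: fun_upd_apply)
    qed
  qed
  ultimately show ?thesis unfolding dset_def by blast
qed

lemma dset_perm:
  fixes e :: "'n::finite \<Rightarrow> nat" and p :: "'n \<Rightarrow> 'n"
  assumes "e \<in> dset mu" "bij p"
  shows "e \<circ> p \<in> dset mu"
proof -
  have *: "(\<Sum>i\<in>A. (e \<circ> p) i) = (\<Sum>i\<in>p ` A. e i)" "card (p ` A) = card A" for A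
    using assms(2) by (auto simp: sum.reindex inj_on_subset[OF bij_is_inj] card_image)
  have "(\<Sum>i\<in>A. (e \<circ> p) i) \<le> (\<Sum>i=1..card A. mu i)" for A
    using assms(1) *(1)[of A] *(2)[of A] unfolding dset_def by (metis (mono_tags, lifting) mem_Collect_eq)
  moreover have "(\<Sum>i\<in>UNIV. (e \<circ> p) i) = psize CARD('n) mu"
    using dset_sum[OF assms(1)] assms(2) unfolding *(1) by (simp add: bij_is_surj)
  ultimately show ?thesis by (simp add: dset_def)
qed

lemma lset_move:
  fixes e :: "'n::finite \<Rightarrow> nat"
  assumes "e \<in> lset lam" "i \<noteq> j" "a + b = e i + e j" "a \<le> max (e i) (e j)" "b \<le> max (e i) (e j)"
  shows "e(i := a, j := b) \<in> lset lam"
proof -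
  obtain mu where "mu \<in> {mu \<in> partitions CARD('n). dominance_le CARD('n) mu lam \<and> mu \<noteq> lam}" "e \<in> dset mu"
    using assms(1) unfolding lset_def by (rule UN_E)
  then show ?thesis unfolding lset_def by (intro UN_I[of mu] dset_move[OF _ assms(2-5)])
qed

lemma lset_perm:
  fixes e :: "'n::finite \<Rightarrow> nat" and p :: "'n \<Rightarrow> 'n"
  assumes "e \<in> lset lam" "bij p"
  shows "e \<circ> p \<in> lset lam"
proof -
  obtain mu where "mu \<in> {mu \<in> partitions CARD('n). dominance_le CARD('n) mu lam \<and> mu \<noteq> lam}" "e \<in> dset mu"
    using assms(1) unfolding lset_def by (rule UN_E)
  then show ?thesis unfolding lset_def by (intro UN_I[of mu] dset_perm[OF _ assms(2)])
qed

text \<open>Closure under exactly those changes of exponents that permutations and X_i del_ij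
  produce, so that spans over such sets are invariant under all operators in use.\<close>

definition stable :: "('n::finite \<Rightarrow> nat) set \<Rightarrow> bool" where
  "stable D \<longleftrightarrow> (\<forall>e\<in>D. \<forall>p. bij p \<longrightarrow> e \<circ> p \<in> D) \<and>
    (\<forall>e\<in>D. \<forall>i j a b. i \<noteq> j \<longrightarrow> a + b = e i + e j \<longrightarrow> a \<le> max (e i) (e j) \<longrightarrow> b \<le> max (e i) (e j) \<longrightarrow> e(i := a, j := b) \<in> D)"

lemma stable_dset: "stable (dset mu)" and stable_lset: "stable (lset mu)"
  unfolding stable_def by (simp_all add: dset_perm dset_move lset_perm lset_move)

lemma mspan_act: "stable D \<Longrightarrow> mspan D f \<Longrightarrow> bij p \<Longrightarrow> mspan D (act p f)"
  by (rule mspan_map[of D f "act p" D]) (auto simp: act_mono stable_def bij_imp_bij_inv intro!: mspan_mono1)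

context jack
begin

lemma y_mono:
  "y i (mon e) = CC (of_nat (e i)) * mon e + gam * (\<Sum>j\<in>UNIV - {i}. X i * del i j (mon e))"
  by (simp add: y_def T_def distrib_left X_dd_mono sum_distrib_left mult.left_commute[of _ gam])

lemma mspan_y:
  assumes "stable D" "mspan D f"
  shows "mspan D (y i f)"
proof (rule mspan_map[OF assms(2), of "y i"])
  fix e assume e: "e \<in> D"
  have "mspan D (X i * del i j (mon e))" if "j \<noteq> i" for j
  proof (cases "e j \<le> e i")
    case True
    then show ?thesis using that e assms(1)
      unfolding X_del_mono_ge[of i j e, OF that[symmetric] True]
      by (intro mspan_sum mspan_mono1) (auto simp: stable_def)
  next
    case False
    then have "e i < e j" by simp
    then show ?thesis using that e assms(1)
      unfolding X_del_mono_lt[of i j e, OF that[symmetric] \<open>e i < e j\<close>]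
      by (intro mspan_uminus mspan_sum mspan_mono1) (auto simp: stable_def)
  qed
  then show "mspan D (y i (mon e))"
    unfolding y_mono using e by (intro mspan_add mspan_scale mspan_sum mspan_mono1) auto
qed auto

lemma mspan_xi: "stable D \<Longrightarrow> mspan D f \<Longrightarrow> mspan D (xi S i f)"
  unfolding xi_def by (intro mspan_add mspan_y mspan_scale mspan_sum mspan_act) auto

lemma mspan_zop: "stable D \<Longrightarrow> mspan D f \<Longrightarrow> mspan D (zop u S as f)"
  by (induction as arbitrary: S) (auto simp: opu_def intro!: mspan_add mspan_scale mspan_xi)

lemma mspan_Zop: "stable D \<Longrightarrow> mspan D f \<Longrightarrow> mspan D (Zop u f)"
  unfolding Zop_def by (rule mspan_zop)

lemma mspan_Y2: "stable D \<Longrightarrow> mspan D f \<Longrightarrow> mspan D (Y2 f)"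
  unfolding Y2_def by (intro mspan_sum mspan_y)

end

section \<open>Partitions and exponent vectors\<close>

abbreviation enum :: "('n::finite \<Rightarrow> nat) \<Rightarrow> bool" where "enum g \<equiv> bij_betw g UNIV {1..CARD('n)}"

lemma exists_enum: "\<exists>g::'n::finite \<Rightarrow> nat. enum g"
  using ex_bij_betw_finite_nat[of "UNIV :: 'n set"] ex_bij_betw_nat_finite_1[of "UNIV :: 'n set"]
  by (metis bij_betw_the_inv_into finite)

lemma partition_decr: "lam \<in> partitions n \<Longrightarrow> 1 \<le> i \<Longrightarrow> i \<le> j \<Longrightarrow> lam j \<le> lam i"
  by (cases "j \<le> n") (auto simp: partitions_def)

lemma exists_sorted:
  fixes e :: "'n::finite \<Rightarrow> nat"
  shows "\<exists>mu\<in>partitions CARD('n). \<exists>g. enum g \<and> e = mu \<circ> g"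
proof -
  obtain bs :: "'n list" where bs: "distinct bs" "set bs = UNIV" using finite_distinct_list[of "UNIV::'n set"] by auto
  define as where "as = rev (sort_key e bs)"
  have as: "distinct as" "set as = UNIV" "sorted (rev (map e as))" using bs by (auto simp: as_def rev_map)
  have len: "length as = CARD('n)" using as by (metis distinct_card)
  define f where "f = (\<lambda>i. as ! (i - 1))"
  have f: "bij_betw f {1..CARD('n)} UNIV"
  proof -
    have "bij_betw ((!) as) {..<length as} UNIV" using as bij_betw_nth[of as] by simp
    moreover have "bij_betw (\<lambda>i. i - 1) {1..CARD('n)} {..<length as}"
      by (rule bij_betw_byWitness[of _ Suc]) (auto simp: len)
    ultimately show ?thesis unfolding f_def using bij_betw_trans[of "\<lambda>i. i - 1" _ _ "(!) as"] by (simp add: o_def)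
  qed
  define mu where "mu = (\<lambda>i. if i \<in> {1..CARD('n)} then e (f i) else 0)"
  define g where "g = the_inv_into {1..CARD('n)} f"
  have g: "enum g" unfolding g_def by (rule bij_betw_the_inv_into[OF f])
  have "mu \<in> partitions CARD('n)"
  proof -
    have "e (as ! (j - 1)) \<le> e (as ! (i - 1))" if "1 \<le> i" "i \<le> j" "j \<le> CARD('n)" for i j
      using sorted_rev_nth_mono[OF as(3), of "i - 1" "j - 1"] that len by simp
    then show ?thesis by (auto simp: partitions_def mu_def f_def)
  qed
  moreover have "e = mu \<circ> g"
  proof
    fix x
    have "g x \<in> {1..CARD('n)}" "f (g x) = x"
      using g f unfolding g_def by (auto simp: bij_betw_def f_the_inv_into_f)
    then show "e x = (mu \<circ> g) x" by (simp add: mu_def)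
  qed
  ultimately show ?thesis using g by blast
qed

lemma sum_enum: "enum g \<Longrightarrow> (\<Sum>i\<in>UNIV. h (g i)) = (\<Sum>i=1..CARD('n). h i)" for g :: "'n::finite \<Rightarrow> nat"
  by (rule sum.reindex_bij_betw)

lemma prod_enum: "enum g \<Longrightarrow> (\<Prod>i\<in>UNIV. h (g i)) = (\<Prod>i=1..CARD('n). h i)" for g :: "'n::finite \<Rightarrow> nat"
  by (rule prod.reindex_bij_betw)

text \<open>The largest index in B is at least \<open>card B\<close>, so its part is at most the
  last part on the right; remove it and induct.\<close>

lemma partition_sum_subset:
  assumes "lam \<in> partitions n" "finite B" "0 \<notin> B"
  shows "(\<Sum>i\<in>B. lam i) \<le> (\<Sum>i=1..card B. lam i)"
  using assms(2,3)
proof (induction "card B" arbitrary: B)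
  case (Suc m)
  define M where "M = Max B"
  have B: "B \<noteq> {}" "finite B" using Suc by auto
  have M: "M \<in> B" "\<And>b. b \<in> B \<Longrightarrow> b \<le> M" unfolding M_def using B by auto
  have "B \<subseteq> {1..M}" using M Suc.prems by (auto simp: Suc_le_eq intro: gr0I)
  then have "card B \<le> M" using card_mono[of "{1..M}" B] by simp
  then have le: "lam M \<le> lam (Suc m)" using Suc.hyps(2) by (intro partition_decr[OF assms(1)]) auto
  have "(\<Sum>i\<in>B - {M}. lam i) \<le> (\<Sum>i=1..card (B - {M}). lam i)"
    by (rule Suc.hyps(1)) (use Suc M B in auto)
  moreover have "card (B - {M}) = m" using M B Suc.hyps(2) by simp
  moreover have "(\<Sum>i\<in>B. lam i) = lam M + (\<Sum>i\<in>B - {M}. lam i)" using M B by (simp add: sum.remove)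
  ultimately show ?case using le by (simp flip: Suc.hyps(2))
qed simp

lemma orbit_dset_iff:
  fixes g :: "'n::finite \<Rightarrow> nat"
  assumes "mu \<in> partitions CARD('n)" "enum g"
  shows "mu \<circ> g \<in> dset lam \<longleftrightarrow> dominance_le CARD('n) mu lam"
proof
  assume d: "mu \<circ> g \<in> dset lam"
  have "(\<Sum>i=1..j. mu i) \<le> (\<Sum>i=1..j. lam i)" if "j \<le> CARD('n)" for j
  proof -
    define A where "A = g -` {1..j}"
    have b: "bij_betw g A {1..j}" unfolding A_def using assms(2) that
      by (auto simp: bij_betw_def intro: inj_on_subset)
    have "(\<Sum>i\<in>A. (mu \<circ> g) i) \<le> (\<Sum>i=1..card A. lam i)" using d by (auto simp: dset_def)
    moreover have "card A = j" using bij_betw_same_card[OF b] by simp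
    moreover have "(\<Sum>i\<in>A. (mu \<circ> g) i) = (\<Sum>i=1..j. mu i)"
      using sum.reindex_bij_betw[OF b, of mu] by simp
    ultimately show ?thesis by simp
  qed
  moreover have "psize CARD('n) mu = psize CARD('n) lam"
    using dset_sum[OF d] sum_enum[OF assms(2), of mu] by (simp add: psize_def)
  ultimately show "dominance_le CARD('n) mu lam" by (simp add: dominance_le_def)
next
  assume d: "dominance_le CARD('n) mu lam"
  have "(\<Sum>i\<in>A. (mu \<circ> g) i) \<le> (\<Sum>i=1..card A. lam i)" for A
  proof -
    have inj: "inj_on g A" using assms(2) by (auto simp: bij_betw_def intro: inj_on_subset)
    have "g ` A \<subseteq> {1..CARD('n)}" using assms(2) by (auto simp: bij_betw_def)
    then have "0 \<notin> g ` A" by auto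
    then have "(\<Sum>i\<in>g ` A. mu i) \<le> (\<Sum>i=1..card (g ` A). mu i)"
      by (intro partition_sum_subset[OF assms(1)]) auto
    also have "card (g ` A) = card A" by (rule card_image[OF inj])
    also have "(\<Sum>i=1..card A. mu i) \<le> (\<Sum>i=1..card A. lam i)"
    proof (cases "card A = 0")
      case False
      moreover have "card A \<le> CARD('n)" by (rule card_mono) auto
      ultimately show ?thesis using d by (auto simp: dominance_le_def)
    qed simp
    finally show ?thesis by (simp add: sum.reindex[OF inj])
  qed
  moreover have "(\<Sum>i\<in>UNIV. (mu \<circ> g) i) = psize CARD('n) lam"
    using d sum_enum[OF assms(2), of mu] by (simp add: psize_def dominance_le_def)
  ultimately show "mu \<circ> g \<in> dset lam" by (simp add: dset_def)
qed

lemma dominance_refl [simp]: "dominance_le n lam lam"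
  by (simp add: dominance_le_def)

lemma dominance_trans: "dominance_le n lam mu \<Longrightarrow> dominance_le n mu nu \<Longrightarrow> dominance_le n lam nu"
  unfolding dominance_le_def by (auto intro: le_trans)

text \<open>A move strictly below the maximum M lowers the sum of squares: with minimum m, M^2 + m^2
  - a^2 - b^2 = 2 (M - a) (M - b) > 0. As that sum depends only on the rearrangement, the new vector
  belongs to a different partition.\<close>

lemma lset_moved:
  fixes g :: "'n::finite \<Rightarrow> nat"
  assumes lam: "lam \<in> partitions CARD('n)" and g: "enum g" and ij: "i \<noteq> j"
    and ab: "a + b = (lam \<circ> g) i + (lam \<circ> g) j" "a < max ((lam \<circ> g) i) ((lam \<circ> g) j)" "b < max ((lam \<circ> g) i) ((lam \<circ> g) j)"
  shows "(lam \<circ> g)(i := a, j := b) \<in> lset lam"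
proof -
  define e where "e = lam \<circ> g"
  define e' where "e' = e(i := a, j := b)"
  have "e \<in> dset lam" unfolding e_def using lam g by (simp add: orbit_dset_iff)
  then have e': "e' \<in> dset lam" unfolding e'_def by (rule dset_move) (use ij ab in \<open>auto simp: e_def\<close>)
  obtain mu h where mu: "mu \<in> partitions CARD('n)" "enum h" "e' = mu \<circ> h" using exists_sorted[of e'] by blast
  have dom: "dominance_le CARD('n) mu lam" using orbit_dset_iff[OF mu(1,2)] e' mu(3) by simp
  have sq: "(\<Sum>l\<in>UNIV. (e l)\<^sup>2) = (\<Sum>l\<in>UNIV - {i,j}. (e l)\<^sup>2) + (e i)\<^sup>2 + (e j)\<^sup>2"
    "(\<Sum>l\<in>UNIV. (e' l)\<^sup>2) = (\<Sum>l\<in>UNIV - {i,j}. (e l)\<^sup>2) + a\<^sup>2 + b\<^sup>2"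
  proof -
    have "(\<Sum>l\<in>UNIV. f l) = (\<Sum>l\<in>UNIV - {i,j}. f l) + f i + f j" for f :: "'n \<Rightarrow> nat"
      using sum_upd2[OF ij, of UNIV f "f i" "f j"] by simp
    note * = this
    show "(\<Sum>l\<in>UNIV. (e l)\<^sup>2) = (\<Sum>l\<in>UNIV - {i,j}. (e l)\<^sup>2) + (e i)\<^sup>2 + (e j)\<^sup>2" by (rule *)
    show "(\<Sum>l\<in>UNIV. (e' l)\<^sup>2) = (\<Sum>l\<in>UNIV - {i,j}. (e l)\<^sup>2) + a\<^sup>2 + b\<^sup>2"
      unfolding *[of "\<lambda>l. (e' l)\<^sup>2"] using ij by (simp add: e'_def)
  qed
  have "a\<^sup>2 + b\<^sup>2 < (e i)\<^sup>2 + (e j)\<^sup>2"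
  proof -
    define M m where "M = int (max (e i) (e j))" and "m = int (min (e i) (e j))"
    have Mm: "int a + int b = M + m" "int a < M" "int b < M"
      and sum: "int ((e i)\<^sup>2 + (e j)\<^sup>2) = M\<^sup>2 + m\<^sup>2"
      using ab by (auto simp: M_def m_def e_def max_def min_def)
    have b: "int b = M + m - int a" using Mm by simp
    have "M\<^sup>2 + m\<^sup>2 - (int a)\<^sup>2 - (int b)\<^sup>2 = 2 * ((M - int a) * (M - int b))"
      unfolding b by (simp add: power2_eq_square algebra_simps)
    moreover have "2 * ((M - int a) * (M - int b)) > 0" using Mm by simp
    ultimately have "int (a\<^sup>2 + b\<^sup>2) < int ((e i)\<^sup>2 + (e j)\<^sup>2)"
      using sum by simp
    then show ?thesis by linarith
  qed
  then have "(\<Sum>l\<in>UNIV. (e' l)\<^sup>2) < (\<Sum>l\<in>UNIV. (e l)\<^sup>2)" unfolding sq by simp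
  moreover have "(\<Sum>l\<in>UNIV. (e' l)\<^sup>2) = (\<Sum>l=1..CARD('n). (mu l)\<^sup>2)" "(\<Sum>l\<in>UNIV. (e l)\<^sup>2) = (\<Sum>l=1..CARD('n). (lam l)\<^sup>2)"
    unfolding mu(3) e_def using sum_enum[OF mu(2), of "\<lambda>l. (mu l)\<^sup>2"] sum_enum[OF g, of "\<lambda>l. (lam l)\<^sup>2"] by simp_all
  ultimately have "mu \<noteq> lam" by auto
  moreover have "e' \<in> dset mu" using orbit_dset_iff[OF mu(1,2)] mu(3) by simp
  ultimately show ?thesis unfolding lset_def using mu(1) dom by (auto simp: e'_def e_def)
qed

section \<open>Triangularity\<close>

context jack
begin

text \<open>All summands of the divided difference are strict moves except the last one, which is
  \<open>mon e\<close> or its transposed copy.\<close>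

lemma X_del_leading:
  fixes g :: "'n::finite \<Rightarrow> nat"
  assumes lam: "lam \<in> partitions CARD('n)" and g: "enum g" and e: "e = lam \<circ> g" and aj: "a \<noteq> j"
  shows "mspan (lset lam) (X a * del a j (mon e) -
    (if e j < e a then mon e else if e a < e j then - mon (e \<circ> tr a j) else 0))"
proof -
  note moved = lset_moved[OF lam g aj, folded e]
  consider "e j < e a" | "e a < e j" | "e a = e j" by linarith
  then show ?thesis
  proof cases
    case 1
    then obtain d where d: "e a = e j + Suc d" using less_imp_Suc_add by auto
    have "X a * del a j (mon e) = (\<Sum>s<Suc d. mon (e(a := e j + s + 1, j := e a - 1 - s)))"
      using X_del_mono_ge[OF aj, of e] 1 d by simp
    also have "\<dots> = (\<Sum>s<d. mon (e(a := e j + s + 1, j := e a - 1 - s))) + mon e"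
      by (simp add: d) (metis add_Suc_right d fun_upd_triv)
    finally have eq: "X a * del a j (mon e) - mon e = (\<Sum>s<d. mon (e(a := e j + s + 1, j := e a - 1 - s)))" by simp
    have "mspan (lset lam) (\<Sum>s<d. mon (e(a := e j + s + 1, j := e a - 1 - s)))"
      by (intro mspan_sum mspan_mono1 moved) (auto simp: d)
    then show ?thesis using 1 unfolding eq[symmetric] by simp
  next
    case 2
    then obtain d where d: "e j = e a + Suc d" using less_imp_Suc_add by auto
    have sw: "e(a := e j, j := e a) = e \<circ> tr a j"
      using aj by (auto simp: fun_eq_iff Transposition.transpose_def)
    have "X a * del a j (mon e) = - (\<Sum>s<Suc d. mon (e(a := e a + s + 1, j := e j - 1 - s)))"
      using X_del_mono_lt[OF aj, of e] 2 d by simp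
    also have "(\<Sum>s<Suc d. mon (e(a := e a + s + 1, j := e j - 1 - s))) =
       (\<Sum>s<d. mon (e(a := e a + s + 1, j := e j - 1 - s))) + mon (e \<circ> tr a j)"
      unfolding sw[symmetric] by (simp add: d)
    finally have eq: "X a * del a j (mon e) - (- mon (e \<circ> tr a j)) = - (\<Sum>s<d. mon (e(a := e a + s + 1, j := e j - 1 - s)))" by simp
    have "mspan (lset lam) (- (\<Sum>s<d. mon (e(a := e a + s + 1, j := e j - 1 - s))))"
      by (intro mspan_uminus mspan_sum mspan_mono1 moved) (auto simp: d)
    then show ?thesis using 2 unfolding eq[symmetric] by simp
  next
    case 3
    then show ?thesis using X_del_mono_ge[OF aj, of e] by (simp add: mspan_zero)
  qed
qed

text \<open>For e_a < e_j the divided difference leaves -gamma times the transposed monomial, and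
  the transposition with j in S cancels it. Indices with smaller exponents, and those in R, whose
  transpositions fix \<open>mon e\<close>, add gamma each; modulo lower terms the operator is thus
  diagonal.\<close>

lemma xi_leading:
  fixes g :: "'n::finite \<Rightarrow> nat"
  assumes lam: "lam \<in> partitions CARD('n)" and g: "enum g" and e: "e = lam \<circ> g"
    and S: "S = {j. e a < e j} \<union> R" "\<And>j. j \<in> R \<Longrightarrow> e j = e a" "a \<notin> R"
  shows "mspan (lset lam) (xi S a (mon e) -
    CC (of_nat (e a) + of_real \<gamma> * of_nat (card {j. e j < e a} + card R)) * mon e)"
proof -
  define V where "V = (\<lambda>j. if e j < e a then mon e else if e a < e j then - mon (e \<circ> tr a j) else 0)"
  have "(\<Sum>j\<in>UNIV - {a}. V j) = (\<Sum>j\<in>UNIV. V j)"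
    by (rule sum.mono_neutral_left) (auto simp: V_def)
  also have "\<dots> = (\<Sum>j\<in>UNIV. (if e j < e a then mon e else 0) - (if e a < e j then mon (e \<circ> tr a j) else 0))"
    by (intro sum.cong) (auto simp: V_def)
  also have "\<dots> = of_nat (card {j. e j < e a}) * mon e - (\<Sum>j\<in>{j. e a < e j}. mon (e \<circ> tr a j))"
    unfolding sum_subtractf by (simp add: sum.If_cases)
  finally have V: "(\<Sum>j\<in>UNIV - {a}. V j) = \<dots>" .
  have "(\<Sum>l\<in>S. act (tr a l) (mon e)) = (\<Sum>l\<in>{j. e a < e j}. mon (e \<circ> tr a l)) + (\<Sum>l\<in>R. mon (e \<circ> tr a l))"
    unfolding S(1) act_tr_mono by (rule sum.union_disjoint) (use S(2) in force)+
  also have "(\<Sum>l\<in>R. mon (e \<circ> tr a l)) = (\<Sum>l\<in>R. mon e)"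
    by (intro sum.cong arg_cong[of _ _ mon]) (auto simp: fun_eq_iff Transposition.transpose_def S(2))
  finally have R: "(\<Sum>l\<in>S. act (tr a l) (mon e)) = (\<Sum>l\<in>{j. e a < e j}. mon (e \<circ> tr a l)) + of_nat (card R) * mon e"
    by (simp only: sum_constant)
  have "xi S a (mon e) - CC (of_nat (e a) + of_real \<gamma> * of_nat (card {j. e j < e a} + card R)) * mon e
    = gam * ((\<Sum>j\<in>UNIV - {a}. X a * del a j (mon e)) - (\<Sum>j\<in>UNIV - {a}. V j))"
    unfolding xi_def y_mono V R by (simp add: CC_simps of_nat_pol algebra_simps)
  also have "\<dots> = gam * (\<Sum>j\<in>UNIV - {a}. X a * del a j (mon e) - V j)" by (simp add: sum_subtractf)
  also have "mspan (lset lam) \<dots>"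
    unfolding V_def by (intro mspan_scale mspan_sum X_del_leading[OF lam g e]) auto
  finally show ?thesis .
qed

text \<open>Sorting by \<open>key\<close> puts larger exponents first and breaks ties in the order opposite to
  \<open>g\<close>; with this choice the eigenvalue at position \<open>g a\<close> is exactly \<open>e a + \<gamma> (n - g a)\<close>.\<close>

definition key :: "('n::finite \<Rightarrow> nat) \<Rightarrow> ('n \<Rightarrow> nat) \<Rightarrow> 'n \<Rightarrow> int" where
  "key g e a = - (int (e a) * int (CARD('n) + 1) + int (g a))"

text \<open>Since g takes values up to n, the factor n + 1 makes \<open>key\<close> a lexicographic
  order coded in one integer.\<close>

lemma key_less_iff:
  fixes g :: "'n::finite \<Rightarrow> nat"
  assumes g: "enum g"
  shows "key g e j < key g e a \<longleftrightarrow> e a < e j \<or> (e j = e a \<and> g a < g j)"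
proof -
  have b: "g i \<le> CARD('n)" for i using g by (auto simp: bij_betw_def)
  have *: "e a * (CARD('n) + 1) + g a < e j * (CARD('n) + 1) + g j" if "e a < e j" for a j
  proof -
    have "Suc (e a) * (CARD('n) + 1) \<le> e j * (CARD('n) + 1)" using that by (intro mult_le_mono1) simp
    then show ?thesis using b[of a] by simp
  qed
  have "key g e j < key g e a \<longleftrightarrow> e a * (CARD('n) + 1) + g a < e j * (CARD('n) + 1) + g j"
    unfolding key_def neg_less_iff_less of_nat_mult[symmetric] of_nat_add[symmetric] of_nat_less_iff ..
  also have "\<dots> \<longleftrightarrow> e a < e j \<or> (e j = e a \<and> g a < g j)"
    using *[of a j] *[of j a] by (cases "e a" "e j" rule: linorder_cases) auto
  finally show ?thesis .
qed

lemma card_enum_greater: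
  fixes g :: "'n::finite \<Rightarrow> nat"
  assumes g: "enum g"
  shows "card {j. g a < g j} = CARD('n) - g a"
proof -
  have r: "range g = {1..CARD('n)}" using g by (simp add: bij_betw_def)
  have "g ` {j. g a < g j} = {g a<..CARD('n)}"
  proof (intro equalityI subsetI)
    fix x assume "x \<in> g ` {j. g a < g j}"
    then obtain j where "x = g j" "g a < g j" by blast
    moreover have "g j \<in> {1..CARD('n)}" unfolding r[symmetric] by simp
    ultimately show "x \<in> {g a<..CARD('n)}" by simp
  next
    fix x assume x: "x \<in> {g a<..CARD('n)}"
    then have "x \<in> range g" unfolding r by simp
    then show "x \<in> g ` {j. g a < g j}" using x by auto
  qed
  moreover have "inj_on g {j. g a < g j}" using g by (auto simp: bij_betw_def intro: inj_on_subset)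
  ultimately show ?thesis using card_image by fastforce
qed

definition coord :: "('n::finite \<Rightarrow> nat) \<Rightarrow> ('n \<Rightarrow> nat) \<Rightarrow> 'n \<Rightarrow> complex" where
  "coord g e a = of_nat (e a) + of_real \<gamma> * of_nat (CARD('n) - g a)"

lemma xi_key:
  fixes g :: "'n::finite \<Rightarrow> nat"
  assumes lam: "lam \<in> partitions CARD('n)" and g: "enum g" and e: "e = lam \<circ> g"
  shows "mspan (lset lam) (xi {j. key g e j < key g e a} a (mon e) - CC (coord g e a) * mon e)"
proof -
  define R where "R = {j. e j = e a \<and> g a < g j}"
  have "g i \<ge> 1" for i using bij_betwE[OF g] by auto
  then have dec: "g j < g i \<Longrightarrow> e i \<le> e j" for i j
    using partition_decr[OF lam, of "g j" "g i"] by (simp add: e)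
  \<comment> \<open>As \<open>lam\<close> decreases, a later position under g has a smaller exponent
    or ties with e_a, and the ties broken against g are precisely those in R. So n - g a indices
    contribute gamma.\<close>
  have "{j. e j < e a} \<union> R = {j. g a < g j}"
  proof (intro equalityI subsetI)
    fix j assume "j \<in> {j. e j < e a} \<union> R"
    then consider "e j < e a" | "g a < g j" by (auto simp: R_def)
    then show "j \<in> {j. g a < g j}"
    proof cases
      case 1
      then have "\<not> g j < g a" using dec[of j a] by auto
      moreover have "g j \<noteq> g a" using 1 by (auto simp: e)
      ultimately show ?thesis by simp
    qed simp
  next
    fix j assume "j \<in> {j. g a < g j}"
    then show "j \<in> {j. e j < e a} \<union> R" using dec[of a j] by (auto simp: R_def)
  qed
  moreover have "card ({j. e j < e a} \<union> R) = card {j. e j < e a} + card R"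
    by (rule card_Un_disjoint) (auto simp: R_def)
  ultimately have "card {j. e j < e a} + card R = CARD('n) - g a"
    using card_enum_greater[OF g, of a] by simp
  moreover have "{j. key g e j < key g e a} = {j. e a < e j} \<union> R"
    unfolding R_def key_less_iff[OF g] by blast
  moreover have "\<And>j. j \<in> R \<Longrightarrow> e j = e a" "a \<notin> R" unfolding R_def by blast+
  note xi_leading[OF lam g e refl this]
  ultimately show ?thesis unfolding coord_def by (simp only:)
qed

lemma opu_key_cong:
  fixes g :: "'n::finite \<Rightarrow> nat"
  assumes lam: "lam \<in> partitions CARD('n)" and g: "enum g" and e: "e = lam \<circ> g"
    and f: "mspan (lset lam) (f - CC c * mon e)"
  shows "mspan (lset lam) (opu u {j. key g e j < key g e a} a f - CC ((u + coord g e a) * c) * mon e)"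
proof -
  let ?S = "{j. key g e j < key g e a}"
  have "opu u ?S a f - CC ((u + coord g e a) * c) * mon e =
    (CC u * (f - CC c * mon e) + xi ?S a (f - CC c * mon e)) + CC c * (xi ?S a (mon e) - CC (coord g e a) * mon e)"
    by (simp add: opu_def CC_simps) (simp add: algebra_simps)
  also have "mspan (lset lam) \<dots>"
    by (intro mspan_add mspan_scale mspan_xi stable_lset f xi_key[OF lam g e])
  finally show ?thesis .
qed

lemma zop_key:
  fixes g :: "'n::finite \<Rightarrow> nat"
  assumes lam: "lam \<in> partitions CARD('n)" and g: "enum g" and e: "e = lam \<circ> g"
  shows "sorted_wrt (\<lambda>a b. key g e a < key g e b) as \<Longrightarrow> S = - set as \<Longrightarrow>
    (\<And>s a. s \<in> S \<Longrightarrow> a \<in> set as \<Longrightarrow> key g e s < key g e a) \<Longrightarrow>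
    mspan (lset lam) (zop u S as (mon e) - CC (\<Prod>a\<leftarrow>as. u + coord g e a) * mon e)"
proof (induction as arbitrary: S)
  case Nil
  then show ?case by (simp add: CC_simps mspan_zero)
next
  case (Cons a as)
  have "a \<notin> set as" using Cons.prems(1) by auto
  have S: "S = {j. key g e j < key g e a}"
  proof
    show "S \<subseteq> {j. key g e j < key g e a}" using Cons.prems(3) by auto
    show "{j. key g e j < key g e a} \<subseteq> S" using Cons.prems(1,2) by force
  qed
  have "mspan (lset lam) (zop u (insert a S) as (mon e) - CC (\<Prod>a\<leftarrow>as. u + coord g e a) * mon e)"
    by (rule Cons.IH) (use Cons.prems \<open>a \<notin> set as\<close> in auto)
  from opu_key_cong[OF lam g e this, of u a, folded S] show ?case by simp
qed

lemma key_inj: "enum g \<Longrightarrow> inj (key g e)" for g :: "'n::finite \<Rightarrow> nat"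
proof (rule injI)
  fix a b assume g: "enum g" and "key g e a = key g e b"
  then have "\<not> key g e a < key g e b" "\<not> key g e b < key g e a" by auto
  then have "g a = g b" unfolding key_less_iff[OF g] by auto
  then show "a = b" using g by (auto simp: bij_betw_def inj_eq)
qed

definition zval :: "nat \<Rightarrow> (nat \<Rightarrow> nat) \<Rightarrow> complex \<Rightarrow> complex" where
  "zval n lam u = (\<Prod>i=1..n. u + (of_nat (lam i) + of_real \<gamma> * of_nat (n - i)))"

text \<open>Each monomial is treated in the order sorted by its own \<open>key\<close>, in which
  every factor is diagonal modulo lower terms; \<open>Zop\<close> is the same operator for all of
  them.\<close>

lemma Zop_mon:
  fixes g :: "'n::finite \<Rightarrow> nat"
  assumes lam: "lam \<in> partitions CARD('n)" and g: "enum g" and e: "e = lam \<circ> g"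
  shows "mspan (lset lam) (Zop u (mon e) - CC (zval CARD('n) lam u) * mon e)"
proof -
  define as where "as = sort_key (key g e) (univ_list :: 'n list)"
  have as: "distinct as" "set as = UNIV" by (auto simp: as_def univ_list)
  have "sorted_wrt (\<le>) (map (key g e) as)" by (simp add: as_def)
  moreover have "distinct (map (key g e) as)"
    using as key_inj[OF g, of e] by (auto simp: distinct_map intro: inj_on_subset)
  ultimately have "sorted_wrt (<) (map (key g e) as)" by (simp add: strict_sorted_iff)
  then have "sorted_wrt (\<lambda>a b. key g e a < key g e b) as" by (simp add: sorted_wrt_map)
  then have "mspan (lset lam) (zop u {} as (mon e) - CC (\<Prod>a\<leftarrow>as. u + coord g e a) * mon e)"
    by (intro zop_key[OF lam g e]) (use as in auto)
  moreover have "(\<Prod>a\<leftarrow>as. u + coord g e a) = (\<Prod>a\<in>UNIV. u + coord g e a)"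
    using prod.distinct_set_conv_list[OF as(1), of "\<lambda>a. u + coord g e a"] as(2) by simp
  moreover have "(\<Prod>a\<in>UNIV. u + coord g e a) = zval CARD('n) lam u"
    unfolding coord_def zval_def e using prod_enum[OF g, of "\<lambda>i. u + (of_nat (lam i) + of_real \<gamma> * of_nat (CARD('n) - i))"]
    by simp
  ultimately show ?thesis using Zop_eq[OF as, of u "mon e"] by simp
qed

section \<open>Symmetrization\<close>

definition Sy :: "'n::finite pol \<Rightarrow> 'n pol" where "Sy f = (\<Sum>p\<in>perms. act p f)"

lemma Sy_add [simp]: "Sy (f + g) = Sy f + Sy g" and Sy_CC_mult [simp]: "Sy (CC c * f) = CC c * Sy f"
  by (simp_all add: Sy_def sum.distrib sum_distrib_left)

lemmas Sy_linear [simp] =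
  additive_diff[of Sy, OF Sy_add]
  additive_zero[of Sy, OF Sy_add]
  additive_sum[of Sy, OF Sy_add]

lemma perms_compose_bij:
  fixes q :: "'n::finite \<Rightarrow> 'n"
  assumes "bij q"
  shows "bij_betw (\<lambda>p. p \<circ> q) perms (perms :: ('n \<Rightarrow> 'n) set)" "bij_betw (\<lambda>p. q \<circ> p) perms (perms :: ('n \<Rightarrow> 'n) set)"
proof -
  have i: "bij (inv q)" "q \<circ> inv q = id" "inv q \<circ> q = id"
    using assms by (simp_all add: bij_imp_bij_inv bij_is_inj flip: surj_iff) (simp add: bij_is_surj)
  have q: "q \<in> perms" "inv q \<in> perms" unfolding perms_def using assms i(1) by blast+
  show "bij_betw (\<lambda>p. p \<circ> q) perms (perms :: ('n \<Rightarrow> 'n) set)"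
    by (rule bij_betw_byWitness[of _ "\<lambda>p. p \<circ> inv q"])
      (use q in \<open>simp_all add: comp_assoc i(2,3) perms_comp image_subset_iff\<close>)
  show "bij_betw (\<lambda>p. q \<circ> p) perms (perms :: ('n \<Rightarrow> 'n) set)"
    by (rule bij_betw_byWitness[of _ "\<lambda>p. inv q \<circ> p"])
      (use q in \<open>simp_all add: o_assoc i(2,3) perms_comp image_subset_iff\<close>)
qed

lemma Sy_act: "bij q \<Longrightarrow> Sy (act q f) = Sy f"
  unfolding Sy_def act_act by (rule sum.reindex_bij_betw[OF perms_compose_bij(1), of q "\<lambda>p. act p f"])

lemma act_Sy: "bij q \<Longrightarrow> act q (Sy f) = Sy f"
  unfolding Sy_def act_sum act_act by (rule sum.reindex_bij_betw[OF perms_compose_bij(2), of q "\<lambda>p. act p f"])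

lemma sym_Sy: "sym (Sy f)" by (simp add: sym_def act_Sy)

lemma Sy_sym: "sym f \<Longrightarrow> Sy f = CC (of_nat (card (perms :: ('n::finite \<Rightarrow> 'n) set))) * f"
  for f :: "'n::finite pol" by (simp add: Sy_def symD of_nat_pol)

lemma card_perms_pos: "card (perms :: ('n::finite \<Rightarrow> 'n) set) > 0"
  by (metis card_gt_0_iff empty_iff perms_props(1,2))

lemma Zop_Sy: "Zop u (Sy f) = Sy (Zop u f)" by (simp add: Sy_def act_Zop)

lemma Y2_Sy: "Y2 (Sy f) = Sy (Y2 f)" by (simp add: Sy_def act_Y2)

lemma mspan_Sy: "stable D \<Longrightarrow> mspan D f \<Longrightarrow> mspan D (Sy f)"
  unfolding Sy_def by (intro mspan_sum mspan_act) auto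

definition e0 :: "(nat \<Rightarrow> nat) \<Rightarrow> 'n::finite \<Rightarrow> nat" where "e0 lam = lam \<circ> (SOME g. enum g)"

text \<open>A nonzero multiple of the monomial symmetric function (\<open>M_msym\<close>), written
  with \<open>Sy\<close> so that operators commuting with \<open>act\<close> pass through
  it.\<close>

definition M :: "(nat \<Rightarrow> nat) \<Rightarrow> 'n::finite pol" where "M lam = Sy (mon (e0 lam))"

lemma e0_enum: "\<exists>g::'n::finite \<Rightarrow> nat. enum g \<and> e0 lam = lam \<circ> g"
  unfolding e0_def using someI_ex[OF exists_enum] by blast

lemma Sy_mon: "enum g \<Longrightarrow> Sy (mon (lam \<circ> g)) = M lam" for g :: "'n::finite \<Rightarrow> nat"
proof -
  assume g: "enum g"
  obtain h :: "'n \<Rightarrow> nat" where h: "enum h" "e0 lam = lam \<circ> h" using e0_enum by blast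
  define p where "p = the_inv_into UNIV h \<circ> g"
  have "bij_betw p UNIV UNIV" unfolding p_def using bij_betw_trans[OF g bij_betw_the_inv_into[OF h(1)]] .
  moreover have "h \<circ> p = g"
    using g h(1) unfolding p_def by (auto simp: fun_eq_iff bij_betw_def intro!: f_the_inv_into_f)
  ultimately have "mon (lam \<circ> g) = act (inv p) (mon (e0 lam))"
    by (simp add: act_mono bij_imp_bij_inv inv_inv_eq h(2) o_assoc[symmetric])
  then show ?thesis using \<open>bij_betw p UNIV UNIV\<close> by (simp add: M_def Sy_act bij_imp_bij_inv)
qed

lemma sym_M: "sym (M lam)" unfolding M_def by (rule sym_Sy)

lemma mspan_M: "lam \<in> partitions CARD('n) \<Longrightarrow> mspan (dset lam) (M lam :: 'n::finite pol)"
proof -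
  assume "lam \<in> partitions CARD('n)"
  moreover obtain h :: "'n \<Rightarrow> nat" where "enum h" "e0 lam = lam \<circ> h" using e0_enum by blast
  ultimately show ?thesis unfolding M_def
    by (intro mspan_Sy stable_dset mspan_mono1) (simp add: orbit_dset_iff)
qed

lemma homi_M: "lam \<in> partitions CARD('n) \<Longrightarrow> homi (psize CARD('n) lam) (M lam :: 'n::finite pol)"
  by (rule mspan_homi[OF mspan_M]) (auto simp: dset_sum)

lemma Zop_M:
  assumes lam: "lam \<in> partitions CARD('n)"
  shows "mspan (lset lam) (Zop u (M lam) - CC (zval CARD('n) lam u) * (M lam :: 'n::finite pol))"
proof -
  obtain g :: "'n \<Rightarrow> nat" where g: "enum g" "e0 lam = lam \<circ> g" using e0_enum by blast
  have "mspan (lset lam) (Sy (Zop u (mon (e0 lam)) - CC (zval CARD('n) lam u) * mon (e0 lam :: 'n \<Rightarrow> nat)))"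
    by (intro mspan_Sy stable_lset Zop_mon[OF lam g])
  then show ?thesis by (simp add: M_def Zop_Sy)
qed

text \<open>Symmetrization trivializes the transpositions in \<open>AA_eq\<close>, so only the Euler
  degree k remains.\<close>

lemma sum_y: "homi k f \<Longrightarrow> Sy (\<Sum>i\<in>UNIV. y i f) = CC (of_nat k) * Sy f"
  for f :: "'n::finite pol"
proof -
  assume f: "homi k f"
  have "Sy (SS f) = CC (of_real (npairs TYPE('n))) * Sy f"
    unfolding SS_def by (simp add: Sy_act sum_offdiag_const of_nat_pol card_Diff_singleton CC_simps of_nat_diff)
  then have "Sy (AA f) = CC (complex_of_real (real k + \<gamma> / 2 * npairs TYPE('n))) * Sy f - CC (complex_of_real (\<gamma> / 2)) * (CC (of_real (npairs TYPE('n))) * Sy f)"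
    unfolding AA_eq[OF f] by simp
  also have "\<dots> = CC (of_nat k) * Sy f"
    by (rule pol_eqI) (simp add: algebra_simps)
  finally show ?thesis by (simp add: AA_def y_def)
qed

lemma sum_rank:
  fixes K :: "'n::finite \<Rightarrow> int" and F :: "nat \<Rightarrow> 'b::comm_monoid_add"
  assumes K: "inj K"
  shows "(\<Sum>a\<in>UNIV. F (card {j. K j < K a})) = (\<Sum>r<CARD('n). F r)"
proof (rule sum.reindex_bij_betw)
  have lt: "card {j. K j < K a} < card {j. K j < K b}" if "K a < K b" for a b
    by (rule psubset_card_mono) (use that in auto)
  have "inj (\<lambda>a. card {j. K j < K a})"
  proof (rule injI)
    fix a b assume "card {j. K j < K a} = card {j. K j < K b}"
    then have "K a = K b" using lt[of a b] lt[of b a] by (cases "K a" "K b" rule: linorder_cases) auto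
    then show "a = b" using K by (simp add: inj_eq)
  qed
  moreover have "range (\<lambda>a. card {j. K j < K a}) \<subseteq> {..<CARD('n)}"
  proof safe
    fix a show "card {j. K j < K a} < CARD('n)" by (rule psubset_card_mono) auto
  qed
  ultimately show "bij_betw (\<lambda>a. card {j. K j < K a}) UNIV {..<CARD('n)}"
    unfolding bij_betw_def by (metis card_image card_lessThan card_subset_eq finite_lessThan)
qed

text \<open>Leading coefficients are known for the xi but wanted for \<open>Y2\<close>. After
  symmetrization the squares of the xi differ from those of the y by cross terms, which collapse to
  the degree, and by squared ranks.\<close>

lemma Sy_sum_xi_squares:
  fixes K :: "'n::finite \<Rightarrow> int" and f :: "'n pol"
  assumes K: "inj K" and f: "homi k f"
  defines "S \<equiv> \<lambda>a. {j. K j < K a}"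
  shows "Sy (\<Sum>a\<in>UNIV. xi (S a) a (xi (S a) a f)) = Sy (Y2 f)
     + CC (of_real \<gamma> * (of_nat CARD('n) - 1) * of_nat k + (of_real \<gamma>)\<^sup>2 * (\<Sum>r<CARD('n). (of_nat r)\<^sup>2)) * Sy f"
proof -
  have Syxi: "Sy (xi (S a) a h) = Sy (y a h) + gam * (of_nat (card (S a)) * Sy h)" for a h
    unfolding xi_def by (simp add: Sy_act)
  have yxi: "Sy (y a (xi (S a) a f)) = Sy (y a (y a f)) + gam * (\<Sum>l\<in>S a. Sy (y l f))" for a
  proof -
    have "Sy (y a (act (tr a l) f)) = Sy (y l f)" for l
      using Sy_act[of "tr a l" "y l f"] by (simp add: act_y)
    then show ?thesis unfolding xi_def by simp
  qed
  \<comment> \<open>The cross terms from the right factor count how often l precedes others, those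
    from the left how many precede l; together every other index is counted once.\<close>
  have cnt: "card {a. l \<in> S a} + card (S l) = CARD('n) - 1" for l
  proof -
    have "card ({a. l \<in> S a} \<union> S l) = card {a. l \<in> S a} + card (S l)"
      by (rule card_Un_disjoint) (auto simp: S_def)
    moreover have "{a. l \<in> S a} \<union> S l = UNIV - {l}"
      using K by (auto simp: S_def inj_eq neq_iff) (metis K injD linorder_less_linear)
    ultimately show ?thesis by (simp add: card_Diff_singleton)
  qed
  have swap: "(\<Sum>a\<in>UNIV. \<Sum>l\<in>S a. Sy (y l f)) = (\<Sum>l\<in>UNIV. of_nat (card {a. l \<in> S a}) * Sy (y l f))"
  proof -
    have "(\<Sum>a\<in>UNIV. \<Sum>l\<in>S a. Sy (y l f)) = (\<Sum>a\<in>UNIV. \<Sum>l\<in>UNIV. if l \<in> S a then Sy (y l f) else 0)"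
      by (intro sum.cong refl sum.mono_neutral_cong_left) auto
    also have "\<dots> = (\<Sum>l\<in>UNIV. \<Sum>a\<in>UNIV. if l \<in> S a then Sy (y l f) else 0)" by (rule sum.swap)
    also have "\<dots> = (\<Sum>l\<in>UNIV. of_nat (card {a. l \<in> S a}) * Sy (y l f))"
      by (intro sum.cong refl) (simp add: sum.If_cases)
    finally show ?thesis .
  qed
  have "(\<Sum>l\<in>UNIV. of_nat (card {a. l \<in> S a}) * Sy (y l f)) + (\<Sum>l\<in>UNIV. of_nat (card (S l)) * Sy (y l f))
     = (\<Sum>l\<in>UNIV. of_nat (CARD('n) - 1) * Sy (y l f))"
    unfolding sum.distrib[symmetric] distrib_right[symmetric] of_nat_add[symmetric] cnt ..
  also have "\<dots> = of_nat (CARD('n) - 1) * Sy (\<Sum>i\<in>UNIV. y i f)" by (simp add: sum_distrib_left)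
  also have "\<dots> = of_nat (CARD('n) - 1) * (CC (of_nat k) * Sy f)" by (simp only: sum_y[OF f])
  finally have lin: "(\<Sum>l\<in>UNIV. of_nat (card {a. l \<in> S a}) * Sy (y l f)) + (\<Sum>l\<in>UNIV. of_nat (card (S l)) * Sy (y l f))
    = of_nat (CARD('n) - 1) * (CC (of_nat k) * Sy f)" .
  have sq: "(\<Sum>a\<in>UNIV. (of_nat (card (S a)))\<^sup>2 :: 'n pol) = CC (\<Sum>r<CARD('n). (of_nat r)\<^sup>2)"
    using sum_rank[OF K, of "\<lambda>r. (of_nat r)\<^sup>2 :: 'n pol"] by (simp add: S_def CC_sum of_nat_pol power2_eq_square CC_simps)
  have "Sy (xi (S a) a (xi (S a) a f)) = Sy (y a (y a f)) + gam * (\<Sum>l\<in>S a. Sy (y l f))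
    + gam * (of_nat (card (S a)) * Sy (y a f)) + gam * gam * ((of_nat (card (S a)))\<^sup>2 * Sy f)" for a
    unfolding Syxi[of a "xi (S a) a f"] yxi Syxi[of a f] by (simp add: algebra_simps power2_eq_square)
  then have "Sy (\<Sum>a\<in>UNIV. xi (S a) a (xi (S a) a f)) = (\<Sum>a\<in>UNIV. Sy (y a (y a f))) + gam * (\<Sum>a\<in>UNIV. \<Sum>l\<in>S a. Sy (y l f))
    + gam * (\<Sum>a\<in>UNIV. of_nat (card (S a)) * Sy (y a f)) + gam * gam * ((\<Sum>a\<in>UNIV. (of_nat (card (S a)))\<^sup>2) * Sy f)"
    by (simp add: sum.distrib sum_distrib_left sum_distrib_right)
  also have "\<dots> = Sy (Y2 f) + gam * (of_nat (CARD('n) - 1) * (CC (of_nat k) * Sy f)) + gam * gam * (CC (\<Sum>r<CARD('n). (of_nat r)\<^sup>2) * Sy f)"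
    unfolding swap sq lin[symmetric] by (simp add: Y2_def distrib_left)
  also have "\<dots> = Sy (Y2 f) + CC (of_real \<gamma> * (of_nat CARD('n) - 1) * of_nat k + (of_real \<gamma>)\<^sup>2 * (\<Sum>r<CARD('n). (of_nat r)\<^sup>2)) * Sy f"
    by (rule pol_eqI) (simp add: of_nat_pol of_nat_diff algebra_simps power2_eq_square)
  finally show ?thesis .
qed

text \<open>The sum of the squares of lam_i + gamma (n - i), less the two corrections of
  \<open>Sy_sum_xi_squares\<close>; the squared ranks cancel the terms gamma^2 (n - i)^2.\<close>

definition yval :: "nat \<Rightarrow> (nat \<Rightarrow> nat) \<Rightarrow> real" where
  "yval n lam = (\<Sum>i=1..n. (real (lam i))\<^sup>2 + 2 * \<gamma> * real (lam i) * real (n - i)) - \<gamma> * (real n - 1) * real (psize n lam)"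

lemma Y2_M:
  assumes lam: "lam \<in> partitions CARD('n)"
  shows "mspan (lset lam) (Y2 (M lam) - CC (of_real (yval CARD('n) lam)) * (M lam :: 'n::finite pol))"
proof -
  obtain g :: "'n \<Rightarrow> nat" where g: "enum g" "e0 lam = lam \<circ> g" using e0_enum by blast
  define e where "e = (e0 lam :: 'n \<Rightarrow> nat)"
  define k where "k = psize CARD('n) lam"
  have e: "e = lam \<circ> g" using g by (simp add: e_def)
  have "e \<in> dset lam" unfolding e using lam g(1) by (simp add: orbit_dset_iff)
  then have hom: "homi k (mon e)" by (intro mspan_homi[OF mspan_mono1]) (auto simp: dset_sum k_def)
  define S where "S = (\<lambda>a. {j. key g e j < key g e a})"
  have xisq: "mspan (lset lam) (xi (S a) a (xi (S a) a (mon e)) - CC ((coord g e a)\<^sup>2) * mon e)" for a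
    using opu_key_cong[OF lam g(1) e, of "xi (S a) a (mon e)" "coord g e a" 0 a] xi_key[OF lam g(1) e, of a]
    by (simp add: opu_def S_def CC_simps power2_eq_square)
  have sx: "Sy (\<Sum>a\<in>UNIV. xi (S a) a (xi (S a) a (mon e))) = Sy (Y2 (mon e))
     + CC (of_real \<gamma> * (of_nat CARD('n) - 1) * of_nat k + (of_real \<gamma>)\<^sup>2 * (\<Sum>r<CARD('n). (of_nat r)\<^sup>2)) * Sy (mon e)"
    unfolding S_def by (rule Sy_sum_xi_squares[OF key_inj[OF g(1)] hom])
  define c where "c = (\<Sum>a\<in>UNIV. (coord g e a)\<^sup>2)"
  have "mspan (lset lam) (Sy (\<Sum>a\<in>UNIV. xi (S a) a (xi (S a) a (mon e)) - CC ((coord g e a)\<^sup>2) * mon e))"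
    by (intro mspan_Sy stable_lset mspan_sum xisq)
  also have "Sy (\<Sum>a\<in>UNIV. xi (S a) a (xi (S a) a (mon e)) - CC ((coord g e a)\<^sup>2) * mon e)
    = Sy (\<Sum>a\<in>UNIV. xi (S a) a (xi (S a) a (mon e))) - CC c * Sy (mon e)"
    unfolding sum_subtractf by (simp add: c_def CC_sum sum_distrib_right)
  also have "\<dots> = Y2 (M lam) + CC (of_real \<gamma> * (of_nat CARD('n) - 1) * of_nat k + (of_real \<gamma>)\<^sup>2 * (\<Sum>r<CARD('n). (of_nat r)\<^sup>2)) * M lam - CC c * M lam"
    unfolding sx by (simp only: M_def Y2_Sy e_def)
  also have "\<dots> = Y2 (M lam) - CC (c - (of_real \<gamma> * (of_nat CARD('n) - 1) * of_nat k + (of_real \<gamma>)\<^sup>2 * (\<Sum>r<CARD('n). (of_nat r)\<^sup>2))) * M lam"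
    by (simp add: CC_simps algebra_simps)
  also have "c - (of_real \<gamma> * (of_nat CARD('n) - 1) * of_nat k + (of_real \<gamma>)\<^sup>2 * (\<Sum>r<CARD('n). (of_nat r)\<^sup>2)) = of_real (yval CARD('n) lam)"
  proof -
    have "c = (\<Sum>i=1..CARD('n). (of_nat (lam i) + of_real \<gamma> * of_nat (CARD('n) - i))\<^sup>2)"
      unfolding c_def coord_def e using sum_enum[OF g(1), of "\<lambda>i. (of_nat (lam i) + complex_of_real \<gamma> * of_nat (CARD('n) - i))\<^sup>2"] by simp
    also have "\<dots> = of_real (\<Sum>i=1..CARD('n). (real (lam i))\<^sup>2 + 2 * \<gamma> * real (lam i) * real (CARD('n) - i)) + (of_real \<gamma>)\<^sup>2 * (\<Sum>i=1..CARD('n). (of_nat (CARD('n) - i))\<^sup>2)"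
      unfolding of_real_sum sum_distrib_left sum.distrib[symmetric]
      by (intro sum.cong refl) (simp add: power2_eq_square algebra_simps)
    also have "(\<Sum>i=1..CARD('n). (of_nat (CARD('n) - i))\<^sup>2) = (\<Sum>r<CARD('n). (of_nat r :: complex)\<^sup>2)"
      by (rule sum.reindex_bij_witness[of _ "\<lambda>r. CARD('n) - r" "\<lambda>i. CARD('n) - i"]) auto
    finally show ?thesis by (simp add: yval_def k_def algebra_simps)
  qed
  finally show ?thesis .
qed

end

section \<open>Dominance order\<close>

definition parts :: "nat \<Rightarrow> nat \<Rightarrow> (nat \<Rightarrow> nat) set" where
  "parts n k = {lam \<in> partitions n. psize n lam = k}"

lemma finite_parts [simp]: "finite (parts n k)"
proof (rule finite_subset)
  show "parts n k \<subseteq> {f. \<forall>x. (x \<in> {1..n} \<longrightarrow> f x \<in> {..k}) \<and> (x \<notin> {1..n} \<longrightarrow> f x = 0)}"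
    by (auto simp: parts_def partitions_def psize_def intro: member_le_sum)
  show "finite {f::nat \<Rightarrow> nat. \<forall>x. (x \<in> {1..n} \<longrightarrow> f x \<in> {..k}) \<and> (x \<notin> {1..n} \<longrightarrow> f x = 0)}"
    by (rule finite_set_of_finite_funs) auto
qed

lemma abel_sum_ge:
  fixes f d :: "nat \<Rightarrow> real"
  assumes "\<And>i. 1 \<le> i \<Longrightarrow> i < n \<Longrightarrow> f (Suc i) \<le> f i" "\<And>j. 1 \<le> j \<Longrightarrow> j \<le> n \<Longrightarrow> 0 \<le> (\<Sum>i=1..j. d i)" "1 \<le> n"
  shows "f n * (\<Sum>i=1..n. d i) \<le> (\<Sum>i=1..n. f i * d i)"
  using assms(3,1,2)
proof (induction n rule: dec_induct)
  case (step n)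
  have "f (Suc n) * (\<Sum>i=1..n. d i) \<le> f n * (\<Sum>i=1..n. d i)"
    using step by (intro mult_right_mono) auto
  also have "\<dots> \<le> (\<Sum>i=1..n. f i * d i)" by (rule step.IH) (use step in auto)
  finally show ?case using step.hyps by (simp add: algebra_simps)
qed simp

text \<open>Summation by parts: the partial sums of lam - mu are nonnegative, their total is 0, and
  the weights decrease.\<close>

lemma dominance_weighted_sum:
  fixes f :: "nat \<Rightarrow> real"
  assumes "dominance_le n mu lam" "\<And>i. 1 \<le> i \<Longrightarrow> i < n \<Longrightarrow> f (Suc i) \<le> f i"
  shows "(\<Sum>i=1..n. f i * real (mu i)) \<le> (\<Sum>i=1..n. f i * real (lam i))"
proof (cases "n = 0")
  case False
  define d where "d = (\<lambda>i. real (lam i) - real (mu i))"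
  have "(\<Sum>i=1..n. d i) = 0"
    using assms(1) by (simp add: d_def dominance_le_def psize_def sum_subtractf flip: of_nat_sum)
  moreover have "0 \<le> (\<Sum>i=1..j. d i)" if "1 \<le> j" "j \<le> n" for j
    using assms(1) that by (auto simp: d_def dominance_le_def sum_subtractf simp flip: of_nat_sum)
  ultimately have "0 \<le> (\<Sum>i=1..n. f i * d i)"
    using abel_sum_ge[of n f d] assms(2) False by simp
  then show ?thesis by (simp add: d_def sum_subtractf right_diff_distrib)
qed simp

text \<open>The difference is the sum of (lam_i - mu_i)^2 plus twice the sum of mu_i (lam_i - mu_i),
  and the latter is nonnegative with mu as decreasing weights.\<close>

lemma dominance_squares_less:
  assumes "dominance_le n mu lam" "mu \<noteq> lam" "mu \<in> partitions n" "lam \<in> partitions n"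
  shows "(\<Sum>i=1..n. (real (mu i))\<^sup>2) < (\<Sum>i=1..n. (real (lam i))\<^sup>2)"
proof -
  obtain i where i: "mu i \<noteq> lam i" using assms(2) by auto
  have "nu i = 0" if "i \<notin> {1..n}" "nu \<in> partitions n" for nu
    using that unfolding partitions_def by blast
  then have "i \<in> {1..n}" using i assms(3,4) by metis
  then have "0 < (\<Sum>i=1..n. (real (lam i) - real (mu i))\<^sup>2)"
    using i by (intro sum_pos2[of _ i]) auto
  moreover have "(\<Sum>i=1..n. real (mu i) * real (mu i)) \<le> (\<Sum>i=1..n. real (mu i) * real (lam i))"
    using assms(1) by (rule dominance_weighted_sum) (use assms(3) in \<open>auto simp: partitions_def\<close>)
  moreover have "(\<Sum>i=1..n. (real (lam i))\<^sup>2) - (\<Sum>i=1..n. (real (mu i))\<^sup>2) = (\<Sum>i=1..n. (real (lam i) - real (mu i))\<^sup>2)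
    + 2 * ((\<Sum>i=1..n. real (mu i) * real (lam i)) - (\<Sum>i=1..n. real (mu i) * real (mu i)))"
    unfolding sum_subtractf[symmetric] sum_distrib_left sum.distrib[symmetric]
    by (intro sum.cong refl) (simp add: power2_eq_square algebra_simps)
  ultimately show ?thesis by simp
qed

definition Low :: "nat \<Rightarrow> (nat \<Rightarrow> nat) \<Rightarrow> (nat \<Rightarrow> nat) set" where
  "Low n lam = {mu \<in> partitions n. dominance_le n mu lam \<and> mu \<noteq> lam}"

lemma Low_subset_parts: "Low n lam \<subseteq> parts n (psize n lam)"
  by (auto simp: Low_def parts_def dominance_le_def)

lemma finite_Low [simp]: "finite (Low n lam)"
  by (rule finite_subset[OF Low_subset_parts]) simp

lemma finite_below [simp]: "finite {mu \<in> partitions n. dominance_le n mu lam}"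
  by (rule finite_subset[OF _ finite_parts[of n "psize n lam"]]) (auto simp: parts_def dominance_le_def)

lemma lset_orbit:
  fixes e :: "'n::finite \<Rightarrow> nat"
  assumes "e \<in> lset lam" "lam \<in> partitions CARD('n)"
  shows "\<exists>mu\<in>Low CARD('n) lam. \<exists>h. enum h \<and> e = mu \<circ> h"
proof -
  obtain nu where nu: "nu \<in> partitions CARD('n)" "dominance_le CARD('n) nu lam" "nu \<noteq> lam" "e \<in> dset nu"
    using assms(1) by (auto simp: lset_def)
  obtain mu h where mu: "mu \<in> partitions CARD('n)" "enum h" "e = mu \<circ> h" using exists_sorted[of e] by blast
  have d: "dominance_le CARD('n) mu nu" using orbit_dset_iff[OF mu(1,2)] nu(4) mu(3) by simp
  have "mu \<noteq> lam"
  proof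
    assume "mu = lam"
    then show False
      using dominance_squares_less[OF nu(2,3,1) assms(2)] dominance_squares_less[OF d _ mu(1) nu(1)] nu(3) by auto
  qed
  then show ?thesis using mu dominance_trans[OF d nu(2)] by (auto simp: Low_def)
qed

section \<open>Linear combinations\<close>

definition lincomb :: "('i \<Rightarrow> 'n::finite pol) \<Rightarrow> 'i set \<Rightarrow> 'n pol \<Rightarrow> bool" where
  "lincomb B L f \<longleftrightarrow> (\<exists>c. f = (\<Sum>i\<in>L. CC (c i) * B i))"

lemma lincomb_zero: "lincomb B L 0"
  unfolding lincomb_def by (rule exI[of _ "\<lambda>_. 0"]) (simp add: CC_simps)

lemma lincomb_add: "lincomb B L f \<Longrightarrow> lincomb B L g \<Longrightarrow> lincomb B L (f + g)"
proof -
  assume "lincomb B L f" "lincomb B L g"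
  then obtain c d where "f = (\<Sum>i\<in>L. CC (c i) * B i)" "g = (\<Sum>i\<in>L. CC (d i) * B i)" unfolding lincomb_def by blast
  then show ?thesis unfolding lincomb_def
    by (intro exI[of _ "\<lambda>i. c i + d i"]) (simp add: CC_simps distrib_right sum.distrib)
qed

lemma lincomb_scale: "lincomb B L f \<Longrightarrow> lincomb B L (CC t * f)"
proof -
  assume "lincomb B L f"
  then obtain c where "f = (\<Sum>i\<in>L. CC (c i) * B i)" unfolding lincomb_def by blast
  then show ?thesis unfolding lincomb_def
    by (intro exI[of _ "\<lambda>i. t * c i"]) (simp add: CC_simps sum_distrib_left mult.assoc)
qed

lemma lincomb_uminus: "lincomb B L f \<Longrightarrow> lincomb B L (- f)"
  using lincomb_scale[of B L f "-1"] by (simp add: CC_simps)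

lemma lincomb_diff: "lincomb B L f \<Longrightarrow> lincomb B L g \<Longrightarrow> lincomb B L (f - g)"
  using lincomb_add[OF _ lincomb_uminus] by fastforce

lemma lincomb_sum: "(\<And>a. a \<in> S \<Longrightarrow> lincomb B L (f a)) \<Longrightarrow> lincomb B L (sum f S)"
  by (induction S rule: infinite_finite_induct) (auto intro: lincomb_zero lincomb_add)

lemma lincomb_single: "finite L \<Longrightarrow> i \<in> L \<Longrightarrow> lincomb B L (B i)"
  unfolding lincomb_def
  by (rule exI[of _ "\<lambda>j. if j = i then 1 else 0"]) (simp add: CC_simps if_distrib if_distribR cong: if_cong)

lemma lincomb_subst: "lincomb B L f \<Longrightarrow> (\<And>i. i \<in> L \<Longrightarrow> lincomb B' L' (B i)) \<Longrightarrow> lincomb B' L' f"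
proof -
  assume "lincomb B L f" and *: "\<And>i. i \<in> L \<Longrightarrow> lincomb B' L' (B i)"
  then obtain c where "f = (\<Sum>i\<in>L. CC (c i) * B i)" unfolding lincomb_def by blast
  then show ?thesis using * by (auto intro!: lincomb_sum lincomb_scale)
qed

lemma lincomb_mono: "lincomb B L f \<Longrightarrow> L \<subseteq> L' \<Longrightarrow> finite L' \<Longrightarrow> lincomb B L' f"
  by (rule lincomb_subst[of B L f]) (auto intro: lincomb_single)

context jack
begin

lemma sym_diff: "sym f \<Longrightarrow> sym g \<Longrightarrow> sym (f - g)"
  and sym_scale: "sym f \<Longrightarrow> sym (CC c * f)" and sym_mult: "sym f \<Longrightarrow> sym g \<Longrightarrow> sym (f * g)"
  by (simp_all add: sym_def)

lemma sym_sum: "(\<And>a. a \<in> S \<Longrightarrow> sym (f a)) \<Longrightarrow> sym (sum f S)"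
  by (simp add: sym_def)

lemma sym_Zop: "sym f \<Longrightarrow> sym (Zop u f)" and sym_Y2: "sym f \<Longrightarrow> sym (Y2 f)"
  by (simp_all add: sym_def act_Zop act_Y2)

lemma Sy_lincomb:
  assumes "mspan D f" "\<And>e. e \<in> D \<Longrightarrow> \<exists>mu\<in>L. \<exists>h. enum h \<and> e = mu \<circ> h" "finite L"
  shows "lincomb M L (Sy f)"
  using assms(1)
proof (induction rule: mspan.induct)
  case (mspan_mono e c)
  then obtain mu h where "mu \<in> L" "enum h" "e = mu \<circ> h" using assms(2) by blast
  then show ?case using assms(3) by (auto simp: Sy_mon intro!: lincomb_scale lincomb_single)
qed (auto intro: lincomb_zero lincomb_add)

lemma sym_lincomb:
  fixes f :: "'n::finite pol"
  assumes "sym f" "mspan D f" "\<And>e. e \<in> D \<Longrightarrow> \<exists>mu\<in>L. \<exists>h. enum h \<and> e = mu \<circ> h" "finite L"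
  shows "lincomb M L f"
proof -
  define N where "N = complex_of_nat (card (perms :: ('n \<Rightarrow> 'n) set))"
  have "N \<noteq> 0" using card_perms_pos[where 'n='n] unfolding N_def by (metis of_nat_eq_0_iff less_numeral_extra(3))
  then have "f = CC (1 / N) * Sy f"
    using Sy_sym[OF assms(1)] by (simp add: N_def flip: mult.assoc CC_simps(2)) (simp add: CC_simps)
  then show ?thesis using lincomb_scale[OF Sy_lincomb[OF assms(2-4)]] by metis
qed

section \<open>Construction of the Jack polynomials\<close>

lemma orthogonal_projection:
  fixes v :: "'n::finite pol"
  assumes "finite B" "\<And>b. b \<in> B \<Longrightarrow> homi k b" "homi k v"
  shows "\<exists>c. \<forall>b\<in>B. form k (v - (\<Sum>b\<in>B. CC (c b) * b)) b = 0"
  using assms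
proof (induction B arbitrary: v rule: finite_induct)
  case (insert b B)
  obtain cv where cv: "\<And>x. x \<in> B \<Longrightarrow> form k (v - (\<Sum>x\<in>B. CC (cv x) * x)) x = 0"
    using insert.IH[of v] insert.prems by auto
  obtain cb where cb: "\<And>x. x \<in> B \<Longrightarrow> form k (b - (\<Sum>x\<in>B. CC (cb x) * x)) x = 0"
    using insert.IH[of b] insert.prems by auto
  define v' where "v' = v - (\<Sum>x\<in>B. CC (cv x) * x)"
  define b' where "b' = b - (\<Sum>x\<in>B. CC (cb x) * x)"
  have hb': "homi k b'" unfolding b'_def using insert.prems by (intro homi_diff homi_sum homi_scale) auto
  have b: "b = b' + (\<Sum>x\<in>B. CC (cb x) * x)" by (simp add: b'_def)
  \<comment> \<open>If \<open>b'\<close> is 0, then \<open>b\<close> is a combination of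
    \<open>B\<close> and the projection onto \<open>B\<close> suffices; otherwise definiteness
    allows the division.\<close>
  define t where "t = (if b' = 0 then 0 else form k v' b' / form k b' b')"
  define w where "w = v' - CC t * b'"
  have tb: "form k w b' = 0"
  proof (cases "b' = 0")
    case False
    then have "form k b' b' \<noteq> 0" using qf_eq_0D[OF hb'] form_self[OF hb'] by auto
    then show ?thesis by (simp add: w_def t_def False)
  qed simp
  have tB: "form k w x = 0" if "x \<in> B" for x
    using cv[OF that] cb[OF that] by (simp add: w_def v'_def[symmetric] b'_def[symmetric])
  have "form k w b = 0"
    by (subst b) (simp add: tb tB)
  moreover have "w = v - (\<Sum>x\<in>insert b B. CC ((if x = b then t else cv x - t * cb x)) * x)"
  proof -
    have "(\<Sum>x\<in>insert b B. CC ((if x = b then t else cv x - t * cb x)) * x) = CC t * b + (\<Sum>x\<in>B. CC (cv x - t * cb x) * x)"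
      using insert.hyps by (simp add: sum.insert) (auto intro!: sum.cong)
    also have "(\<Sum>x\<in>B. CC (cv x - t * cb x) * x) = (\<Sum>x\<in>B. CC (cv x) * x) - CC t * (\<Sum>x\<in>B. CC (cb x) * x)"
      unfolding sum_distrib_left sum_subtractf[symmetric]
      by (intro sum.cong refl) (simp add: CC_simps algebra_simps)
    finally show ?thesis by (simp add: w_def v'_def b'_def algebra_simps)
  qed
  ultimately show ?case using tB by (intro exI[of _ "\<lambda>x. if x = b then t else cv x - t * cb x"]) auto
qed simp

text \<open>All lower symmetric polynomials are projected away at once, which respects the partial
  order and makes the eigenvector property a consequence of self-adjointness.\<close>

lemma Pj_exists:
  assumes lam: "lam \<in> partitions CARD('n)"
  shows "\<exists>P::'n::finite pol. sym P \<and> mspan (lset lam) (P - M lam) \<and>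
    (\<forall>g. sym g \<longrightarrow> mspan (lset lam) g \<longrightarrow> form (psize CARD('n) lam) P g = 0)"
proof -
  define k where "k = psize CARD('n) lam"
  define B where "B = (M :: _ \<Rightarrow> 'n pol) ` Low CARD('n) lam"
  have low: "mspan (lset lam) b" if "b \<in> B" for b
  proof -
    from that obtain mu where mu: "mu \<in> Low CARD('n) lam" "b = M mu" unfolding B_def by blast
    show ?thesis unfolding mu(2)
      by (rule mspan_subset[OF mspan_M]) (use mu(1) in \<open>auto simp: Low_def lset_def\<close>)
  qed
  have hom: "homi k b" if "b \<in> B" for b using mspan_homi[OF low[OF that]] by (auto simp: k_def lset_sum)
  have symB: "sym b" if "b \<in> B" for b using that by (auto simp: B_def sym_M)
  obtain c where c: "\<And>b. b \<in> B \<Longrightarrow> form k (M lam - (\<Sum>b\<in>B. CC (c b) * b)) b = 0"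
    using orthogonal_projection[of B k "M lam"] hom homi_M[OF lam] by (auto simp: B_def k_def)
  define P where "P = M lam - (\<Sum>b\<in>B. CC (c b) * b)"
  have "sym P" unfolding P_def by (intro sym_diff sym_M sym_sum sym_scale symB)
  moreover have "mspan (lset lam) (P - M lam)"
    unfolding P_def by (simp, intro mspan_uminus mspan_sum mspan_scale low)
  moreover have "form k P g = 0" if "sym g" "mspan (lset lam) g" for g
  proof -
    have "lincomb M (Low CARD('n) lam) g" using that by (rule sym_lincomb) (use lset_orbit lam in auto)
    then obtain d where "g = (\<Sum>mu\<in>Low CARD('n) lam. CC (d mu) * M mu)" unfolding lincomb_def by blast
    moreover have "form k P (M mu) = 0" if "mu \<in> Low CARD('n) lam" for mu
      unfolding P_def by (rule c) (use that in \<open>simp add: B_def\<close>)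
    ultimately show ?thesis by simp
  qed
  ultimately show ?thesis unfolding k_def by blast
qed

definition Pj :: "(nat \<Rightarrow> nat) \<Rightarrow> 'n::finite pol" where
  "Pj lam = (SOME P. sym P \<and> mspan (lset lam) (P - M lam) \<and>
    (\<forall>g. sym g \<longrightarrow> mspan (lset lam) g \<longrightarrow> form (psize CARD('n) lam) P g = 0))"

lemma Pj:
  assumes lam: "lam \<in> partitions CARD('n)"
  shows sym_Pj: "sym (Pj lam :: 'n::finite pol)" and mspan_Pj_diff: "mspan (lset lam) (Pj lam - M lam :: 'n pol)"
    and form_Pj_lower: "\<And>g. sym g \<Longrightarrow> mspan (lset lam) g \<Longrightarrow> form (psize CARD('n) lam) (Pj lam :: 'n pol) g = 0"
  using someI_ex[OF Pj_exists[OF lam]] unfolding Pj_def by blast+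

lemma homi_lset: "mspan (lset lam) f \<Longrightarrow> homi (psize CARD('n) lam) (f :: 'n::finite pol)"
  by (erule mspan_homi) (rule lset_sum)

lemma homi_Pj: "lam \<in> partitions CARD('n) \<Longrightarrow> homi (psize CARD('n) lam) (Pj lam :: 'n::finite pol)"
  using homi_add[OF homi_lset[OF mspan_Pj_diff] homi_M] by fastforce

text \<open>By triangularity h = L P - c P lies in the lower span. Moving L to the other argument,
  the form of h with h becomes a combination of forms of P with lower polynomials, hence 0, and
  definiteness gives h = 0.\<close>

lemma Pj_eigen:
  fixes L :: "'n::finite pol \<Rightarrow> 'n pol"
  assumes lam: "lam \<in> partitions CARD('n)"
    and add: "\<And>f g. L (f + g) = L f + L g"
    and adj: "\<And>f g. homi (psize CARD('n) lam) f \<Longrightarrow> homi (psize CARD('n) lam) g \<Longrightarrow> form (psize CARD('n) lam) (L f) g = form (psize CARD('n) lam) f (L g)"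
    and symL: "\<And>f. sym f \<Longrightarrow> sym (L f)" and spanL: "\<And>f. mspan (lset lam) f \<Longrightarrow> mspan (lset lam) (L f)"
    and lead: "mspan (lset lam) (L (M lam) - CC c * M lam)"
  shows "L (Pj lam) = CC c * Pj lam"
proof -
  define h where "h = L (Pj lam) - CC c * Pj lam"
  have "h = L (Pj lam - M lam) + (L (M lam) - CC c * M lam) - CC c * (Pj lam - M lam)"
    by (simp add: h_def additive_diff[of L, OF add] algebra_simps)
  also have "mspan (lset lam) \<dots>"
    by (intro mspan_diff mspan_add spanL mspan_Pj_diff lead mspan_scale lam)
  finally have h: "mspan (lset lam) h" .
  have symh: "sym h" unfolding h_def by (intro sym_diff symL sym_scale sym_Pj lam)
  have "form (psize CARD('n) lam) h h = 0"
    unfolding h_def[THEN arg_cong[of _ _ "\<lambda>x. form _ x h"]]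
    by (simp add: adj[OF homi_Pj[OF lam] homi_lset[OF h]] form_Pj_lower[OF lam] symh h symL spanL)
  then have "h = 0" using qf_eq_0D[OF homi_lset[OF h]] by (simp add: qf_def)
  then show ?thesis by (simp add: h_def)
qed

lemma Zop_Pj:
  assumes "lam \<in> partitions CARD('n)"
  shows "Zop (of_real u) (Pj lam) = CC (zval CARD('n) lam (of_real u)) * (Pj lam :: 'n::finite pol)"
  by (rule Pj_eigen[OF assms]) (auto intro: form_Zop sym_Zop mspan_Zop stable_lset Zop_M assms)

lemma Y2_Pj:
  assumes "lam \<in> partitions CARD('n)"
  shows "Y2 (Pj lam) = CC (of_real (yval CARD('n) lam)) * (Pj lam :: 'n::finite pol)"
  by (rule Pj_eigen[OF assms]) (auto intro: form_Y2 sym_Y2 mspan_Y2 stable_lset Y2_M assms)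

text \<open>The numbers lam_i + gamma (n - i) strictly decrease because gamma > 0. So their set,
  read off from the zeros in u, determines which number belongs to which i.\<close>

lemma zval_separates:
  assumes lam: "lam \<in> partitions n" and mu: "mu \<in> partitions n" and eq: "\<And>u::real. zval n lam (of_real u) = zval n mu (of_real u)"
  shows "lam = mu"
proof -
  define r where "r = (\<lambda>lam i. real (lam i) + \<gamma> * real (n - i))"
  have z: "zval n lam (of_real u) = of_real (\<Prod>i=1..n. u + r lam i)" for lam u
    by (simp add: zval_def r_def)
  have zero: "(\<exists>i\<in>{1..n}. x = r lam i) \<longleftrightarrow> (\<exists>i\<in>{1..n}. x = r mu i)" for x
  proof -
    have "(\<Prod>i=1..n. - x + r lam i) = (\<Prod>i=1..n. - x + r mu i)"
      using eq[of "-x"] unfolding z of_real_eq_iff .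
    then have "(\<Prod>i=1..n. - x + r lam i) = 0 \<longleftrightarrow> (\<Prod>i=1..n. - x + r mu i) = 0" by (simp only:)
    moreover have "- x + r nu i = 0 \<longleftrightarrow> x = r nu i" for nu i by auto
    ultimately show ?thesis by (simp only: prod_zero_iff[OF finite_atLeastAtMost])
  qed
  have dec: "r nu j < r nu i" if "nu \<in> partitions n" "1 \<le> i" "i < j" "j \<le> n" for nu i j
  proof -
    have "real (nu j) \<le> real (nu i)" using partition_decr[OF that(1,2), of j] that by simp
    moreover have "\<gamma> * real (n - j) < \<gamma> * real (n - i)" using that gamma_pos by simp
    ultimately show ?thesis unfolding r_def by linarith
  qed
  have rank: "card {x. (\<exists>l\<in>{1..n}. x = r nu l) \<and> r nu i < x} = i - 1" if "nu \<in> partitions n" "i \<in> {1..n}" for nu i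
  proof -
    have inj: "inj_on (r nu) {1..n}"
      by (rule linorder_inj_onI') (use dec[OF that(1)] in force)
    have "{x. (\<exists>l\<in>{1..n}. x = r nu l) \<and> r nu i < x} = r nu ` {1..<i}"
    proof (intro equalityI subsetI)
      fix x assume "x \<in> {x. (\<exists>l\<in>{1..n}. x = r nu l) \<and> r nu i < x}"
      then obtain l where l: "l \<in> {1..n}" "x = r nu l" "r nu i < r nu l" by blast
      then have "l < i" using dec[OF that(1), of i l] that(2) by (cases i l rule: linorder_cases) auto
      then show "x \<in> r nu ` {1..<i}" using l by auto
    next
      fix x assume "x \<in> r nu ` {1..<i}"
      then show "x \<in> {x. (\<exists>l\<in>{1..n}. x = r nu l) \<and> r nu i < x}" using dec[OF that(1)] that(2) by force
    qed
    moreover have "{1..<i} \<subseteq> {1..n}" using that(2) by auto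
    ultimately show ?thesis using card_image[OF inj_on_subset[OF inj]] by simp
  qed
  show ?thesis
  proof
    fix i
    show "lam i = mu i"
    proof (cases "i \<in> {1..n}")
      case True
      then obtain j where j: "j \<in> {1..n}" "r lam i = r mu j" using zero by blast
      have "i - 1 = j - 1"
        using rank[OF lam True] rank[OF mu j(1)] unfolding zero j(2) by simp
      then have "i = j" using True j(1) by auto
      then show ?thesis using j(2) by (simp add: r_def)
    qed (use lam mu in \<open>auto simp: partitions_def\<close>)
  qed
qed

text \<open>Here the whole family \<open>Zop\<close> matters: \<open>yval\<close> can coincide for
  partitions that are incomparable in dominance order.\<close>

lemma Pj_orthogonal:
  assumes "lam \<in> parts CARD('n) k" "mu \<in> parts CARD('n) k" "lam \<noteq> mu"
  shows "form k (Pj lam) (Pj mu :: 'n::finite pol) = 0"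
proof -
  have lam: "lam \<in> partitions CARD('n)" "psize CARD('n) lam = k" and mu: "mu \<in> partitions CARD('n)" "psize CARD('n) mu = k"
    using assms by (auto simp: parts_def)
  obtain u :: real where u: "zval CARD('n) lam (of_real u) \<noteq> zval CARD('n) mu (of_real u)"
    using zval_separates[OF lam(1) mu(1)] assms(3) by blast
  have "form k (Zop (of_real u) (Pj lam)) (Pj mu :: 'n pol) = form k (Pj lam :: 'n pol) (Zop (of_real u) (Pj mu))"
    by (rule form_Zop) (use homi_Pj[OF lam(1)] homi_Pj[OF mu(1)] lam(2) mu(2) in auto)
  moreover have "cnj (zval CARD('n) mu (of_real u)) = zval CARD('n) mu (of_real u)" by (simp add: zval_def)
  ultimately show ?thesis using u by (simp add: Zop_Pj lam mu)
qed

text \<open>\<open>Pj mu\<close> is not known to be nonzero here, hence the conclusion compares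
  terms rather than coefficients.\<close>

lemma Pj_independent:
  fixes a b :: "(nat \<Rightarrow> nat) \<Rightarrow> complex"
  assumes "(\<Sum>lam\<in>parts CARD('n) k. CC (a lam) * (Pj lam :: 'n::finite pol)) = (\<Sum>lam\<in>parts CARD('n) k. CC (b lam) * Pj lam)"
    and mu: "mu \<in> parts CARD('n) k"
  shows "CC (a mu) * (Pj mu :: 'n pol) = CC (b mu) * Pj mu"
proof -
  have f: "form k (\<Sum>lam\<in>parts CARD('n) k. CC (c lam) * (Pj lam :: 'n pol)) (Pj mu) = c mu * form k (Pj mu :: 'n pol) (Pj mu)" for c
  proof -
    have "form k (\<Sum>lam\<in>parts CARD('n) k. CC (c lam) * (Pj lam :: 'n pol)) (Pj mu)
      = (\<Sum>lam\<in>parts CARD('n) k. c lam * form k (Pj lam :: 'n pol) (Pj mu))" by simp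
    also have "\<dots> = (\<Sum>lam\<in>parts CARD('n) k. if lam = mu then c mu * form k (Pj mu :: 'n pol) (Pj mu) else 0)"
      by (intro sum.cong refl) (use Pj_orthogonal mu in auto)
    finally show ?thesis using mu by simp
  qed
  have hom: "homi k (Pj mu :: 'n pol)" using homi_Pj[of mu] mu by (auto simp: parts_def)
  have "a mu * form k (Pj mu :: 'n pol) (Pj mu) = b mu * form k (Pj mu :: 'n pol) (Pj mu)"
    using f[of a] f[of b] assms(1) by simp
  then consider "a mu = b mu" | "form k (Pj mu :: 'n pol) (Pj mu) = 0" by auto
  then show ?thesis
  proof cases
    case 2
    then have "Pj mu = (0 :: 'n pol)" using qf_eq_0D[OF hom] by (simp add: qf_def)
    then show ?thesis by simp
  qed simp
qed

text \<open>Inversion of a unitriangular system; the sum of squares decreases strictly in dominance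
  order and serves as induction measure.\<close>

lemma M_lincomb_Pj:
  assumes "lam \<in> partitions CARD('n)"
  shows "lincomb Pj {mu \<in> partitions CARD('n). dominance_le CARD('n) mu lam} (M lam :: 'n::finite pol)"
  using assms
proof (induction "\<Sum>i=1..CARD('n). (lam i)\<^sup>2" arbitrary: lam rule: less_induct)
  case less
  have "lincomb M (Low CARD('n) lam) (Pj lam - M lam :: 'n pol)"
    by (rule sym_lincomb[OF _ mspan_Pj_diff[OF less.prems] lset_orbit[OF _ less.prems] finite_Low])
      (auto intro!: sym_diff sym_Pj sym_M less.prems)
  then have "lincomb Pj {mu \<in> partitions CARD('n). dominance_le CARD('n) mu lam} (Pj lam - M lam :: 'n pol)"
  proof (rule lincomb_subst)
    fix mu assume mu: "mu \<in> Low CARD('n) lam"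
    then have "(\<Sum>i=1..CARD('n). (real (mu i))\<^sup>2) < (\<Sum>i=1..CARD('n). (real (lam i))\<^sup>2)"
      using less.prems by (intro dominance_squares_less) (auto simp: Low_def)
    then have "(\<Sum>i=1..CARD('n). (mu i)\<^sup>2) < (\<Sum>i=1..CARD('n). (lam i)\<^sup>2)"
      by (simp flip: of_nat_power of_nat_sum)
    from less.hyps[OF this] mu
    have "lincomb Pj {nu \<in> partitions CARD('n). dominance_le CARD('n) nu mu} (M mu :: 'n pol)" by (auto simp: Low_def)
    then show "lincomb Pj {mu \<in> partitions CARD('n). dominance_le CARD('n) mu lam} (M mu :: 'n pol)"
      by (rule lincomb_mono) (use mu in \<open>auto simp: Low_def intro: dominance_trans\<close>)
  qed
  moreover have "lincomb Pj {mu \<in> partitions CARD('n). dominance_le CARD('n) mu lam} (Pj lam :: 'n pol)"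
    using less.prems by (intro lincomb_single) auto
  ultimately show ?case using lincomb_diff by fastforce
qed

lemma sym_lincomb_Pj:
  assumes "sym f" "homi k f"
  shows "lincomb Pj (parts CARD('n) k) (f :: 'n::finite pol)"
proof -
  have "lincomb M (parts CARD('n) k) f"
  proof (rule sym_lincomb[OF assms(1) homi_mspan[OF assms(2)]])
    fix e :: "'n \<Rightarrow> nat" assume e: "e \<in> {e. sum e UNIV = k}"
    obtain mu h where mu: "mu \<in> partitions CARD('n)" "enum h" "e = mu \<circ> h" using exists_sorted[of e] by blast
    then have "psize CARD('n) mu = k" using e sum_enum[OF mu(2), of mu] by (simp add: psize_def)
    then show "\<exists>mu\<in>parts CARD('n) k. \<exists>h. enum h \<and> e = mu \<circ> h" using mu by (auto simp: parts_def)
  qed simp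
  then show ?thesis
  proof (rule lincomb_subst)
    fix mu assume mu: "mu \<in> parts CARD('n) k"
    then have "lincomb Pj {nu \<in> partitions CARD('n). dominance_le CARD('n) nu mu} (M mu :: 'n pol)"
      by (intro M_lincomb_Pj) (auto simp: parts_def)
    then show "lincomb Pj (parts CARD('n) k) (M mu :: 'n pol)"
      by (rule lincomb_mono[OF _ _ finite_parts]) (use mu in \<open>auto simp: parts_def dominance_le_def\<close>)
  qed
qed

lemma yval_less:
  assumes "dominance_le n mu lam" "mu \<noteq> lam" "mu \<in> partitions n" "lam \<in> partitions n"
  shows "yval n mu < yval n lam"
proof -
  have "(\<Sum>i=1..n. real (n - i) * real (mu i)) \<le> (\<Sum>i=1..n. real (n - i) * real (lam i))"
    using assms(1) by (rule dominance_weighted_sum) auto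
  then have "2 * \<gamma> * (\<Sum>i=1..n. real (n - i) * real (mu i)) \<le> 2 * \<gamma> * (\<Sum>i=1..n. real (n - i) * real (lam i))"
    using gamma_pos by simp
  moreover have "yval n nu = (\<Sum>i=1..n. (real (nu i))\<^sup>2) + 2 * \<gamma> * (\<Sum>i=1..n. real (n - i) * real (nu i)) - \<gamma> * (real n - 1) * real (psize n nu)" for nu
    unfolding yval_def sum.distrib sum_distrib_left by (simp add: mult_ac)
  moreover have "psize n mu = psize n lam" using assms(1) by (simp add: dominance_le_def)
  ultimately show ?thesis using dominance_squares_less[OF assms] by simp
qed

text \<open>Below \<open>lam\<close> the eigenvalue \<open>yval\<close> is strictly smaller, so an
  eigenvector with the eigenvalue of \<open>lam\<close> has no components there.\<close>

lemma Y2_eigen_unique: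
  assumes lam: "lam \<in> partitions CARD('n)"
    and f: "lincomb Pj {mu \<in> partitions CARD('n). dominance_le CARD('n) mu lam} (f :: 'n::finite pol)"
    and eig: "Y2 f = CC (of_real (yval CARD('n) lam)) * f"
  shows "\<exists>t. f = CC t * Pj lam"
proof -
  define L where "L = {mu \<in> partitions CARD('n). dominance_le CARD('n) mu lam}"
  define k where "k = psize CARD('n) lam"
  have Lk: "L \<subseteq> parts CARD('n) k" by (auto simp: L_def k_def parts_def dominance_le_def)
  obtain c where c: "f = (\<Sum>mu\<in>L. CC (c mu) * Pj mu)" using f unfolding lincomb_def L_def by blast
  define a where "a = (\<lambda>mu. if mu \<in> L then c mu else 0)"
  have fa: "f = (\<Sum>mu\<in>parts CARD('n) k. CC (a mu) * Pj mu)"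
    unfolding c a_def by (rule sum.mono_neutral_cong_left) (use Lk in \<open>auto simp: CC_simps\<close>)
  have "Y2 f = (\<Sum>mu\<in>parts CARD('n) k. CC (a mu * of_real (yval CARD('n) mu)) * Pj mu)"
    unfolding fa Y2_sum Y2_CC_mult by (intro sum.cong refl) (auto simp: Y2_Pj parts_def CC_simps mult.assoc)
  moreover have "Y2 f = (\<Sum>mu\<in>parts CARD('n) k. CC (a mu * of_real (yval CARD('n) lam)) * Pj mu)"
    unfolding eig unfolding fa sum_distrib_left by (intro sum.cong refl) (simp add: CC_simps mult_ac)
  ultimately have eq: "(\<Sum>mu\<in>parts CARD('n) k. CC (a mu * of_real (yval CARD('n) mu)) * Pj mu :: 'n pol)
    = (\<Sum>mu\<in>parts CARD('n) k. CC (a mu * of_real (yval CARD('n) lam)) * Pj mu)" by simp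
  have zero: "CC (c mu) * (Pj mu :: 'n pol) = 0" if "mu \<in> L - {lam}" for mu
  proof -
    have "yval CARD('n) mu < yval CARD('n) lam"
      using that lam by (intro yval_less) (auto simp: L_def)
    then have ne: "of_real (yval CARD('n) mu) - of_real (yval CARD('n) lam) \<noteq> (0::complex)" by simp
    have "CC (c mu * of_real (yval CARD('n) mu)) * (Pj mu :: 'n pol) = CC (c mu * of_real (yval CARD('n) lam)) * Pj mu"
      using Pj_independent[OF eq, of mu] that Lk by (auto simp: a_def)
    then have "CC (of_real (yval CARD('n) mu) - of_real (yval CARD('n) lam)) * (CC (c mu) * (Pj mu :: 'n pol)) = 0"
      by (simp add: CC_simps algebra_simps)
    then have "CC (1 / (of_real (yval CARD('n) mu) - of_real (yval CARD('n) lam))) * (CC (of_real (yval CARD('n) mu) - of_real (yval CARD('n) lam)) * (CC (c mu) * (Pj mu :: 'n pol))) = 0"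
      by simp
    then show ?thesis using ne unfolding mult.assoc[symmetric] CC_simps(2)[symmetric] by (simp add: CC_simps)
  qed
  have "f = CC (c lam) * Pj lam + (\<Sum>mu\<in>L - {lam}. CC (c mu) * Pj mu)"
    unfolding c using lam by (intro sum.remove) (auto simp: L_def)
  also have "(\<Sum>mu\<in>L - {lam}. CC (c mu) * Pj mu :: 'n pol) = 0" using zero by (intro sum.neutral) auto
  finally show ?thesis by auto
qed

end

section \<open>Agreement with the defining conditions of the Jack polynomials\<close>

definition orb :: "(nat \<Rightarrow> nat) \<Rightarrow> ('n::finite \<Rightarrow> nat) set" where
  "orb lam = {e. \<exists>g. enum g \<and> e = lam \<circ> g}"

lemma finite_orb: "finite (orb lam :: ('n::finite \<Rightarrow> nat) set)"
proof -
  have "finite {g::'n \<Rightarrow> nat. \<forall>x. (x \<in> UNIV \<longrightarrow> g x \<in> {1..CARD('n)}) \<and> (x \<notin> UNIV \<longrightarrow> g x = 0)}"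
    by (rule finite_set_of_finite_funs) auto
  then have "finite {g::'n \<Rightarrow> nat. enum g}"
    by (rule finite_subset[rotated]) (auto simp: bij_betw_def)
  moreover have "orb lam = (\<lambda>g. lam \<circ> g) ` {g::'n \<Rightarrow> nat. enum g}" by (auto simp: orb_def)
  ultimately show ?thesis by simp
qed

definition msym :: "(nat \<Rightarrow> nat) \<Rightarrow> 'n::finite pol" where "msym lam = (\<Sum>e\<in>orb lam. mon e)"

lemma ev_msym: "ev (msym lam) = monomial_sym lam"
  by (rule ext) (simp add: msym_def monomial_sym_def orb_def mon_def)

text \<open>After multiplication by the product of all X_i - X_j the two sides agree everywhere;
  then the factors are cancelled one by one.\<close>

lemma pol_eqI_generic:
  fixes f g :: "'n::finite pol"
  assumes "\<And>x. (\<forall>i j. i \<noteq> j \<longrightarrow> x $ i \<noteq> x $ j) \<Longrightarrow> ev f x = ev g x"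
  shows "f = g"
proof -
  define V where "V = (\<lambda>S. \<Prod>(i,j)\<in>S. X i - X j :: 'n pol)"
  have cancel: "V S * f = V S * g \<Longrightarrow> f = g" if "finite S" "\<And>i j. (i, j) \<in> S \<Longrightarrow> i \<noteq> j" for S
    using that
  proof (induction S)
    case (insert p S)
    obtain i j where p: "p = (i, j)" by force
    have "(X i - X j) * (V S * f) = (X i - X j) * (V S * g)"
      using insert by (simp add: V_def p mult.assoc)
    then have "V S * f = V S * g" by (rule X_diff_cancel[rotated]) (use insert p in auto)
    then show ?case using insert by blast
  qed (simp add: V_def)
  define S where "S = {(i::'n, j). i \<noteq> j}"
  have "V S * f = V S * g"
  proof (rule pol_eqI)
    fix x :: "complex ^ 'n"
    show "ev (V S * f) x = ev (V S * g) x"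
    proof (cases "\<forall>i j. i \<noteq> j \<longrightarrow> x $ i \<noteq> x $ j")
      case False
      then obtain i j where "(i, j) \<in> S" "x $ i = x $ j" by (auto simp: S_def)
      then have "ev (V S) x = 0" unfolding V_def ev_prod by (intro prod_zero bexI[of _ "(i, j)"]) auto
      then show ?thesis by simp
    qed (simp add: assms)
  qed
  then show ?thesis by (rule cancel[rotated 2]) (auto simp: S_def)
qed

lemma ev_scale: "homi k f \<Longrightarrow> ev f (r *\<^sub>R x) = of_real r ^ k * ev f x"
proof (induction rule: homi.induct)
  case (homi_X k f i)
  then show ?case by (simp add: scaleR_conv_of_real[where 'a = complex])
qed (auto simp: algebra_simps)

definition p1p :: "'n::finite pol" where "p1p = (\<Sum>i\<in>UNIV. X i)"

lemma ev_p1p: "ev p1p x = p1 x" by (simp add: p1p_def p1_def)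

lemma homi_p1p_power: "homi k (p1p ^ k)"
proof (induction k)
  case 0
  show ?case using homi_const[of 1] by (simp add: CC_simps)
next
  case (Suc k)
  have "p1p ^ Suc k = (\<Sum>i\<in>UNIV. X i * p1p ^ k :: 'a pol)"
    by (simp add: p1p_def sum_distrib_right)
  then show ?case using Suc by (auto intro: homi_sum homi_X)
qed

lemma homi_p1p_mult: "homi k f \<Longrightarrow> homi (Suc k) (p1p * f)"
  unfolding p1p_def sum_distrib_right by (intro homi_sum homi_X)

lemma dd_p1p_power: "dd i (p1p ^ k) = CC (of_nat k) * p1p ^ (k - 1)"
proof (induction k)
  case 0
  show ?case using dd_CC[of i 1] by (simp add: CC_simps)
next
  case (Suc k)
  have "dd i p1p = 1" by (simp add: p1p_def)
  then have "dd i (p1p ^ Suc k) = p1p ^ k + p1p * (CC (of_nat k) * p1p ^ (k - 1))"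
    by (simp add: dd_mult Suc)
  also have "p1p * (CC (of_nat k) * p1p ^ (k - 1)) = CC (of_nat k) * (p1p ^ k :: 'a pol)"
    by (cases k) (simp_all add: CC_simps mult_ac)
  finally show ?case by (simp add: CC_simps algebra_simps)
qed

context jack
begin

lemma sym_p1p: "sym p1p"
  unfolding sym_def p1p_def
proof (intro allI impI)
  fix p :: "'a \<Rightarrow> 'a" assume "bij p"
  then show "act p (\<Sum>i\<in>UNIV. X i) = (\<Sum>i\<in>UNIV. X i)"
    using sum.reindex_bij_betw[of p UNIV UNIV X] by (simp add: bij_def bij_betw_def)
qed

lemma sym_p1p_power: "sym (p1p ^ k)"
  by (simp add: sym_def symD[OF sym_p1p])

lemma sym_msym: "sym (msym lam)"
  unfolding sym_def
proof (intro allI impI)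
  fix p :: "'a \<Rightarrow> 'a" assume p: "bij p"
  have orb: "e \<circ> q \<in> orb lam" if "e \<in> orb lam" "bij q" for e :: "'a \<Rightarrow> nat" and q :: "'a \<Rightarrow> 'a"
  proof -
    from that(1) obtain g where g: "enum g" "e = lam \<circ> g" unfolding orb_def by blast
    have "enum (g \<circ> q)" using bij_betw_trans[OF _ g(1), of q UNIV] that(2) by blast
    then show ?thesis unfolding orb_def g(2) by (auto simp: o_assoc)
  qed
  have inv: "inv p \<circ> p = id" "p \<circ> inv p = id" using p
    by (simp_all add: bij_is_inj flip: surj_iff) (simp add: bij_is_surj)
  have "(\<Sum>e\<in>orb lam. mon (e \<circ> inv p)) = (\<Sum>e\<in>orb lam. mon e)"
    by (rule sum.reindex_bij_witness[of _ "\<lambda>e. e \<circ> p" "\<lambda>e. e \<circ> inv p"])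
      (auto simp: comp_assoc inv intro!: orb p bij_imp_bij_inv)
  then show "act p (msym lam) = msym lam" using p by (simp add: msym_def act_mono)
qed

lemma M_msym: "\<exists>t. t \<noteq> 0 \<and> M lam = CC t * (msym lam :: 'n::finite pol)"
proof -
  define N where "N = complex_of_nat (card (perms :: ('n \<Rightarrow> 'n) set))"
  define m where "m = complex_of_nat (card (orb lam :: ('n \<Rightarrow> nat) set))"
  have N: "N \<noteq> 0" using card_perms_pos[where 'n='n] unfolding N_def by (metis of_nat_eq_0_iff less_numeral_extra(3))
  have "e0 lam \<in> (orb lam :: ('n \<Rightarrow> nat) set)" using e0_enum by (auto simp: orb_def)
  then have m: "m \<noteq> 0" using finite_orb[of lam, where 'n='n] unfolding m_def by (metis card_0_eq empty_iff of_nat_eq_0_iff)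
  have "Sy (msym lam) = (\<Sum>e\<in>(orb lam :: ('n \<Rightarrow> nat) set). M lam :: 'n pol)"
    unfolding msym_def Sy_linear by (intro sum.cong refl) (auto simp: orb_def Sy_mon)
  then have "CC N * msym lam = CC m * (M lam :: 'n pol)"
    using Sy_sym[OF sym_msym[of lam], where 'n='n] by (simp add: N_def m_def of_nat_pol)
  then have "CC (1 / m) * (CC N * msym lam) = CC (1 / m) * (CC m * (M lam :: 'n pol))" by simp
  then have "M lam = CC (N / m) * (msym lam :: 'n pol)"
    using m unfolding mult.assoc[symmetric] CC_simps(2)[symmetric] by (simp add: CC_simps(4))
  moreover have "N / m \<noteq> 0" using N m by simp
  ultimately show ?thesis by blast
qed

lemma msym_M: "\<exists>t. msym lam = CC t * (M lam :: 'n::finite pol)"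
proof -
  obtain t where t: "t \<noteq> 0" "M lam = CC t * (msym lam :: 'n pol)" using M_msym by blast
  have "CC (1 / t) * (M lam :: 'n pol) = msym lam"
    unfolding t(2) mult.assoc[symmetric] CC_simps(2)[symmetric] using t(1) by (simp add: CC_simps(4))
  then show ?thesis by metis
qed

lemma p1p_power_expansion: "\<exists>c. p1p ^ k = (\<Sum>lam\<in>parts CARD('n) k. CC (c lam) * (Pj lam :: 'n::finite pol))"
  using sym_lincomb_Pj[OF sym_p1p_power homi_p1p_power] unfolding lincomb_def .

text \<open>Any choice serves: by \<open>Pj_independent\<close> the terms of the expansion do not
  depend on it.\<close>

definition jcoeff :: "'n::finite itself \<Rightarrow> nat \<Rightarrow> (nat \<Rightarrow> nat) \<Rightarrow> complex" where
  "jcoeff t k = (SOME c. p1p ^ k = (\<Sum>lam\<in>parts CARD('n) k. CC (c lam) * (Pj lam :: 'n pol)))"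

definition Jl :: "(nat \<Rightarrow> nat) \<Rightarrow> 'n::finite pol" where
  "Jl lam = CC (jcoeff TYPE('n) (psize CARD('n) lam) lam) * Pj lam"

lemma Jl_parts: "lam \<in> parts CARD('n) k \<Longrightarrow> Jl lam = CC (jcoeff TYPE('n::finite) k lam) * (Pj lam :: 'n pol)"
  by (simp add: Jl_def parts_def)

lemma sum_Jl: "(\<Sum>lam\<in>parts CARD('n) k. Jl lam :: 'n::finite pol) = p1p ^ k"
proof -
  have "p1p ^ k = (\<Sum>lam\<in>parts CARD('n) k. CC (jcoeff TYPE('n) k lam) * (Pj lam :: 'n pol))"
    unfolding jcoeff_def by (rule someI_ex[OF p1p_power_expansion])
  then show ?thesis by (simp add: Jl_parts)
qed

lemma sym_Jl: "lam \<in> parts CARD('n) k \<Longrightarrow> sym (Jl lam :: 'n::finite pol)"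
  and homi_Jl: "lam \<in> parts CARD('n) k \<Longrightarrow> homi k (Jl lam :: 'n pol)"
  and Zop_Jl: "lam \<in> parts CARD('n) k \<Longrightarrow> Zop (of_real u) (Jl lam) = CC (zval CARD('n) lam (of_real u)) * (Jl lam :: 'n pol)"
  and Y2_Jl: "lam \<in> parts CARD('n) k \<Longrightarrow> Y2 (Jl lam) = CC (of_real (yval CARD('n) lam)) * (Jl lam :: 'n pol)"
  using sym_Pj[of lam, where 'n='n] homi_Pj[of lam, where 'n='n] Zop_Pj[of lam u, where 'n='n] Y2_Pj[of lam, where 'n='n]
  by (auto simp: Jl_def parts_def mult.left_commute intro: sym_scale homi_scale)

lemma jack_eigenvalue_eq:
  "jack_eigenvalue n (1 / \<gamma>) lam = yval n lam + (\<gamma> * (real n - 1) - 1) * real (psize n lam)"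
proof -
  have "rho n (1 / \<gamma>) lam + 2 * \<gamma> * real (psize n lam) * (real n - 1) =
    (\<Sum>i=1..n. real (lam i) * (real (lam i) - 1 - 2 * \<gamma> * (real i - 1)) + 2 * \<gamma> * real (lam i) * (real n - 1))"
    unfolding rho_def psize_def by (simp add: sum.distrib sum_distrib_left sum_distrib_right)
  also have "\<dots> = (\<Sum>i=1..n. ((real (lam i))\<^sup>2 + 2 * \<gamma> * real (lam i) * real (n - i)) - real (lam i))"
    by (intro sum.cong refl) (simp add: of_nat_diff power2_eq_square algebra_simps)
  also have "\<dots> = yval n lam + (\<gamma> * (real n - 1) - 1) * real (psize n lam)"
    unfolding yval_def psize_def sum_subtractf by (simp add: algebra_simps)
  finally show ?thesis by (simp add: jack_eigenvalue_def)
qed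

text \<open>The definition imposes the equation only where the coordinates are distinct;
  \<open>pol_eqI_generic\<close> makes it an identity of polynomials.\<close>

lemma jack_op_Jl_iff:
  fixes f :: "'n::finite pol"
  assumes "sym f" "homi (psize CARD('n) lam) f"
  shows "(\<forall>x. (\<forall>i j. i \<noteq> j \<longrightarrow> x $ i \<noteq> x $ j) \<longrightarrow> jack_op (1 / \<gamma>) (ev f) x = of_real (jack_eigenvalue CARD('n) (1 / \<gamma>) lam) * ev f x)
    \<longleftrightarrow> Y2 f = CC (of_real (yval CARD('n) lam)) * f"
proof -
  have "jack_op (1 / \<gamma>) (ev f) x = of_real (jack_eigenvalue CARD('n) (1 / \<gamma>) lam) * ev f x \<longleftrightarrow>
     ev (Y2 f) x = ev (CC (of_real (yval CARD('n) lam)) * f) x" if "\<forall>i j. i \<noteq> j \<longrightarrow> x $ i \<noteq> x $ j" for x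
    using jack_op_ev[OF assms, of x] that by (simp add: jack_eigenvalue_eq algebra_simps)
  then show ?thesis using pol_eqI_generic by metis
qed

lemma psize_below: "mu \<in> {mu \<in> partitions CARD('n). dominance_le CARD('n) mu lam} \<Longrightarrow> homi (psize CARD('n) lam) (M mu :: 'n::finite pol)"
  using homi_M[of mu, where 'n='n] by (auto simp: dominance_le_def)

lemma is_jack_family_Jl: "is_jack_family (1 / \<gamma>) (\<lambda>lam. ev (Jl lam :: 'n::finite pol))"
  unfolding is_jack_family_def
proof (intro conjI ballI allI)
  fix lam assume lam: "lam \<in> partitions CARD('n)"
  let ?D = "{mu \<in> partitions CARD('n). dominance_le CARD('n) mu lam}"
  have "lincomb M (Low CARD('n) lam) (Pj lam - M lam :: 'n pol)"
    by (rule sym_lincomb[OF _ mspan_Pj_diff[OF lam] lset_orbit[OF _ lam] finite_Low])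
      (auto intro!: sym_diff sym_Pj sym_M lam)
  then have "lincomb M ?D (Pj lam - M lam :: 'n pol)"
    by (rule lincomb_mono) (auto simp: Low_def)
  moreover have "lincomb M ?D (M lam :: 'n pol)" using lam by (intro lincomb_single) auto
  ultimately have "lincomb M ?D (Pj lam :: 'n pol)" using lincomb_add by fastforce
  then have "lincomb M ?D (Jl lam :: 'n pol)" unfolding Jl_def by (rule lincomb_scale)
  then have "lincomb msym ?D (Jl lam :: 'n pol)"
  proof (rule lincomb_subst)
    fix mu assume "mu \<in> ?D"
    moreover obtain t where "M mu = CC t * (msym mu :: 'n pol)" using M_msym by blast
    ultimately show "lincomb msym ?D (M mu :: 'n pol)" by (auto intro!: lincomb_scale lincomb_single)
  qed
  then obtain u where u: "Jl lam = (\<Sum>mu\<in>?D. CC (u mu) * (msym mu :: 'n pol))" unfolding lincomb_def by blast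
  show "\<exists>u. \<forall>x. ev (Jl lam :: 'n pol) x = (\<Sum>mu\<in>?D. u mu * monomial_sym mu x)"
    by (rule exI[of _ u]) (simp add: u ev_msym)
next
  fix lam :: "nat \<Rightarrow> nat" and x :: "complex ^ 'n" assume lam: "lam \<in> partitions CARD('n)"
  then have p: "lam \<in> parts CARD('n) (psize CARD('n) lam)" by (simp add: parts_def)
  show "(\<forall>i j. i \<noteq> j \<longrightarrow> x $ i \<noteq> x $ j) \<longrightarrow> jack_op (1 / \<gamma>) (ev (Jl lam)) x = of_real (jack_eigenvalue CARD('n) (1 / \<gamma>) lam) * ev (Jl lam) x"
    using jack_op_Jl_iff[OF sym_Jl[OF p] homi_Jl[OF p]] Y2_Jl[OF p] by blast
next
  fix k and x :: "complex ^ 'n"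
  show "(\<Sum>lam\<in>{lam \<in> partitions CARD('n). psize CARD('n) lam = k}. ev (Jl lam) x) = p1 x ^ k"
    using arg_cong[OF sum_Jl[of k], of "\<lambda>f. ev f x"] by (simp add: ev_p1p parts_def)
qed

text \<open>Each member is a multiple of \<open>Pj lam\<close> by \<open>Y2_eigen_unique\<close>;
  the expansion of p_1^k then fixes the multiples, by independence of the \<open>Pj\<close>.\<close>

lemma jack_family_unique:
  fixes C :: "(nat \<Rightarrow> nat) \<Rightarrow> complex ^ 'n::finite \<Rightarrow> complex"
  assumes fam: "is_jack_family (1 / \<gamma>) C" and lam0: "lam0 \<in> partitions CARD('n)"
  shows "C lam0 = ev (Jl lam0)"
proof -
  let ?D = "\<lambda>lam. {mu \<in> partitions CARD('n). dominance_le CARD('n) mu lam}"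
  have "\<exists>t. C lam = ev (CC t * Pj lam)" if lam: "lam \<in> partitions CARD('n)" for lam
  proof -
    obtain u where u: "\<And>x. C lam x = (\<Sum>mu\<in>?D lam. u mu * monomial_sym mu x)"
      using fam lam unfolding is_jack_family_def by blast
    define f where "f = (\<Sum>mu\<in>?D lam. CC (u mu) * (msym mu :: 'n pol))"
    have Cf: "C lam = ev f" by (rule ext) (simp add: u f_def ev_msym)
    have "lincomb msym (?D lam) f" unfolding lincomb_def f_def by blast
    then have M: "lincomb M (?D lam) f"
    proof (rule lincomb_subst)
      fix mu assume "mu \<in> ?D lam"
      moreover obtain t where "msym mu = CC t * (M mu :: 'n pol)" using msym_M by blast
      ultimately show "lincomb M (?D lam) (msym mu :: 'n pol)" by (auto intro!: lincomb_scale lincomb_single)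
    qed
    then have P: "lincomb Pj (?D lam) f"
    proof (rule lincomb_subst)
      fix mu assume mu: "mu \<in> ?D lam"
      then have "lincomb Pj (?D mu) (M mu :: 'n pol)" by (intro M_lincomb_Pj) auto
      then show "lincomb Pj (?D lam) (M mu :: 'n pol)"
        by (rule lincomb_mono[OF _ _ finite_below]) (use mu in \<open>auto intro: dominance_trans\<close>)
    qed
    obtain c where c: "f = (\<Sum>mu\<in>?D lam. CC (c mu) * M mu)" using M unfolding lincomb_def by blast
    have "sym f" unfolding c by (intro sym_sum sym_scale sym_M)
    moreover have "homi (psize CARD('n) lam) f" unfolding c by (intro homi_sum homi_scale psize_below)
    ultimately have "Y2 f = CC (of_real (yval CARD('n) lam)) * f"
      using jack_op_Jl_iff[of f lam] fam lam unfolding is_jack_family_def Cf[symmetric] by blast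
    from Y2_eigen_unique[OF lam P this] show ?thesis unfolding Cf by auto
  qed
  then obtain t where t: "\<And>lam. lam \<in> partitions CARD('n) \<Longrightarrow> C lam = ev (CC (t lam) * Pj lam)" by metis
  define k where "k = psize CARD('n) lam0"
  have lam0': "lam0 \<in> parts CARD('n) k" using lam0 by (simp add: parts_def k_def)
  have "(\<Sum>lam\<in>parts CARD('n) k. CC (t lam) * Pj lam) = (\<Sum>lam\<in>parts CARD('n) k. CC (jcoeff TYPE('n) k lam) * (Pj lam :: 'n pol))"
  proof (rule pol_eqI)
    fix x :: "complex ^ 'n"
    have "(\<Sum>lam\<in>parts CARD('n) k. C lam x) = p1 x ^ k"
      using fam unfolding is_jack_family_def parts_def by blast
    moreover have "(\<Sum>lam\<in>parts CARD('n) k. C lam x) = ev (\<Sum>lam\<in>parts CARD('n) k. CC (t lam) * Pj lam) x"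
      unfolding ev_sum by (intro sum.cong refl) (simp add: t parts_def)
    moreover have "(\<Sum>lam\<in>parts CARD('n) k. CC (jcoeff TYPE('n) k lam) * (Pj lam :: 'n pol)) = p1p ^ k"
      using sum_Jl[of k, where 'n='n] by (simp add: Jl_parts)
    ultimately show "ev (\<Sum>lam\<in>parts CARD('n) k. CC (t lam) * Pj lam) x = ev (\<Sum>lam\<in>parts CARD('n) k. CC (jcoeff TYPE('n) k lam) * (Pj lam :: 'n pol)) x"
      by (simp add: ev_p1p)
  qed
  from Pj_independent[OF this lam0'] have "CC (t lam0) * Pj lam0 = (Jl lam0 :: 'n pol)"
    by (simp add: Jl_parts[OF lam0'])
  then show ?thesis using t[OF lam0] by simp
qed

lemma jack_C_eq:
  assumes "lam \<in> partitions CARD('n)"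
  shows "jack_C (1 / \<gamma>) lam = ev (Jl lam :: 'n::finite pol)"
  unfolding jack_C_def
proof (rule the_equality)
  show "\<exists>C. is_jack_family (1 / \<gamma>) C \<and> ev (Jl lam :: 'n pol) = C lam"
    using is_jack_family_Jl[where 'n='n] by (intro exI[of _ "\<lambda>lam. ev (Jl lam)"]) auto
  show "f = ev (Jl lam)" if "\<exists>C. is_jack_family (1 / \<gamma>) C \<and> f = C lam" for f :: "complex ^ 'n \<Rightarrow> complex"
    using that jack_family_unique assms by auto
qed

section \<open>Growth of the Jack polynomials\<close>

lemma T_p1p_power: "T i (p1p ^ k) = CC (of_nat k) * p1p ^ (k - 1)"
  by (simp add: T_sym[OF sym_p1p_power] dd_p1p_power)

text \<open>On the symmetric p_1^k every T_i acts as the plain derivative.\<close>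

lemma form_p1p_power: "form k (p1p ^ k) (p1p ^ k :: 'n::finite pol) = of_nat CARD('n) ^ k * fact k"
proof (induction k)
  case (Suc k)
  have "p1p ^ Suc k = (\<Sum>i\<in>UNIV. X i * p1p ^ k :: 'n pol)" by (simp add: p1p_def sum_distrib_right)
  then have "form (Suc k) (p1p ^ Suc k) (p1p ^ Suc k :: 'n pol) = (\<Sum>i\<in>UNIV. form (Suc k) (X i * p1p ^ k) (p1p ^ Suc k :: 'n pol))"
    by (metis form_linear(3))
  also have "\<dots> = of_nat CARD('n) * (of_nat (Suc k) * form k (p1p ^ k) (p1p ^ k :: 'n pol))"
    unfolding form_X T_p1p_power form_CC_right by simp
  finally show ?case by (simp add: Suc algebra_simps)
qed simp

lemma qf_Jl_le:
  assumes "lam \<in> parts CARD('n) k"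
  shows "qf k (Jl lam :: 'n::finite pol) \<le> real CARD('n) ^ k * fact k"
proof -
  have orth: "form k (Jl mu) (Jl nu :: 'n pol) = (if nu = mu then form k (Jl mu) (Jl mu :: 'n pol) else 0)"
    if "mu \<in> parts CARD('n) k" "nu \<in> parts CARD('n) k" for mu nu
  proof (cases "nu = mu")
    case False
    then have "form k (Pj mu) (Pj nu :: 'n pol) = 0" using Pj_orthogonal[OF that] by blast
    then show ?thesis using False unfolding Jl_parts[OF that(1)] Jl_parts[OF that(2)] by simp
  qed simp
  have "form k (p1p ^ k) (p1p ^ k :: 'n pol) = (\<Sum>mu\<in>parts CARD('n) k. \<Sum>nu\<in>parts CARD('n) k. form k (Jl mu) (Jl nu :: 'n pol))"
    unfolding sum_Jl[symmetric] form_linear(3) form_linear(6) by (rule sum.swap)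
  also have "\<dots> = (\<Sum>mu\<in>parts CARD('n) k. \<Sum>nu\<in>parts CARD('n) k. if nu = mu then form k (Jl mu) (Jl mu :: 'n pol) else 0)"
    by (intro sum.cong refl orth)
  also have "\<dots> = (\<Sum>mu\<in>parts CARD('n) k. form k (Jl mu) (Jl mu :: 'n pol))" by simp
  finally have "complex_of_real (real CARD('n) ^ k * fact k) = (\<Sum>mu\<in>parts CARD('n) k. form k (Jl mu) (Jl mu :: 'n pol))"
    by (simp add: form_p1p_power)
  from arg_cong[OF this, of Re] have "real CARD('n) ^ k * fact k = (\<Sum>mu\<in>parts CARD('n) k. qf k (Jl mu :: 'n pol))"
    by (simp add: qf_def del: Re_complex_of_real)
  moreover have "qf k (Jl lam :: 'n pol) \<le> (\<Sum>mu\<in>parts CARD('n) k. qf k (Jl mu :: 'n pol))"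
    using assms by (intro member_le_sum) (auto intro: qf_nonneg homi_Jl)
  ultimately show ?thesis by simp
qed

text \<open>The k! in the squared norm of p_1^k cancels against \<open>ev_le_qf\<close>, which is
  why the growth is only geometric in the degree.\<close>

lemma Jl_bound:
  fixes x :: "complex ^ 'n::finite"
  assumes lam: "lam \<in> parts CARD('n) k" and x: "\<And>i. norm (x $ i) \<le> R" "R \<ge> 0"
  shows "norm (ev (Jl lam) x) \<le> (bern TYPE('n) * R * real CARD('n)) ^ k"
proof -
  have b: "0 \<le> (bern TYPE('n) * R) ^ k" using bern_nonneg[where 'n='n] x(2) by simp
  have "norm (ev (Jl lam) x) * sqrt (fact k) \<le> (bern TYPE('n) * R) ^ k * sqrt (qf k (Jl lam :: 'n pol))"
    by (rule ev_le_qf[OF homi_Jl[OF lam] x])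
  also have "\<dots> \<le> (bern TYPE('n) * R) ^ k * (sqrt (real CARD('n) ^ k) * sqrt (fact k))"
    using qf_Jl_le[OF lam] b by (intro mult_left_mono) (auto simp flip: real_sqrt_mult)
  finally have "norm (ev (Jl lam) x) \<le> (bern TYPE('n) * R) ^ k * sqrt (real CARD('n) ^ k)"
    by (simp flip: mult.assoc)
  also have "\<dots> \<le> (bern TYPE('n) * R) ^ k * real CARD('n) ^ k"
  proof (rule mult_left_mono[OF _ b])
    have "1 \<le> real CARD('n) ^ k" by (rule one_le_power) simp
    then show "sqrt (real CARD('n) ^ k) \<le> real CARD('n) ^ k"
      by (intro real_le_lsqrt) (auto simp: power2_eq_square mult_le_cancel_right1)
  qed
  finally show ?thesis by (simp add: power_mult_distrib mult_ac)
qed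

end

section \<open>The differential equation of the confluent series\<close>

text \<open>Both sides are polynomials in u that agree at infinitely many points, so their roots
  agree with multiplicity.\<close>

lemma shifted_root_mset:
  fixes r s :: "nat \<Rightarrow> complex"
  assumes "\<And>u::real. (\<Prod>i=1..n. of_real u + r i) * (of_real u + t) = (\<Prod>i=1..n. of_real u + s i) * (of_real u + (t + 1))"
  shows "image_mset r (mset_set {1..n}) + {#t#} = image_mset s (mset_set {1..n}) + {#t + 1#}"
proof -
  define P where "P = (\<lambda>r t. (\<Prod>i\<in>{1..n}. [:r i, 1:]) * [:t, 1:] :: complex poly)"
  have ne: "(\<Prod>i\<in>{1..n}. [:r i, 1:]) \<noteq> 0" for r :: "nat \<Rightarrow> complex" by (simp add: prod_zero_iff)
  have roots: "proots (P r t) = image_mset uminus (image_mset r (mset_set {1..n}) + {#t#})" for r t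
  proof -
    have "proots (\<Prod>i\<in>{1..n}. [:r i, 1:]) = (\<Sum>i\<in>{1..n}. {#- r i#})"
      by (subst proots_prod) auto
    also have "\<dots> = image_mset (\<lambda>i. - r i) (mset_set {1..n})"
    proof -
      have "finite S \<Longrightarrow> (\<Sum>i\<in>S. {#- r i#}) = image_mset (\<lambda>i. - r i) (mset_set S)" for S
        by (induction S rule: finite_induct) auto
      then show ?thesis by simp
    qed
    finally show ?thesis unfolding P_def by (subst proots_mult[OF ne]) (simp_all add: image_mset.compositionality o_def)
  qed
  have pe: "poly (P r t) x = (\<Prod>i=1..n. x + r i) * (x + t)" for r t x
    unfolding P_def by (simp add: poly_prod algebra_simps)
  have "P r t - P s (t + 1) = 0"
  proof (rule ccontr)
    assume "P r t - P s (t + 1) \<noteq> 0"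
    then have "finite {x. poly (P r t - P s (t + 1)) x = 0}" by (rule poly_roots_finite)
    moreover have "range complex_of_real \<subseteq> {x. poly (P r t - P s (t + 1)) x = 0}"
      by (auto simp only: mem_Collect_eq poly_diff pe assms diff_self)
    moreover have "infinite (range complex_of_real)"
      using range_inj_infinite infinite_UNIV_char_0 inj_of_real by (metis finite_imageD)
    ultimately show False using finite_subset by blast
  qed
  then have "proots (P r t) = proots (P s (t + 1))" by simp
  then have "image_mset uminus (proots (P r t)) = image_mset uminus (proots (P s (t + 1)))" by simp
  then show ?thesis unfolding roots by (simp add: image_mset.compositionality o_def)
qed

locale jack_param = jack +
  fixes n :: nat and c :: complex
  assumes nonpole: "\<And>i. i \<in> {1..n} \<Longrightarrow> c - of_real (\<gamma> * (real i - 1)) \<notin> \<int>\<^sub>\<le>\<^sub>0"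
begin

abbreviation gp :: "(nat \<Rightarrow> nat) \<Rightarrow> complex" where "gp \<equiv> gen_pochhammer n (1 / \<gamma>) c"

definition root :: "(nat \<Rightarrow> nat) \<Rightarrow> nat \<Rightarrow> complex" where
  "root lam i = of_nat (lam i) + of_real \<gamma> * of_nat (n - i)"

text \<open>Chosen so that c0 + root lam i is c - gamma (i - 1) + lam_i, the end point of the i-th
  Pochhammer factor.\<close>

definition c0 :: complex where "c0 = c - of_real (\<gamma> * (real n - 1))"

lemma c0_root: "i \<in> {1..n} \<Longrightarrow> c0 + root lam i = (c - of_real (\<gamma> * (real i - 1))) + of_nat (lam i)"
  by (simp add: c0_def root_def of_nat_diff algebra_simps)

lemma nonpole_root: "i \<in> {1..n} \<Longrightarrow> c0 + root lam i \<notin> \<int>\<^sub>\<le>\<^sub>0"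
  unfolding c0_root using nonpole[of i]
  by (metis add_diff_cancel_right' nonpos_Ints_diff_Nats of_nat_in_Nats)

text \<open>Up to a constant factor, the generalized Pochhammer symbol depends only on the multiset
  of the numbers \<open>root lam i\<close>; in this form \<open>gp_shift\<close> can use an equality
  of multisets.\<close>

lemma gp_Gamma: "gp lam * (\<Prod>i=1..n. Gamma (c - of_real (\<gamma> * (real i - 1)))) = (\<Prod>i=1..n. Gamma (c0 + root lam i))"
proof -
  have "gp lam * (\<Prod>i=1..n. Gamma (c - of_real (\<gamma> * (real i - 1)))) =
     (\<Prod>i=1..n. pochhammer (c - of_real (\<gamma> * (real i - 1))) (lam i) * Gamma (c - of_real (\<gamma> * (real i - 1))))"
    unfolding gen_pochhammer_def by (simp add: prod.distrib mult.commute)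
  also have "\<dots> = (\<Prod>i=1..n. Gamma (c0 + root lam i))"
    by (intro prod.cong refl) (simp add: c0_root pochhammer_Gamma nonpole Gamma_eq_zero_iff del: of_real_mult)
  finally show ?thesis .
qed

lemma Gamma_prod_nonzero: "(\<Prod>i=1..n. Gamma (c - of_real (\<gamma> * (real i - 1)))) \<noteq> 0"
  using nonpole by (auto simp: prod_zero_iff Gamma_eq_zero_iff simp del: of_real_mult)

lemma gp_nonzero: "gp lam \<noteq> 0"
proof
  assume "gp lam = 0"
  then have "(\<Prod>i=1..n. Gamma (c0 + root lam i)) = 0" using gp_Gamma[of lam] by simp
  then show False using nonpole_root by (auto simp: prod_zero_iff Gamma_eq_zero_iff)
qed

text \<open>With t = be / al the hypothesis says that the numbers of lam together with t are those
  of mu together with t + 1. Comparing Gamma products gives gp lam = gp mu * (c0 + t). If al = 0,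
  then be = 0 too, as otherwise lam and mu would have equal eigenvalues.\<close>

lemma gp_shift:
  assumes "lam \<in> parts n (Suc k)" "mu \<in> parts n k"
    and eq: "\<And>u::real. zval n lam (of_real u) * (of_real u * al + be) = zval n mu (of_real u) * ((of_real u + 1) * al + be)"
  shows "gp lam * al = gp mu * (c0 * al + be)"
proof (cases "al = 0")
  case True
  have "be = 0"
  proof (rule ccontr)
    assume "be \<noteq> 0"
    then have "zval n lam (of_real u) = zval n mu (of_real u)" for u :: real using eq[of u] True by simp
    then have "lam = mu" using assms by (intro zval_separates[of lam n mu]) (auto simp: parts_def)
    then show False using assms by (simp add: parts_def)
  qed
  then show ?thesis using True by simp
next
  case False
  define t where "t = be / al"
  have be: "be = al * t" using False by (simp add: t_def)
  have "image_mset (root lam) (mset_set {1..n}) + {#t#} = image_mset (root mu) (mset_set {1..n}) + {#t + 1#}"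
  proof (rule shifted_root_mset)
    fix u :: real
    have "(zval n lam (of_real u) * (of_real u + t)) * al = (zval n mu (of_real u) * (of_real u + (t + 1))) * al"
      using eq[of u] by (simp add: be algebra_simps)
    then show "(\<Prod>i=1..n. of_real u + root lam i) * (of_real u + t) = (\<Prod>i=1..n. of_real u + root mu i) * (of_real u + (t + 1))"
      using False by (simp add: zval_def root_def)
  qed
  note ms = this
  \<comment> \<open>t differs from t + 1, so it is one of the numbers of mu; hence Gamma (c0 + t) is
    finite and nonzero and may be cancelled.\<close>
  have "t \<in># image_mset (root mu) (mset_set {1..n}) + {#t + 1#}" unfolding ms[symmetric] by simp
  then obtain i where i: "i \<in> {1..n}" "t = root mu i" by auto
  have np: "c0 + t \<notin> \<int>\<^sub>\<le>\<^sub>0" using nonpole_root i by simp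
  then have nz: "c0 + t \<noteq> 0" by auto
  have "(\<Prod>i=1..n. Gamma (c0 + root lam i)) * Gamma (c0 + t) = (\<Prod>i=1..n. Gamma (c0 + root mu i)) * Gamma (c0 + t + 1)"
    using arg_cong[OF ms, of "\<lambda>A. prod_mset (image_mset (\<lambda>x. Gamma (c0 + x)) A)"]
    by (simp add: prod_unfold_prod_mset image_mset.compositionality o_def add_ac mult_ac)
  also have "Gamma (c0 + t + 1) = (c0 + t) * Gamma (c0 + t)"
    using np by (rule Gamma_plus1)
  finally have "(\<Prod>i=1..n. Gamma (c0 + root lam i)) = (\<Prod>i=1..n. Gamma (c0 + root mu i)) * (c0 + t)"
    using np by (simp add: Gamma_eq_zero_iff)
  then have "gp lam = gp mu * (c0 + t)"
    unfolding gp_Gamma[symmetric] using Gamma_prod_nonzero by (simp add: mult.assoc mult.left_commute)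
  then show ?thesis by (simp add: be algebra_simps)
qed

end

section \<open>Multiplication by p_1 and the degreewise form of the equation\<close>

context jack
begin

lemma ze_sym: "sym f \<Longrightarrow> ze i f = y i f + CC (of_real \<gamma> * (of_nat CARD('n) - 1)) * f"
  for f :: "'n::finite pol"
  unfolding ze_def xi_def by (simp add: card_Diff_singleton of_nat_pol CC_simps of_nat_diff mult.assoc)

lemma act_ze: "bij p \<Longrightarrow> act p (ze i f) = ze (p i) (act p f)"
  unfolding ze_def by (simp add: act_xi image_set_diff bij_is_inj bij_is_surj)

definition G :: "'n::finite pol \<Rightarrow> 'n pol" where "G f = (\<Sum>i\<in>UNIV. X i * ze i f)"

lemma ze_linear: "ze i (f + g) = ze i f + ze i g" "ze i (CC t * f) = CC t * ze i f"
  by (simp_all add: ze_def)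

lemma G_add: "G (f + g) = G f + G g"
  by (simp add: G_def ze_linear distrib_left sum.distrib)

lemma sym_G: "sym f \<Longrightarrow> sym (G f)"
  unfolding sym_def
proof (intro allI impI)
  fix p :: "'a \<Rightarrow> 'a" assume s: "\<forall>p. bij p \<longrightarrow> act p f = f" and p: "bij p"
  have "act p (G f) = (\<Sum>i\<in>UNIV. X (p i) * ze (p i) f)" using s p by (simp add: G_def act_ze)
  also have "\<dots> = G f" unfolding G_def
    using p by (intro sum.reindex_bij_betw) (simp add: bij_def bij_betw_def)
  finally show "act p (G f) = G f" .
qed

lemma homi_G: "homi k f \<Longrightarrow> homi (Suc k) (G f)"
  unfolding G_def ze_def by (intro homi_sum homi_X homi_xi)

lemma Zop_G:
  assumes "Zop u f = CC z * f"
  shows "Zop u (CC u * (p1p * f) + G f) = CC z * (CC (u + 1) * (p1p * f) + G f)"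
proof -
  have "Zop u (\<Sum>i\<in>UNIV. X i * (CC u * f + ze i f)) = (\<Sum>i\<in>UNIV. X i * (CC (u + 1) * (CC z * f) + ze i (CC z * f)))"
    unfolding Zop_sum Zop_X assms ..
  also have "(\<Sum>i\<in>UNIV. X i * (CC u * f + ze i f)) = CC u * (p1p * f) + G f"
    by (simp add: G_def p1p_def distrib_left sum.distrib sum_distrib_left sum_distrib_right mult_ac)
  also have "(\<Sum>i\<in>UNIV. X i * (CC (u + 1) * (CC z * f) + ze i (CC z * f))) = CC z * (CC (u + 1) * (p1p * f) + G f)"
    unfolding ze_linear by (simp add: G_def p1p_def distrib_left sum.distrib sum_distrib_left sum_distrib_right mult_ac)
  finally show ?thesis .
qed

lemma CC_cancel: "CC a * f = CC b * f \<Longrightarrow> f \<noteq> 0 \<Longrightarrow> a = b"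
proof (rule ccontr)
  assume *: "CC a * f = CC b * f" "f \<noteq> 0" "a \<noteq> b"
  have "CC (1 / (a - b)) * (CC (a - b) * f) = 0" using *(1) by (simp add: CC_simps algebra_simps)
  then have "CC ((1 / (a - b)) * (a - b)) * f = 0" unfolding CC_simps(2) mult.assoc .
  then show False using * by (simp add: CC_simps)
qed

text \<open>The coefficients stay implicit; the relation between them, obtained by comparing both
  sides of \<open>Zop_G\<close>, is all that \<open>gp_shift\<close> asks for.\<close>

lemma pieri_coefficients:
  assumes mu: "mu \<in> parts CARD('n) k"
  shows "\<exists>al be. p1p * Jl mu = (\<Sum>lam\<in>parts CARD('n) (Suc k). CC (al lam) * (Pj lam :: 'n::finite pol)) \<and>
    G (Jl mu) = (\<Sum>lam\<in>parts CARD('n) (Suc k). CC (be lam) * (Pj lam :: 'n pol)) \<and>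
    (\<forall>lam\<in>parts CARD('n) (Suc k). \<forall>u::real. zval CARD('n) lam (of_real u) * (of_real u * al lam + be lam) =
       zval CARD('n) mu (of_real u) * ((of_real u + 1) * al lam + be lam))"
proof -
  let ?Q = "parts CARD('n) (Suc k)"
  have "lincomb Pj ?Q (p1p * Jl mu :: 'n pol)"
    by (intro sym_lincomb_Pj sym_mult sym_p1p sym_Jl[OF mu] homi_p1p_mult homi_Jl[OF mu])
  then obtain al where al: "p1p * Jl mu = (\<Sum>lam\<in>?Q. CC (al lam) * (Pj lam :: 'n pol))" unfolding lincomb_def by blast
  have "lincomb Pj ?Q (G (Jl mu) :: 'n pol)"
    by (intro sym_lincomb_Pj sym_G sym_Jl[OF mu] homi_G homi_Jl[OF mu])
  then obtain be where be: "G (Jl mu) = (\<Sum>lam\<in>?Q. CC (be lam) * (Pj lam :: 'n pol))" unfolding lincomb_def by blast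
  \<comment> \<open>Where \<open>Pj lam\<close> vanishes, the expansions leave the coefficients
    free; the value 0 makes the relation hold there.\<close>
  define nz where "nz = (\<lambda>a lam. if (Pj lam :: 'n pol) = 0 then 0 else a lam :: complex)"
  have nz: "(\<Sum>lam\<in>?Q. CC (a lam) * (Pj lam :: 'n pol)) = (\<Sum>lam\<in>?Q. CC (nz a lam) * Pj lam)" for a
    by (intro sum.cong refl) (simp add: nz_def)
  have "zval CARD('n) lam (of_real u) * (of_real u * nz al lam + nz be lam) =
       zval CARD('n) mu (of_real u) * ((of_real u + 1) * nz al lam + nz be lam)" if lam: "lam \<in> ?Q" for lam and u :: real
  proof (cases "(Pj lam :: 'n pol) = 0")
    case False
    have "Zop (of_real u) (CC (of_real u) * (p1p * Jl mu) + G (Jl mu)) =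
      CC (zval CARD('n) mu (of_real u)) * (CC (of_real u + 1) * (p1p * Jl mu) + G (Jl mu :: 'n pol))"
      by (rule Zop_G) (rule Zop_Jl[OF mu])
    also have "Zop (of_real u) (CC (of_real u) * (p1p * Jl mu) + G (Jl mu)) =
      (\<Sum>lam\<in>?Q. CC (zval CARD('n) lam (of_real u) * (of_real u * nz al lam + nz be lam)) * (Pj lam :: 'n pol))"
    proof -
      have "CC (of_real u) * (p1p * Jl mu) + G (Jl mu) = (\<Sum>lam\<in>?Q. CC (of_real u * nz al lam + nz be lam) * (Pj lam :: 'n pol))"
        unfolding al be nz[of al] nz[of be] sum_distrib_left sum.distrib[symmetric]
        by (intro sum.cong refl) (simp add: CC_simps algebra_simps)
      then have "Zop (of_real u) (CC (of_real u) * (p1p * Jl mu) + G (Jl mu)) = (\<Sum>lam\<in>?Q. CC (of_real u * nz al lam + nz be lam) * Zop (of_real u) (Pj lam :: 'n pol))"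
        by simp
      also have "\<dots> = (\<Sum>lam\<in>?Q. CC (zval CARD('n) lam (of_real u) * (of_real u * nz al lam + nz be lam)) * (Pj lam :: 'n pol))"
        by (intro sum.cong refl) (auto simp: Zop_Pj parts_def CC_simps mult_ac)
      finally show ?thesis .
    qed
    also have "CC (zval CARD('n) mu (of_real u)) * (CC (of_real u + 1) * (p1p * Jl mu) + G (Jl mu :: 'n pol)) =
      (\<Sum>lam\<in>?Q. CC (zval CARD('n) mu (of_real u) * ((of_real u + 1) * nz al lam + nz be lam)) * (Pj lam :: 'n pol))"
      unfolding al be nz[of al] nz[of be] sum_distrib_left sum.distrib[symmetric]
      by (intro sum.cong refl) (simp add: CC_simps algebra_simps)
    finally show ?thesis by (rule CC_cancel[OF Pj_independent[OF _ lam] False])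
  qed (simp add: nz_def)
  then show ?thesis using al be unfolding nz[of al] nz[of be] by blast
qed

definition p2p :: "'n::finite pol" where "p2p = (\<Sum>i\<in>UNIV. X i * X i)"

lemma y_p1p_power: "y i (p1p ^ m) = CC (of_nat m) * (X i * p1p ^ (m - 1))"
  by (simp add: y_def T_p1p_power mult_ac)

lemma G_p1p_power:
  "G (p1p ^ m) = CC (of_nat m) * (p2p * p1p ^ (m - 1)) + CC (of_real \<gamma> * (of_nat CARD('n) - 1)) * (p1p ^ Suc m :: 'n::finite pol)"
  unfolding G_def ze_sym[OF sym_p1p_power] y_p1p_power
  by (simp add: p2p_def p1p_def distrib_left sum.distrib sum_distrib_left sum_distrib_right mult_ac)

lemma Y2_p1p_power:
  "Y2 (p1p ^ Suc k) = CC (of_nat (Suc k) * of_nat k) * (p2p * p1p ^ (k - 1))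
     + CC ((1 + of_real \<gamma> * (of_nat CARD('n) - 1)) * of_nat (Suc k)) * (p1p ^ Suc k :: 'n::finite pol)"
proof -
  have "y i (y i (p1p ^ Suc k)) = CC (of_nat (Suc k)) * (X i * (X i * (CC (of_nat k) * p1p ^ (k - 1)) + p1p ^ k
     + gam * (CC (of_nat (CARD('n) - 1)) * p1p ^ k)) :: 'n pol)" for i
  proof -
    have "y i (y i (p1p ^ Suc k)) = CC (of_nat (Suc k)) * (X i * T i (X i * p1p ^ k))"
      unfolding y_p1p_power y_CC_mult by (simp add: y_def)
    then show ?thesis unfolding T_X_mult_same T_p1p_power
      by (simp add: sym_p1p_power card_Diff_singleton of_nat_pol del: act_simps(10))
  qed
  then have "Y2 (p1p ^ Suc k) = (\<Sum>i\<in>UNIV. CC (of_nat (Suc k)) * (X i * (X i * (CC (of_nat k) * p1p ^ (k - 1)) + p1p ^ k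
     + gam * (CC (of_nat (CARD('n) - 1)) * p1p ^ k)) :: 'n pol))"
    unfolding Y2_def by simp
  also have "\<dots> = CC (of_nat (Suc k)) * (CC (of_nat k) * (p2p * p1p ^ (k - 1)) + p1p * p1p ^ k + gam * CC (of_nat (CARD('n) - 1)) * (p1p * p1p ^ k))"
    by (simp add: p2p_def p1p_def distrib_left sum.distrib sum_distrib_left sum_distrib_right mult_ac)
  also have "\<dots> = CC (of_nat (Suc k) * of_nat k) * (p2p * p1p ^ (k - 1))
     + CC ((1 + of_real \<gamma> * (of_nat CARD('n) - 1)) * of_nat (Suc k)) * (p1p ^ Suc k :: 'n pol)"
    by (rule pol_eqI) (simp add: of_nat_diff algebra_simps)
  finally show ?thesis .
qed

lemma yval_rho: "lam \<in> parts n k \<Longrightarrow> yval n lam = rho n (1 / \<gamma>) lam + (1 + \<gamma> * (real n - 1)) * real k"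
proof -
  assume "lam \<in> parts n k"
  then have p: "psize n lam = k" by (simp add: parts_def)
  have rho: "rho n (1 / \<gamma>) lam = yval n lam + (\<gamma> * (real n - 1) - 1) * real k - 2 / (1 / \<gamma>) * real k * (real n - 1)"
    using jack_eigenvalue_eq[of n lam] unfolding jack_eigenvalue_def p eq_diff_eq .
  show ?thesis unfolding rho by (simp add: algebra_simps)
qed

end

text \<open>\<open>gp_shift\<close> trades 1 / gp mu for 1 / gp lam, with a numerator in which the
  sum over mu can be carried out. This leaves an identity between polynomials without
  \<open>gp\<close>, whose coefficients can be compared for each lam before dividing by gp lam
  again.\<close>

lemma (in jack) Jl_diff_eq:
  fixes c :: complex
  assumes np: "\<And>i. i \<in> {1..CARD('n)} \<Longrightarrow> c - of_real (\<gamma> * (real i - 1)) \<notin> \<int>\<^sub>\<le>\<^sub>0"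
  defines "gp \<equiv> gen_pochhammer CARD('n) (1 / \<gamma>) c"
  shows "(\<Sum>lam\<in>parts CARD('n) (Suc k). CC ((of_real (rho CARD('n) (1 / \<gamma>) lam) + c * of_nat (Suc k)) / gp lam) * (Jl lam :: 'n::finite pol))
    = CC (of_nat (Suc k)) * (p1p * (\<Sum>mu\<in>parts CARD('n) k. CC (1 / gp mu) * Jl mu))"
proof -
  interpret jack_param \<gamma> "CARD('n)" c by unfold_locales (rule np)
  let ?Q = "parts CARD('n) (Suc k)" and ?R = "parts CARD('n) k"
  define PC where "PC = (\<lambda>mu al be. p1p * Jl mu = (\<Sum>lam\<in>?Q. CC (al lam) * (Pj lam :: 'n pol)) \<and>
    G (Jl mu) = (\<Sum>lam\<in>?Q. CC (be lam) * (Pj lam :: 'n pol)) \<and>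
    (\<forall>lam\<in>?Q. \<forall>u::real. zval CARD('n) lam (of_real u) * (of_real u * al lam + be lam) =
       zval CARD('n) mu (of_real u) * ((of_real u + 1) * al lam + be lam)))"
  have "\<forall>mu\<in>?R. \<exists>p. PC mu (fst p) (snd p)"
  proof
    fix mu assume "mu \<in> ?R"
    from pieri_coefficients[OF this] obtain al be where "PC mu al be" unfolding PC_def by (elim exE)
    then show "\<exists>p. PC mu (fst p) (snd p)" by (intro exI[of _ "(al, be)"]) simp
  qed
  from bchoice[OF this] obtain p where p: "\<forall>mu\<in>?R. PC mu (fst (p mu)) (snd (p mu))" by (elim exE)
  define al where "al = (\<lambda>mu. fst (p mu))"
  define be where "be = (\<lambda>mu. snd (p mu))"
  have PC: "PC mu (al mu) (be mu)" if "mu \<in> ?R" for mu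
    unfolding al_def be_def using p that by (rule bspec)
  have ab: "p1p * Jl mu = (\<Sum>lam\<in>?Q. CC (al mu lam) * (Pj lam :: 'n pol))"
    "G (Jl mu) = (\<Sum>lam\<in>?Q. CC (be mu lam) * (Pj lam :: 'n pol))" if "mu \<in> ?R" for mu
    by (rule conjunct1[OF PC[OF that, unfolded PC_def]], rule conjunct1[OF conjunct2[OF PC[OF that, unfolded PC_def]]])
  have ab3: "zval CARD('n) lam (of_real u) * (of_real u * al mu lam + be mu lam) =
       zval CARD('n) mu (of_real u) * ((of_real u + 1) * al mu lam + be mu lam)"
    if "mu \<in> ?R" "lam \<in> ?Q" for mu lam and u :: real
    by (rule bspec[OF conjunct2[OF conjunct2[OF PC[OF that(1), unfolded PC_def]]] that(2), THEN spec])
  have sh: "al mu lam / gp mu = (c0 * al mu lam + be mu lam) / gp lam" if "mu \<in> ?R" "lam \<in> ?Q" for mu lam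
    using gp_shift[OF that(2,1) ab3[OF that]] gp_nonzero[of mu] gp_nonzero[of lam]
    unfolding gp_def by (simp add: frac_eq_eq mult.commute)
  define A where "A = (\<lambda>lam. \<Sum>mu\<in>?R. c0 * al mu lam + be mu lam)"
  have "p1p * (\<Sum>mu\<in>?R. CC (1 / gp mu) * Jl mu) = (\<Sum>mu\<in>?R. \<Sum>lam\<in>?Q. CC (al mu lam / gp mu) * (Pj lam :: 'n pol))"
    unfolding sum_distrib_left
  proof (intro sum.cong refl)
    fix mu assume mu: "mu \<in> ?R"
    have "p1p * (CC (1 / gp mu) * Jl mu) = CC (1 / gp mu) * (p1p * (Jl mu :: 'n pol))" by (simp only: mult_ac)
    then show "p1p * (CC (1 / gp mu) * Jl mu) = (\<Sum>lam\<in>?Q. CC (al mu lam / gp mu) * (Pj lam :: 'n pol))"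
      unfolding ab(1)[OF mu] by (simp add: sum_distrib_left flip: mult.assoc CC_simps(2))
  qed
  also have "\<dots> = (\<Sum>lam\<in>?Q. \<Sum>mu\<in>?R. CC ((c0 * al mu lam + be mu lam) / gp lam) * (Pj lam :: 'n pol))"
    by (subst sum.swap, intro sum.cong refl) (simp add: sh)
  also have "\<dots> = (\<Sum>lam\<in>?Q. CC (A lam / gp lam) * (Pj lam :: 'n pol))"
    by (simp add: A_def CC_sum sum_distrib_right sum_divide_distrib)
  finally have lhs: "p1p * (\<Sum>mu\<in>?R. CC (1 / gp mu) * Jl mu) = (\<Sum>lam\<in>?Q. CC (A lam / gp lam) * (Pj lam :: 'n pol))" .
  \<comment> \<open>Without the denominators the sum over mu recombines the Jack polynomials to
    p_1^k, where G is explicit.\<close>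
  have "(\<Sum>lam\<in>?Q. CC (A lam) * (Pj lam :: 'n pol)) = (\<Sum>lam\<in>?Q. \<Sum>mu\<in>?R. CC c0 * (CC (al mu lam) * Pj lam) + CC (be mu lam) * Pj lam)"
    unfolding A_def CC_sum sum_distrib_right by (intro sum.cong refl) (simp add: CC_simps algebra_simps)
  also have "\<dots> = (\<Sum>mu\<in>?R. CC c0 * (p1p * Jl mu) + G (Jl mu))"
    by (subst sum.swap, intro sum.cong refl) (simp add: ab sum.distrib sum_distrib_left)
  also have "\<dots> = CC c0 * (p1p * p1p ^ k) + G (p1p ^ k)"
    by (simp add: sum.distrib additive_sum[of G, OF G_add, symmetric] sum_Jl flip: sum_distrib_left)
  also have "\<dots> = CC c * p1p ^ Suc k + CC (of_nat k) * (p2p * p1p ^ (k - 1))"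
    unfolding G_p1p_power by (rule pol_eqI) (simp add: c0_def algebra_simps)
  finally have A: "(\<Sum>lam\<in>?Q. CC (A lam) * (Pj lam :: 'n pol)) = \<dots>" .
  define B where "B = (\<lambda>lam. of_real (rho CARD('n) (1 / \<gamma>) lam) + c * of_nat (Suc k))"
  have "(\<Sum>lam\<in>?Q. CC (B lam) * (Jl lam :: 'n pol)) =
     (\<Sum>lam\<in>?Q. CC (of_real (yval CARD('n) lam)) * Jl lam + CC ((c - (1 + of_real \<gamma> * (of_nat CARD('n) - 1))) * of_nat (Suc k)) * Jl lam)"
  proof (intro sum.cong refl)
    fix lam assume "lam \<in> ?Q"
    then show "CC (B lam) * (Jl lam :: 'n pol) = CC (of_real (yval CARD('n) lam)) * Jl lam + CC ((c - (1 + of_real \<gamma> * (of_nat CARD('n) - 1))) * of_nat (Suc k)) * Jl lam"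
      unfolding distrib_right[symmetric] CC_simps(1)[symmetric] B_def
      by (intro arg_cong[of _ _ "\<lambda>t. CC t * Jl lam"]) (simp add: yval_rho algebra_simps)
  qed
  also have "\<dots> = Y2 (p1p ^ Suc k) + CC ((c - (1 + of_real \<gamma> * (of_nat CARD('n) - 1))) * of_nat (Suc k)) * p1p ^ Suc k"
  proof -
    have "Y2 (p1p ^ Suc k) = (\<Sum>lam\<in>?Q. Y2 (Jl lam :: 'n pol))" unfolding sum_Jl[symmetric] by (rule Y2_sum)
    also have "\<dots> = (\<Sum>lam\<in>?Q. CC (of_real (yval CARD('n) lam)) * (Jl lam :: 'n pol))" by (intro sum.cong refl Y2_Jl)
    finally show ?thesis unfolding sum.distrib sum_distrib_left[symmetric] sum_Jl by simp
  qed
  \<comment> \<open>The same combination of p_1^(k+1) and p_2 p_1^(k-1) as for A, now multiplied by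
    k + 1.\<close>
  also have "\<dots> = CC (of_nat (Suc k)) * (CC c * p1p ^ Suc k + CC (of_nat k) * (p2p * p1p ^ (k - 1)))"
    unfolding Y2_p1p_power by (rule pol_eqI) (simp add: algebra_simps)
  also have "\<dots> = (\<Sum>lam\<in>?Q. CC (of_nat (Suc k) * A lam) * (Pj lam :: 'n pol))"
    unfolding A[symmetric] by (simp add: sum_distrib_left CC_simps mult.assoc)
  finally have "(\<Sum>lam\<in>?Q. CC (of_nat (Suc k) * A lam) * (Pj lam :: 'n pol)) = (\<Sum>lam\<in>?Q. CC (B lam * jcoeff TYPE('n) (Suc k) lam) * Pj lam)"
    by (simp add: Jl_parts CC_simps mult.assoc)
  note indep = Pj_independent[OF this]
  have "(\<Sum>lam\<in>?Q. CC (B lam / gp lam) * (Jl lam :: 'n pol)) = (\<Sum>lam\<in>?Q. CC (of_nat (Suc k)) * (CC (A lam / gp lam) * Pj lam))"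
  proof (intro sum.cong refl)
    fix lam assume lam: "lam \<in> ?Q"
    have "CC (B lam / gp lam) * (Jl lam :: 'n pol) = CC (1 / gp lam) * (CC (B lam * jcoeff TYPE('n) (Suc k) lam) * Pj lam)"
      unfolding Jl_parts[OF lam] mult.assoc[symmetric] CC_simps(2)[symmetric] by simp
    also have "\<dots> = CC (1 / gp lam) * (CC (of_nat (Suc k) * A lam) * (Pj lam :: 'n pol))" using indep[OF lam] by simp
    also have "\<dots> = CC (of_nat (Suc k)) * (CC (A lam / gp lam) * Pj lam)"
      unfolding mult.assoc[symmetric] CC_simps(2)[symmetric] by simp
    finally show "CC (B lam / gp lam) * (Jl lam :: 'n pol) = CC (of_nat (Suc k)) * (CC (A lam / gp lam) * Pj lam)" .
  qed
  then show ?thesis unfolding lhs B_def by (simp only: sum_distrib_left)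
qed

section \<open>Second-order expansion of products\<close>

text \<open>The error is dominated by the corresponding error e for the norms of the w_i. That one
  is a polynomial in s with nonnegative coefficients starting at s^2, so e(s) / s^2 is
  increasing.\<close>

lemma prod_second_order:
  fixes w :: "'i \<Rightarrow> complex"
  assumes "finite I" "0 \<le> s" "s \<le> s0" "0 < s0"
  shows "norm ((\<Prod>i\<in>I. 1 + of_real s * w i) - 1 - of_real s * (\<Sum>i\<in>I. w i)) \<le> (s / s0)\<^sup>2 * (\<Prod>i\<in>I. 1 + s0 * norm (w i))"
proof -
  define e where "e = (\<lambda>J s. (\<Prod>i\<in>J. 1 + s * norm (w i)) - 1 - s * (\<Sum>i\<in>J. norm (w i)))"
  have e_insert: "e (insert i J) s = e J s * (1 + s * norm (w i)) + s\<^sup>2 * norm (w i) * (\<Sum>i\<in>J. norm (w i))"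
    if "finite J" "i \<notin> J" for i J s
    using that by (simp add: e_def power2_eq_square algebra_simps)
  have 1: "norm ((\<Prod>i\<in>J. 1 + of_real s * w i) - 1 - of_real s * (\<Sum>i\<in>J. w i)) \<le> e J s \<and> 0 \<le> e J s \<and> e J s \<le> (s / s0)\<^sup>2 * e J s0"
    if "finite J" for J
    using that
  proof (induction J)
    case (insert i J)
    define P where "P = (\<Prod>i\<in>J. 1 + of_real s * w i) - 1 - of_real s * (\<Sum>i\<in>J. w i)"
    define N where "N = (\<Sum>i\<in>J. norm (w i))"
    have N: "0 \<le> N" "norm (\<Sum>i\<in>J. w i) \<le> N" unfolding N_def by (auto intro: sum_nonneg norm_sum)
    have IH: "norm P \<le> e J s" "0 \<le> e J s" "e J s \<le> (s / s0)\<^sup>2 * e J s0" using insert.IH by (auto simp: P_def)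
    have eq: "(\<Prod>i\<in>insert i J. 1 + of_real s * w i) - 1 - of_real s * (\<Sum>i\<in>insert i J. w i)
       = P * (1 + of_real s * w i) + (of_real s)\<^sup>2 * w i * (\<Sum>i\<in>J. w i)"
      using insert.hyps by (simp add: P_def power2_eq_square algebra_simps)
    have fac: "norm (1 + of_real s * w i) \<le> 1 + s * norm (w i)"
      using norm_triangle_ineq[of 1 "of_real s * w i"] assms(2) by (simp add: norm_mult)
    have "norm (P * (1 + of_real s * w i) + (of_real s)\<^sup>2 * w i * (\<Sum>i\<in>J. w i))
      \<le> norm P * norm (1 + of_real s * w i) + s\<^sup>2 * norm (w i) * norm (\<Sum>i\<in>J. w i)"
      using norm_triangle_ineq[of "P * (1 + of_real s * w i)" "(of_real s)\<^sup>2 * w i * (\<Sum>i\<in>J. w i)"] assms(2)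
      by (simp add: norm_mult norm_power)
    also have "\<dots> \<le> e J s * (1 + s * norm (w i)) + s\<^sup>2 * norm (w i) * N"
      using IH fac N assms(2) by (intro add_mono mult_mono mult_nonneg_nonneg) auto
    finally have A: "norm ((\<Prod>i\<in>insert i J. 1 + of_real s * w i) - 1 - of_real s * (\<Sum>i\<in>insert i J. w i)) \<le> e (insert i J) s"
      unfolding eq e_insert[OF insert.hyps] N_def .
    have B: "0 \<le> e (insert i J) s"
      unfolding e_insert[OF insert.hyps] N_def[symmetric] using IH N assms(2) by (intro add_nonneg_nonneg mult_nonneg_nonneg) auto
    have "e J s * (1 + s * norm (w i)) \<le> ((s / s0)\<^sup>2 * e J s0) * (1 + s0 * norm (w i))"
      using IH assms by (intro mult_mono) (auto intro!: mult_right_mono add_nonneg_nonneg)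
    moreover have "s\<^sup>2 * norm (w i) * N \<le> (s / s0)\<^sup>2 * (s0\<^sup>2 * norm (w i) * N)"
      using assms by (simp add: power_divide)
    ultimately have "e J s * (1 + s * norm (w i)) + s\<^sup>2 * norm (w i) * N
      \<le> ((s / s0)\<^sup>2 * e J s0) * (1 + s0 * norm (w i)) + (s / s0)\<^sup>2 * (s0\<^sup>2 * norm (w i) * N)"
      by (rule add_mono)
    then have "e (insert i J) s \<le> (s / s0)\<^sup>2 * e (insert i J) s0"
      unfolding e_insert[OF insert.hyps] N_def[symmetric] by (simp only: distrib_left mult.assoc)
    with A B show ?case by blast
  qed (simp add: e_def)
  have "e I s0 \<le> (\<Prod>i\<in>I. 1 + s0 * norm (w i))"
    using assms by (simp add: e_def) (smt (verit) mult_nonneg_nonneg norm_ge_zero sum_nonneg)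
  then have "(s / s0)\<^sup>2 * e I s0 \<le> (s / s0)\<^sup>2 * (\<Prod>i\<in>I. 1 + s0 * norm (w i))"
    by (intro mult_left_mono) auto
  then show ?thesis using 1[OF assms(1)] by linarith
qed

section \<open>Summation over partitions\<close>

text \<open>Restriction to {1..n} embeds the partitions in all n-tuples, over which the sum is a
  product of n geometric series.\<close>

lemma summable_on_partitions: "(\<lambda>lam. (1 / 2 :: real) ^ psize n lam) summable_on partitions n"
proof (rule nonneg_bdd_above_summable_on)
  show "bdd_above (sum (\<lambda>lam. (1 / 2 :: real) ^ psize n lam) ` {F. F \<subseteq> partitions n \<and> finite F})"
  proof (rule bdd_aboveI2)
    fix F assume F: "F \<in> {F. F \<subseteq> partitions n \<and> finite F}"
    define m where "m = (\<Sum>lam\<in>F. psize n lam)"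
    have le: "lam i \<le> m" if "lam \<in> F" "i \<in> {1..n}" for lam i
    proof -
      have "lam i \<le> psize n lam" unfolding psize_def using that by (intro member_le_sum) auto
      also have "\<dots> \<le> m" unfolding m_def using that F by (intro member_le_sum) auto
      finally show ?thesis .
    qed
    define r where "r = (\<lambda>lam::nat \<Rightarrow> nat. restrict lam {1..n})"
    have inj: "inj_on r F"
    proof (rule inj_onI)
      fix lam mu assume lm: "lam \<in> F" "mu \<in> F" "r lam = r mu"
      show "lam = mu"
      proof
        fix i show "lam i = mu i"
        proof (cases "i \<in> {1..n}")
          case True
          then show ?thesis using fun_cong[OF lm(3), of i] by (simp add: r_def)
        next
          case False
          then have "lam i = 0" "mu i = 0" using lm F unfolding partitions_def by blast+
          then show ?thesis by simp
        qed
      qed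
    qed
    have "(\<Sum>lam\<in>F. (1 / 2 :: real) ^ psize n lam) = (\<Sum>lam\<in>F. \<Prod>i\<in>{1..n}. (1/2) ^ r lam i)"
      by (simp add: psize_def power_sum r_def)
    also have "\<dots> = (\<Sum>f\<in>r ` F. \<Prod>i\<in>{1..n}. (1/2) ^ f i)" using inj by (simp add: sum.reindex)
    also have "\<dots> \<le> (\<Sum>f\<in>PiE {1..n} (\<lambda>_. {..m}). \<Prod>i\<in>{1..n}. (1/2) ^ f i)"
      by (rule sum_mono2) (auto simp: r_def finite_PiE le intro!: prod_nonneg)
    also have "\<dots> = (\<Prod>i\<in>{1..n}. \<Sum>j\<in>{..m}. (1/2) ^ j)"
      by (rule prod_sum_PiE[symmetric]) auto
    also have "\<dots> \<le> (\<Prod>i\<in>{1..n}. 2)"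
    proof (rule prod_mono)
      fix i
      have "(\<Sum>j\<le>m. (1/2::real) ^ j) = 2 - (1/2) ^ m" by (induction m) (auto simp: field_simps)
      then show "0 \<le> (\<Sum>j\<in>{..m}. (1/2::real) ^ j) \<and> (\<Sum>j\<in>{..m}. (1/2::real) ^ j) \<le> 2"
        using power_le_one[of "1/2::real" m] by (auto intro: sum_nonneg)
    qed
    finally show "(\<Sum>lam\<in>F. (1 / 2 :: real) ^ psize n lam) \<le> 2 ^ n" by simp
  qed
qed simp

lemma sums_by_size:
  fixes f :: "(nat \<Rightarrow> nat) \<Rightarrow> 'b::banach"
  assumes "f summable_on partitions n"
  shows "(\<lambda>k. \<Sum>lam\<in>parts n k. f lam) sums infsum f (partitions n)"
proof -
  have img: "snd ` Sigma UNIV (parts n) = partitions n" by (force simp: parts_def image_iff)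
  have inj: "inj_on snd (Sigma UNIV (parts n))" by (auto simp: inj_on_def parts_def)
  have "(f has_sum infsum f (partitions n)) (snd ` Sigma UNIV (parts n))"
    unfolding img using assms by (rule has_sum_infsum)
  then have "((f \<circ> snd) has_sum infsum f (partitions n)) (Sigma UNIV (parts n))"
    using has_sum_reindex[OF inj] by blast
  then have "((\<lambda>k. \<Sum>lam\<in>parts n k. f lam) has_sum infsum f (partitions n)) UNIV"
    by (rule has_sum_SigmaD) (auto simp: has_sum_finite)
  then show ?thesis by (rule has_sum_imp_sums)
qed

lemma summable_on_partitions_bound:
  fixes f :: "(nat \<Rightarrow> nat) \<Rightarrow> complex"
  assumes "\<And>lam. lam \<in> partitions n \<Longrightarrow> norm (f lam) \<le> B * (1 / 2) ^ psize n lam"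
  shows "f summable_on partitions n" "norm (infsum f (partitions n)) \<le> B * infsum (\<lambda>lam. (1 / 2) ^ psize n lam) (partitions n)"
proof -
  have s: "(\<lambda>lam. B * (1 / 2) ^ psize n lam) summable_on partitions n"
    using summable_on_partitions by (rule summable_on_cmult_right)
  have abs: "(\<lambda>lam. norm (f lam)) summable_on partitions n"
    by (rule summable_on_comparison_test[OF s]) (use assms in auto)
  then show "f summable_on partitions n" by (rule abs_summable_summable)
  have "norm (infsum f (partitions n)) \<le> infsum (\<lambda>lam. norm (f lam)) (partitions n)"
    using abs by (rule norm_infsum_bound)
  also have "\<dots> \<le> infsum (\<lambda>lam. B * (1 / 2) ^ psize n lam) (partitions n)"
    by (rule infsum_mono[OF abs s assms])
  also have "\<dots> = B * infsum (\<lambda>lam. (1 / 2) ^ psize n lam) (partitions n)"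
    by (rule infsum_cmult_right')
  finally show "norm (infsum f (partitions n)) \<le> B * infsum (\<lambda>lam. (1 / 2) ^ psize n lam) (partitions n)" .
qed

section \<open>Boxes of a partition\<close>

definition boxes :: "nat \<Rightarrow> (nat \<Rightarrow> nat) \<Rightarrow> (nat \<times> nat) set" where
  "boxes n lam = (SIGMA i:{1..n}. {..<lam i})"

lemma finite_boxes [simp]: "finite (boxes n lam)" by (simp add: boxes_def)

lemma sum_boxes: "(\<Sum>b\<in>boxes n lam. f b) = (\<Sum>i=1..n. \<Sum>j<lam i. f (i, j))"
  unfolding boxes_def by (subst sum.Sigma) auto

lemma prod_boxes: "(\<Prod>b\<in>boxes n lam. f b) = (\<Prod>i=1..n. \<Prod>j<lam i. f (i, j))"
  unfolding boxes_def by (subst prod.Sigma) auto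

lemma card_boxes: "card (boxes n lam) = psize n lam"
  by (simp add: boxes_def psize_def)

lemma prod_fact_le: "finite S \<Longrightarrow> (\<Prod>i\<in>S. fact (f i)) \<le> (fact (\<Sum>i\<in>S. f i) :: nat)"
proof (induction S rule: finite_induct)
  case (insert i S)
  have "fact (f i) * (\<Prod>i\<in>S. fact (f i)) \<le> fact (f i) * (fact (\<Sum>i\<in>S. f i) :: nat)"
    using insert by simp
  also have "\<dots> \<le> fact (f i + (\<Sum>i\<in>S. f i))"
    by (rule dvd_imp_le[OF fact_fact_dvd_fact]) simp
  finally show ?case using insert by simp
qed simp

lemma prod_boxes_fact_le: "(\<Prod>(i, j)\<in>boxes n lam. real (j + 1)) \<le> fact (psize n lam)"
proof -
  have f: "(\<Prod>j<m. real (j + 1)) = fact m" for m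
    by (induction m) (simp_all add: mult.commute)
  have "(\<Prod>(i, j)\<in>boxes n lam. real (j + 1)) = (\<Prod>i=1..n. fact (lam i))"
    unfolding prod_boxes by (simp only: f case_prod_conv)
  also have "\<dots> = real (\<Prod>i=1..n. fact (lam i))" by simp
  also have "\<dots> \<le> real (fact (psize n lam))"
    unfolding psize_def of_nat_le_iff by (rule prod_fact_le) simp
  finally show ?thesis by simp
qed

text \<open>For j at least 2 |z| + 1 the constant 1/2 works, and the finitely many remaining j give
  positive quotients.\<close>

lemma shifted_norm_lower_bound:
  fixes z :: complex
  assumes "z \<notin> \<int>\<^sub>\<le>\<^sub>0"
  shows "\<exists>e>0. \<forall>j. e * real (j + 1) \<le> norm (z + of_nat j)"
proof -
  define J where "J = nat \<lceil>2 * norm z + 1\<rceil>"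
  define S where "S = insert (1/2) ((\<lambda>j. norm (z + of_nat j) / real (j + 1)) ` {..<J})"
  define e where "e = Min S"
  have S: "finite S" "S \<noteq> {}" by (auto simp: S_def)
  have nz: "z + of_nat j \<noteq> 0" for j
  proof
    assume "z + of_nat j = 0"
    then have "z = - of_nat j" by (simp add: add_eq_0_iff2)
    then show False using assms by simp
  qed
  have "\<forall>s\<in>S. 0 < s" using nz by (auto simp: S_def intro!: divide_pos_pos)
  then have "e > 0" using Min_in[OF S] by (auto simp: e_def)
  moreover have "e * real (j + 1) \<le> norm (z + of_nat j)" for j
  proof (cases "j < J")
    case True
    then have "e \<le> norm (z + of_nat j) / real (j + 1)" unfolding e_def using S(1) by (intro Min_le) (auto simp: S_def)
    then show ?thesis by (simp add: pos_le_divide_eq)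
  next
    case False
    then have "2 * norm z + 1 \<le> real j" unfolding J_def by linarith
    moreover have "norm (of_nat j :: complex) \<le> norm (z + of_nat j) + norm z"
      using norm_triangle_ineq4[of "z + of_nat j" z] by simp
    moreover have "e \<le> 1/2" unfolding e_def using S(1) by (intro Min_le) (auto simp: S_def)
    then have "e * real (j + 1) \<le> 1/2 * real (j + 1)" by (rule mult_right_mono) simp
    moreover have "norm (of_nat j :: complex) = real j" by simp
    ultimately have "e * real (j + 1) \<le> 1/2 * real (j + 1)" "1/2 * real (j + 1) \<le> norm (z + of_nat j)"
      by simp_all
    then show ?thesis by (rule order_trans)
  qed
  ultimately show ?thesis by blast
qed

text \<open>At most J factors can exceed 1/2, and each of those costs at most 2 H relative to
  1/2.\<close>

lemma prod_eventually_small: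
  fixes q :: "nat \<Rightarrow> real"
  assumes "\<And>j. 0 \<le> q j" "\<And>j. q j \<le> H" "1 \<le> H" "\<And>j. J \<le> j \<Longrightarrow> q j \<le> 1/2"
  shows "(\<Prod>j<m. q j) \<le> (2 * H) ^ J * (1/2) ^ m"
proof -
  have "(\<Prod>j<m. q j) \<le> (2 * H) ^ min m J * (1/2) ^ m"
  proof (induction m)
    case (Suc m)
    have "(\<Prod>j<Suc m. q j) \<le> ((2 * H) ^ min m J * (1/2) ^ m) * q m"
      using Suc assms(1) by (simp add: mult_right_mono)
    also have "\<dots> \<le> ((2 * H) ^ min m J * (1/2) ^ m) * (if m < J then (2 * H) * (1/2) else 1/2)"
      using assms by (intro mult_left_mono) auto
    also have "\<dots> = (2 * H) ^ min (Suc m) J * (1/2) ^ Suc m"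
    proof (cases "m < J")
      case True
      then have "min m J = m" "min (Suc m) J = Suc m" by auto
      then show ?thesis using True by simp
    next
      case False
      then have "min m J = J" "min (Suc m) J = J" by auto
      then show ?thesis using False by simp
    qed
    finally show ?case .
  qed simp
  also have "\<dots> \<le> (2 * H) ^ J * (1/2) ^ m" using assms(3) by (intro mult_right_mono power_increasing) auto
  finally show ?thesis .
qed

context jack_param
begin

text \<open>A Pochhammer factor of a - N is -N (1 + w/N) with this w; the flag tells the factors of
  a and b apart.\<close>

definition wt :: "complex \<Rightarrow> complex \<Rightarrow> (nat \<times> nat) \<times> bool \<Rightarrow> complex" where
  "wt a b = (\<lambda>((i, j), t). - ((if t then a else b) - of_real (\<gamma> * (real i - 1)) + of_nat j))"

abbreviation bx :: "(nat \<Rightarrow> nat) \<Rightarrow> ((nat \<times> nat) \<times> bool) set" where "bx lam \<equiv> boxes n lam \<times> UNIV"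

text \<open>The signs cancel because each box carries two factors.\<close>

lemma gen_pochhammer_shift:
  assumes N: "N > 0"
  shows "gen_pochhammer n (1 / \<gamma>) (a - of_nat N) lam * gen_pochhammer n (1 / \<gamma>) (b - of_nat N) lam
    = (of_nat N)\<^sup>2 ^ psize n lam * (\<Prod>p\<in>bx lam. 1 + of_real (1 / real N) * wt a b p)"
proof -
  have gp: "gen_pochhammer n (1 / \<gamma>) d lam = (\<Prod>(i,j)\<in>boxes n lam. d - of_real (\<gamma> * (real i - 1)) + of_nat j)" for d
    unfolding gen_pochhammer_def prod_boxes by (simp add: pochhammer_prod atLeast0LessThan mult.commute)
  have "(\<Prod>p\<in>bx lam. 1 + of_real (1 / real N) * wt a b p) = (\<Prod>x\<in>boxes n lam. \<Prod>t\<in>UNIV. 1 + of_real (1 / real N) * wt a b (x, t))"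
    by (simp add: prod.cartesian_product case_prod_beta)
  then have "(of_nat N)\<^sup>2 ^ psize n lam * (\<Prod>p\<in>bx lam. 1 + of_real (1 / real N) * wt a b p)
    = (\<Prod>x\<in>boxes n lam. (of_nat N)\<^sup>2 * ((1 + of_real (1 / real N) * wt a b (x, True)) * (1 + of_real (1 / real N) * wt a b (x, False))))"
    unfolding card_boxes[symmetric] by (simp add: UNIV_bool prod.distrib mult_ac)
  also have "\<dots> = (\<Prod>(i,j)\<in>boxes n lam. (a - of_nat N - of_real (\<gamma> * (real i - 1)) + of_nat j) * (b - of_nat N - of_real (\<gamma> * (real i - 1)) + of_nat j))"
  proof (intro prod.cong refl, clarify)
    fix i j
    have wN: "of_nat N * (1 + of_real (1 / real N) * wt a b ((i, j), t)) = - ((if t then a else b) - of_nat N - of_real (\<gamma> * (real i - 1)) + of_nat j)" for t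
      using N by (simp add: wt_def field_simps)
    have nn: "(of_nat N)\<^sup>2 * (P * Q) = (of_nat N * P) * (of_nat N * Q)" for P Q :: complex
      by (simp add: power2_eq_square mult_ac)
    show "(of_nat N)\<^sup>2 * ((1 + of_real (1 / real N) * wt a b ((i, j), True)) * (1 + of_real (1 / real N) * wt a b ((i, j), False)))
      = (a - of_nat N - of_real (\<gamma> * (real i - 1)) + of_nat j) * (b - of_nat N - of_real (\<gamma> * (real i - 1)) + of_nat j)"
      by (simp only: nn wN if_True if_False minus_mult_minus)
  qed
  finally show ?thesis unfolding gp by (simp add: prod.distrib case_prod_beta)
qed

lemma sum_wt: "(\<Sum>p\<in>bx lam. wt a b p) = - ((a + b) * of_nat (psize n lam) + of_real (rho n (1 / \<gamma>) lam))"
proof -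
  have "(\<Sum>p\<in>bx lam. wt a b p) = (\<Sum>x\<in>boxes n lam. \<Sum>t\<in>UNIV. wt a b (x, t))"
    by (simp add: sum.cartesian_product case_prod_beta)
  also have "\<dots> = (\<Sum>i=1..n. \<Sum>j<lam i. - (a + b) + of_real (2 * \<gamma> * (real i - 1)) - 2 * of_nat j)"
    unfolding sum_boxes by (intro sum.cong refl) (simp add: UNIV_bool wt_def algebra_simps)
  also have "\<dots> = (\<Sum>i=1..n. - ((a + b) * of_nat (lam i)) - of_real (real (lam i) * (real (lam i) - 1 - 2 / (1 / \<gamma>) * (real i - 1))))"
  proof (intro sum.cong refl)
    fix i
    have g: "2 * (\<Sum>j<m. of_nat j) = (of_nat m * (of_nat m - 1) :: complex)" for m
      by (induction m) (auto simp: algebra_simps)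
    have "(\<Sum>j<lam i. - (a + b) + of_real (2 * \<gamma> * (real i - 1)) - 2 * of_nat j)
       = of_nat (lam i) * (- (a + b) + of_real (2 * \<gamma> * (real i - 1))) - 2 * (\<Sum>j<lam i. of_nat j)"
      by (simp add: sum_subtractf sum_distrib_left)
    then show "(\<Sum>j<lam i. - (a + b) + of_real (2 * \<gamma> * (real i - 1)) - 2 * of_nat j)
       = - ((a + b) * of_nat (lam i)) - of_real (real (lam i) * (real (lam i) - 1 - 2 / (1 / \<gamma>) * (real i - 1)))"
      unfolding g by (simp add: algebra_simps)
  qed
  also have "\<dots> = - ((a + b) * of_nat (psize n lam) + of_real (rho n (1 / \<gamma>) lam))"
    unfolding rho_def psize_def by (simp add: sum_subtractf sum_negf sum_distrib_left)
  finally show ?thesis .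
qed

lemma gp_lower_bound: "\<exists>e>0. \<forall>lam. e ^ psize n lam * (\<Prod>(i,j)\<in>boxes n lam. real (j + 1)) \<le> norm (gp lam)"
proof -
  have "\<forall>i\<in>{1..n}. \<exists>e>0. \<forall>j. e * real (j + 1) \<le> norm (c - of_real (\<gamma> * (real i - 1)) + of_nat j)"
    using shifted_norm_lower_bound[OF nonpole] by blast
  then obtain e where e: "\<And>i. i \<in> {1..n} \<Longrightarrow> e i > 0"
    "\<And>i j. i \<in> {1..n} \<Longrightarrow> e i * real (j + 1) \<le> norm (c - of_real (\<gamma> * (real i - 1)) + of_nat j)" by metis
  define d where "d = Min (insert 1 (e ` {1..n}))"
  have d: "d > 0" unfolding d_def using e(1) by (subst Min_gr_iff) auto
  have de: "d \<le> e i" if "i \<in> {1..n}" for i unfolding d_def using that by (intro Min_le) auto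
  have "d ^ psize n lam * (\<Prod>(i,j)\<in>boxes n lam. real (j + 1)) \<le> norm (gp lam)" for lam
  proof -
    have "d ^ psize n lam * (\<Prod>(i,j)\<in>boxes n lam. real (j + 1)) = (\<Prod>(i,j)\<in>boxes n lam. d * real (j + 1))"
      unfolding card_boxes[symmetric] by (simp add: prod.distrib case_prod_beta)
    also have "\<dots> \<le> (\<Prod>(i,j)\<in>boxes n lam. norm (c - of_real (\<gamma> * (real i - 1)) + of_nat j))"
    proof (rule prod_mono, clarify)
      fix i j assume "(i, j) \<in> boxes n lam"
      then have i: "i \<in> {1..n}" by (simp add: boxes_def)
      have "d * real (j + 1) \<le> e i * real (j + 1)" using de[OF i] by (intro mult_right_mono) auto
      then show "0 \<le> d * real (j + 1) \<and> d * real (j + 1) \<le> norm (c - of_real (\<gamma> * (real i - 1)) + of_nat j)"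
        using order_trans[OF _ e(2)[OF i, of j]] d by simp
    qed
    also have "\<dots> = norm (gp lam)"
      unfolding gen_pochhammer_def prod_boxes by (simp add: pochhammer_prod atLeast0LessThan mult.commute flip: prod_norm)
    finally show ?thesis .
  qed
  then show ?thesis using d by blast
qed

text \<open>In column j the two numerator factors grow like (1 + j/N0)^2, while \<open>gp\<close>
  and the factorial provide (j+1)^2 below. Each box thus contributes asymptotically a constant over
  N0^2, and a large N0 beats the geometric growth W.\<close>

lemma coefficient_bound:
  fixes W :: real
  shows "\<exists>N0>0. \<exists>B\<ge>0. \<forall>lam. (\<Prod>p\<in>bx lam. 1 + (1 / real N0) * norm (wt a b p)) * W ^ psize n lam / (norm (gp lam) * fact (psize n lam)) \<le> B * (1/2) ^ psize n lam"
proof -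
  define W' where "W' = max 1 \<bar>W\<bar>"
  obtain e where e: "e > 0" "\<And>lam. e ^ psize n lam * (\<Prod>(i,j)\<in>boxes n lam. real (j + 1)) \<le> norm (gp lam)"
    using gp_lower_bound by blast
  define A where "A = norm a + norm b + \<gamma> * real n"
  have A: "A \<ge> 0" unfolding A_def using gamma_pos by simp
  \<comment> \<open>By d^2 \<le> d \<le> e / (2 W') a box whose unsquared factor is at most d
    contributes at most 1/2. N0 and J supply d/2 each.\<close>
  define d where "d = min 1 (e / (2 * W'))"
  have W': "W' \<ge> 1" "\<bar>W\<bar> \<le> W'" by (auto simp: W'_def)
  have d: "d > 0" "d \<le> 1" "d \<le> e / (2 * W')" using e W' by (auto simp: d_def)
  define N0 where "N0 = nat \<lceil>max 1 (max A (2 / d))\<rceil>"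
  have "max 1 (max A (2 / d)) \<le> real N0" unfolding N0_def by linarith
  then have N0: "1 \<le> real N0" "A \<le> real N0" "2 / d \<le> real N0" by auto
  define J where "J = nat \<lceil>4 / d\<rceil>"
  have J: "4 / d \<le> real J" unfolding J_def by linarith
  define q where "q = (\<lambda>j::nat. W' / e * ((1 + (A + real j) / real N0) / real (j + 1))\<^sup>2)"
  \<comment> \<open>The 9 is (2 + 1)^2, the crude bound from \<open>base\<close> valid for all
    columns.\<close>
  define H where "H = max 1 (W' / e * 9)"
  have base: "0 \<le> (1 + (A + real j) / real N0) / real (j + 1)"
    "(1 + (A + real j) / real N0) / real (j + 1) \<le> 2 / real (j + 1) + 1 / real N0" for j
  proof -
    show "0 \<le> (1 + (A + real j) / real N0) / real (j + 1)" using A N0 by simp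
    have "1 + (A + real j) / real N0 \<le> 2 + real j / real N0" using N0 by (simp add: add_divide_distrib divide_le_eq_1)
    also have "\<dots> \<le> 2 + real (j + 1) / real N0" using N0 by (intro add_left_mono divide_right_mono) auto
    finally have "(1 + (A + real j) / real N0) / real (j + 1) \<le> (2 + real (j + 1) / real N0) / real (j + 1)"
      by (rule divide_right_mono) simp
    also have "(2 + real (j + 1) / real N0) / real (j + 1) = 2 / real (j + 1) + 1 / real N0"
      unfolding add_divide_distrib by (simp del: of_nat_add of_nat_Suc)
    finally show "(1 + (A + real j) / real N0) / real (j + 1) \<le> 2 / real (j + 1) + 1 / real N0" .
  qed
  have q0: "0 \<le> q j" for j unfolding q_def using W' e by (intro mult_nonneg_nonneg) auto
  have qH: "q j \<le> H" for j
  proof -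
    have "2 / real (j + 1) + 1 / real N0 \<le> 2 + 1" using N0 by (intro add_mono) (auto simp: divide_le_eq)
    then have "((1 + (A + real j) / real N0) / real (j + 1))\<^sup>2 \<le> 3\<^sup>2" using base[of j] by (intro power_mono) auto
    then have "q j \<le> W' / e * 9" unfolding q_def using W' e by (intro mult_left_mono) auto
    then show ?thesis by (simp add: H_def)
  qed
  have qJ: "q j \<le> 1/2" if "J \<le> j" for j
  proof -
    have j: "4 / d \<le> real (j + 1)" using J that by simp
    have "2 / real (j + 1) \<le> d / 2" using j d(1) by (simp add: field_simps)
    moreover have "1 / real N0 \<le> d / 2" using N0 d(1) by (simp add: field_simps)
    ultimately have le: "(1 + (A + real j) / real N0) / real (j + 1) \<le> d" using base(2)[of j] by simp
    have "((1 + (A + real j) / real N0) / real (j + 1))\<^sup>2 \<le> d\<^sup>2" using base(1)[of j] le by (intro power_mono) auto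
    also have "\<dots> \<le> d" using d by (simp add: power2_eq_square mult_le_cancel_right1)
    also have "\<dots> \<le> e / (2 * W')" by (rule d)
    finally have "q j \<le> W' / e * (e / (2 * W'))" unfolding q_def using W' e by (intro mult_left_mono) auto
    then show ?thesis using W' e by simp
  qed
  define B where "B = ((2 * H) ^ J) ^ n"
  have H1: "1 \<le> H" by (simp add: H_def)
  have "(\<Prod>p\<in>bx lam. 1 + (1 / real N0) * norm (wt a b p)) * W ^ psize n lam / (norm (gp lam) * fact (psize n lam)) \<le> B * (1/2) ^ psize n lam" for lam
  proof -
    define F where "F = (\<Prod>(i,j)\<in>boxes n lam. real (j + 1))"
    have F: "F > 0" unfolding F_def by (intro prod_pos) auto
    have den: "e ^ psize n lam * F * F \<le> norm (gp lam) * fact (psize n lam)"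
    proof (rule mult_mono)
      show "e ^ psize n lam * F \<le> norm (gp lam)" unfolding F_def by (rule e)
      show "F \<le> fact (psize n lam)" unfolding F_def by (rule prod_boxes_fact_le)
    qed (use F in auto)
    have "(\<Prod>p\<in>bx lam. 1 + (1 / real N0) * norm (wt a b p)) \<le> (\<Prod>x\<in>boxes n lam. \<Prod>t\<in>(UNIV::bool set). 1 + (A + real (snd x)) / real N0)"
      unfolding prod.cartesian_product
    proof (rule prod_mono)
      fix p assume "p \<in> bx lam"
      then obtain i j t where p: "p = ((i, j), t)" "(i, j) \<in> boxes n lam" by auto
      then have i: "1 \<le> i" "i \<le> n" by (auto simp: boxes_def)
      have "norm (wt a b ((i, j), t)) \<le> norm (if t then a else b) + norm (complex_of_real (\<gamma> * (real i - 1))) + norm (of_nat j :: complex)"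
        using norm_triangle_ineq[of "(if t then a else b) - of_real (\<gamma> * (real i - 1))" "of_nat j"]
          norm_triangle_ineq4[of "if t then a else b" "of_real (\<gamma> * (real i - 1))"]
        unfolding wt_def prod.case norm_minus_cancel by linarith
      also have "\<dots> \<le> (norm a + norm b) + \<gamma> * real n + real j"
        using i gamma_pos by (intro add_mono) (auto simp: abs_mult simp del: of_real_mult)
      finally have "norm (wt a b ((i, j), t)) \<le> A + real j" by (simp add: A_def)
      then show "0 \<le> 1 + 1 / real N0 * norm (wt a b p) \<and> 1 + 1 / real N0 * norm (wt a b p) \<le> (case p of (x, t) \<Rightarrow> 1 + (A + real (snd x)) / real N0)"
        by (simp add: p divide_right_mono)
    qed
    also have "\<dots> = (\<Prod>(i,j)\<in>boxes n lam. (1 + (A + real j) / real N0)\<^sup>2)"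
      by (simp add: case_prod_beta)
    finally have num: "(\<Prod>p\<in>bx lam. 1 + (1 / real N0) * norm (wt a b p)) \<le> \<dots>" .
    have Q0: "0 \<le> (\<Prod>(i,j)\<in>boxes n lam. (1 + (A + real j) / real N0)\<^sup>2)" by (intro prod_nonneg) auto
    have P0: "0 \<le> (\<Prod>p\<in>bx lam. 1 + (1 / real N0) * norm (wt a b p))" by (intro prod_nonneg) auto
    have Wp: "W ^ psize n lam \<le> W' ^ psize n lam"
      using power_mono[OF W'(2) abs_ge_zero] abs_ge_self[of "W ^ psize n lam"] unfolding power_abs by (rule order_trans[rotated])
    have "(\<Prod>p\<in>bx lam. 1 + (1 / real N0) * norm (wt a b p)) * W ^ psize n lam / (norm (gp lam) * fact (psize n lam))
      \<le> (\<Prod>p\<in>bx lam. 1 + (1 / real N0) * norm (wt a b p)) * W' ^ psize n lam / (norm (gp lam) * fact (psize n lam))"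
      using Wp P0 by (intro divide_right_mono mult_left_mono) auto
    also have "\<dots> \<le> (\<Prod>(i,j)\<in>boxes n lam. (1 + (A + real j) / real N0)\<^sup>2) * W' ^ psize n lam / (e ^ psize n lam * F * F)"
      using num den Q0 W' e F by (intro frac_le mult_right_mono mult_nonneg_nonneg) auto
    also have "\<dots> = (\<Prod>(i,j)\<in>boxes n lam. q j)"
      unfolding q_def F_def card_boxes[symmetric] power_divide
      by (simp add: prod.distrib prod_dividef case_prod_beta power2_eq_square mult_ac)
    also have "\<dots> = (\<Prod>i=1..n. \<Prod>j<lam i. q j)" by (simp add: prod_boxes)
    also have "\<dots> \<le> (\<Prod>i=1..n. (2 * H) ^ J * (1/2) ^ lam i)"
      by (intro prod_mono conjI prod_nonneg prod_eventually_small q0 qH qJ H1)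
    also have "\<dots> = B * (1/2) ^ psize n lam"
      by (simp add: prod.distrib B_def psize_def power_sum)
    finally show ?thesis .
  qed
  moreover have "0 < N0" using N0(1) by simp
  moreover have "0 \<le> B" using H1 by (simp add: B_def)
  ultimately show ?thesis by blast
qed

end

section \<open>Expansion of the hypergeometric series\<close>

lemma sum_le_prod_one_plus:
  fixes w :: "'i \<Rightarrow> real"
  assumes "finite I" "\<And>i. i \<in> I \<Longrightarrow> 0 \<le> w i"
  shows "1 + (\<Sum>i\<in>I. w i) \<le> (\<Prod>i\<in>I. 1 + w i)"
  using assms
proof (induction I rule: finite_induct)
  case (insert i I)
  have "0 \<le> w i * (\<Sum>i\<in>I. w i)" using insert.prems by (intro mult_nonneg_nonneg sum_nonneg) auto
  then have "1 + (w i + (\<Sum>i\<in>I. w i)) \<le> (1 + w i) * (1 + (\<Sum>i\<in>I. w i))" by (simp add: algebra_simps)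
  also have "\<dots> \<le> (1 + w i) * (\<Prod>i\<in>I. 1 + w i)" using insert by (intro mult_left_mono) auto
  finally show ?case using insert.hyps by simp
qed simp

context jack_param
begin

definition tau :: "(nat \<Rightarrow> nat) \<Rightarrow> complex ^ 'n::finite \<Rightarrow> complex" where
  "tau lam x = ev (Jl lam) x / (gp lam * fact (psize n lam))"

lemma hypergeom_0F1:
  fixes x :: "complex ^ 'n::finite"
  assumes n: "n = CARD('n)"
  shows "hypergeom (1 / \<gamma>) [] [c] x = infsum (\<lambda>lam. tau lam x) (partitions n)"
  unfolding hypergeom_def n[symmetric]
  by (rule infsum_cong) (simp only: tau_def, simp add: jack_C_eq n)

text \<open>Homogeneity turns the argument x/N^2 into the factor N^(-2|lam|), which cancels the
  powers of N from \<open>gen_pochhammer_shift\<close>.\<close>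

lemma hypergeom_2F1:
  fixes x :: "complex ^ 'n::finite"
  assumes n: "n = CARD('n)" and N: "N > 0"
  shows "hypergeom (1 / \<gamma>) [a - of_nat N, b - of_nat N] [c] ((1 / (real N)\<^sup>2) *\<^sub>R x)
    = infsum (\<lambda>lam. (\<Prod>p\<in>bx lam. 1 + of_real (1 / real N) * wt a b p) * tau lam x) (partitions n)"
  unfolding hypergeom_def n[symmetric]
proof (rule infsum_cong)
  fix lam assume lam: "lam \<in> partitions n"
  then have p: "lam \<in> parts CARD('n) (psize n lam)" by (simp add: parts_def n)
  define P where "P = (\<Prod>p\<in>bx lam. 1 + of_real (1 / real N) * wt a b p)"
  have J: "jack_C (1 / \<gamma>) lam ((1 / (real N)\<^sup>2) *\<^sub>R x) = (1 / (of_nat N)\<^sup>2) ^ psize n lam * ev (Jl lam) x"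
    using lam by (simp add: jack_C_eq n ev_scale[OF homi_Jl[OF p], unfolded n])
  have "(\<Prod>a\<leftarrow>[a - of_nat N, b - of_nat N]. gen_pochhammer n (1 / \<gamma>) a lam) = (of_nat N)\<^sup>2 ^ psize n lam * P"
    using gen_pochhammer_shift[OF N, of a lam b] by (simp add: P_def)
  moreover have "(of_nat N)\<^sup>2 ^ psize n lam * (1 / (of_nat N)\<^sup>2) ^ psize n lam = (1 :: complex)"
    unfolding power_mult_distrib[symmetric] using N by simp
  ultimately show "(\<Prod>a\<leftarrow>[a - of_nat N, b - of_nat N]. gen_pochhammer n (1 / \<gamma>) a lam) /
      ((\<Prod>b\<leftarrow>[c]. gen_pochhammer n (1 / \<gamma>) b lam) * fact (psize n lam)) * jack_C (1 / \<gamma>) lam ((1 / (real N)\<^sup>2) *\<^sub>R x) = P * tau lam x"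
    unfolding J tau_def by (simp add: mult.assoc mult.left_commute[of P])
qed

text \<open>One N0 and one B serve the whole polydisc of radius R, which is the source of uniformity
  on compact sets.\<close>

lemma tau_bound:
  assumes n: "n = CARD('n::finite)" and R: "R \<ge> 0"
  shows "\<exists>N0>0. \<exists>B\<ge>0. \<forall>lam\<in>partitions n. \<forall>x::complex ^ 'n. (\<forall>i. norm (x $ i) \<le> R) \<longrightarrow>
    (\<Prod>p\<in>bx lam. 1 + (1 / real N0) * norm (wt a b p)) * norm (tau lam x) \<le> B * (1/2) ^ psize n lam"
proof -
  define W where "W = bern TYPE('n) * R * real CARD('n)"
  obtain N0 B where N0: "N0 > 0" "B \<ge> 0" and B: "\<And>lam. (\<Prod>p\<in>bx lam. 1 + (1 / real N0) * norm (wt a b p)) * W ^ psize n lam / (norm (gp lam) * fact (psize n lam)) \<le> B * (1/2) ^ psize n lam"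
    using coefficient_bound[of a b W] by blast
  have "(\<Prod>p\<in>bx lam. 1 + (1 / real N0) * norm (wt a b p)) * norm (tau lam x) \<le> B * (1/2) ^ psize n lam"
    if lam: "lam \<in> partitions n" and x: "\<forall>i. norm (x $ i) \<le> R" for lam and x :: "complex ^ 'n"
  proof -
    have p: "lam \<in> parts CARD('n) (psize n lam)" using lam by (simp add: parts_def n)
    have "norm (ev (Jl lam) x) \<le> W ^ psize n lam" unfolding W_def by (rule Jl_bound[OF p _ R]) (use x in blast)
    then have "norm (tau lam x) \<le> W ^ psize n lam / (norm (gp lam) * fact (psize n lam))"
      unfolding tau_def norm_divide norm_mult norm_fact by (rule divide_right_mono) simp
    then have "(\<Prod>p\<in>bx lam. 1 + (1 / real N0) * norm (wt a b p)) * norm (tau lam x)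
      \<le> (\<Prod>p\<in>bx lam. 1 + (1 / real N0) * norm (wt a b p)) * (W ^ psize n lam / (norm (gp lam) * fact (psize n lam)))"
      by (rule mult_left_mono) (auto intro!: prod_nonneg)
    then show ?thesis using B[of lam] by simp
  qed
  then show ?thesis using N0 by blast
qed

lemma coordinate_bound: "\<exists>R\<ge>0. \<forall>i. norm (x $ i) \<le> R" for x :: "complex ^ 'n::finite"
  by (rule exI[of _ "\<Sum>i\<in>UNIV. norm (x $ i)"]) (auto intro: sum_nonneg member_le_sum)

lemma one_le_prod_wt: "1 \<le> (\<Prod>p\<in>bx lam. 1 + (1 / real N0) * norm (wt a b p))"
  by (intro prod_ge_1) simp

lemma tau_summable:
  fixes x :: "complex ^ 'n::finite"
  assumes n: "n = CARD('n)"
  shows "(\<lambda>lam. tau lam x) summable_on partitions n"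
    and "(\<lambda>lam. (\<Sum>p\<in>bx lam. wt a b p) * tau lam x) summable_on partitions n"
proof -
  obtain R where R: "R \<ge> 0" "\<forall>i. norm (x $ i) \<le> R" using coordinate_bound by blast
  obtain N0 B where N0: "N0 > 0" "B \<ge> 0" and B: "\<And>lam. lam \<in> partitions n \<Longrightarrow>
    (\<Prod>p\<in>bx lam. 1 + (1 / real N0) * norm (wt a b p)) * norm (tau lam x) \<le> B * (1/2) ^ psize n lam"
    using tau_bound[OF n R(1), of a b] R(2) by blast
  show "(\<lambda>lam. tau lam x) summable_on partitions n"
  proof (rule summable_on_partitions_bound)
    fix lam assume "lam \<in> partitions n"
    from B[OF this] show "norm (tau lam x) \<le> B * (1/2) ^ psize n lam"
      using mult_right_mono[OF one_le_prod_wt[of N0 a b lam], of "norm (tau lam x)"] by simp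
  qed
  show "(\<lambda>lam. (\<Sum>p\<in>bx lam. wt a b p) * tau lam x) summable_on partitions n"
  proof (rule summable_on_partitions_bound[where B = "real N0 * B"])
    fix lam assume lam: "lam \<in> partitions n"
    define P where "P = (\<Prod>p\<in>bx lam. 1 + (1 / real N0) * norm (wt a b p))"
    \<comment> \<open>A sum of nonnegative numbers is at most the product of 1 plus each of them, so
      the linear term obeys the same bound up to N0.\<close>
    have "(1 / real N0) * (\<Sum>p\<in>bx lam. norm (wt a b p)) \<le> P"
      unfolding P_def sum_distrib_left using sum_le_prod_one_plus[of "bx lam" "\<lambda>p. (1 / real N0) * norm (wt a b p)"] by simp
    then have "(\<Sum>p\<in>bx lam. norm (wt a b p)) \<le> real N0 * P" using N0(1) by (simp add: field_simps)
    then have "norm (\<Sum>p\<in>bx lam. wt a b p) \<le> real N0 * P" using norm_sum order_trans by blast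
    then have "norm ((\<Sum>p\<in>bx lam. wt a b p) * tau lam x) \<le> (real N0 * P) * norm (tau lam x)"
      unfolding norm_mult by (rule mult_right_mono) simp
    also have "\<dots> \<le> real N0 * (B * (1/2) ^ psize n lam)"
      unfolding mult.assoc using B[OF lam] by (intro mult_left_mono) (auto simp: P_def)
    finally show "norm ((\<Sum>p\<in>bx lam. wt a b p) * tau lam x) \<le> real N0 * B * (1/2) ^ psize n lam" by (simp add: mult.assoc)
  qed
qed

lemma tau_summable_rho:
  fixes x :: "complex ^ 'n::finite"
  assumes n: "n = CARD('n)"
  shows "(\<lambda>lam. of_real (rho n (1 / \<gamma>) lam) * tau lam x) summable_on partitions n"
    and "(\<lambda>lam. of_nat (psize n lam) * tau lam x) summable_on partitions n"
proof -
  \<comment> \<open>By \<open>sum_wt\<close> the weights for (0, 0) sum to -rho, and subtracting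
    those for (1, 0) isolates |lam|.\<close>
  have 1: "(\<lambda>lam. - ((\<Sum>p\<in>bx lam. wt 0 0 p) * tau lam x)) summable_on partitions n"
    using summable_on_cmult_right[OF tau_summable(2)[OF n, of 0 0 x], of "-1"] by simp
  then show "(\<lambda>lam. of_real (rho n (1 / \<gamma>) lam) * tau lam x) summable_on partitions n"
    by (simp add: sum_wt)
  have "(\<lambda>lam. (\<Sum>p\<in>bx lam. wt 0 0 p) * tau lam x + (-1) * ((\<Sum>p\<in>bx lam. wt 1 0 p) * tau lam x)) summable_on partitions n"
    by (intro summable_on_add summable_on_cmult_right tau_summable n)
  then show "(\<lambda>lam. of_nat (psize n lam) * tau lam x) summable_on partitions n"
    by (simp add: sum_wt algebra_simps)
qed

definition FF :: "nat \<Rightarrow> 'n::finite pol" where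
  "FF k = (\<Sum>lam\<in>parts n k. CC (1 / (gp lam * fact k)) * Jl lam)"

lemma ev_FF: "ev (FF k) x = (\<Sum>lam\<in>parts n k. tau lam x)"
  by (simp add: FF_def tau_def parts_def)

lemma homi_FF: "n = CARD('n::finite) \<Longrightarrow> homi k (FF k :: 'n pol)"
  unfolding FF_def by (intro homi_sum homi_scale homi_Jl) simp

text \<open>The degrees are compared separately: in degree k + 1 this is \<open>Jl_diff_eq\<close>
  divided by (k+1)!, and the degree 0 term on the right vanishes.\<close>

lemma p1_0F1:
  fixes x :: "complex ^ 'n::finite"
  assumes n: "n = CARD('n)"
  shows "p1 x * hypergeom (1 / \<gamma>) [] [c] x =
    infsum (\<lambda>lam. (of_real (rho n (1 / \<gamma>) lam) + c * of_nat (psize n lam)) * tau lam x) (partitions n)"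
proof -
  define f where "f = (\<lambda>lam. (of_real (rho n (1 / \<gamma>) lam) + c * of_nat (psize n lam)) * tau lam x)"
  have "(\<lambda>lam. of_real (rho n (1 / \<gamma>) lam) * tau lam x + c * (of_nat (psize n lam) * tau lam x)) summable_on partitions n"
    by (intro summable_on_add summable_on_cmult_right tau_summable_rho n)
  then have "f summable_on partitions n" by (simp add: f_def algebra_simps)
  then have s: "(\<lambda>k. \<Sum>lam\<in>parts n k. f lam) sums infsum f (partitions n)" by (rule sums_by_size)
  have "(\<Sum>lam\<in>parts n (Suc k). f lam) = p1 x * ev (FF k) x" for k
  proof -
    have "(\<Sum>lam\<in>parts n (Suc k). f lam) = (\<Sum>lam\<in>parts n (Suc k). (of_real (rho n (1 / \<gamma>) lam) + c * of_nat (Suc k)) / gp lam * ev (Jl lam) x) / fact (Suc k)"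
      unfolding sum_divide_distrib by (intro sum.cong refl) (simp add: f_def tau_def parts_def)
    also have "(\<Sum>lam\<in>parts n (Suc k). (of_real (rho n (1 / \<gamma>) lam) + c * of_nat (Suc k)) / gp lam * ev (Jl lam) x)
      = of_nat (Suc k) * (p1 x * (\<Sum>mu\<in>parts n k. 1 / gp mu * ev (Jl mu) x))"
      using arg_cong[OF Jl_diff_eq[of c k, where 'n='n], of "\<lambda>p. ev p x"] nonpole
      by (simp add: n ev_p1p del: of_nat_Suc)
    also have "\<dots> / fact (Suc k) = p1 x * ((\<Sum>mu\<in>parts n k. 1 / gp mu * ev (Jl mu) x) / fact k)"
      unfolding fact_Suc by (simp del: of_nat_Suc)
    also have "(\<Sum>mu\<in>parts n k. 1 / gp mu * ev (Jl mu) x) / fact k = ev (FF k) x"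
      unfolding sum_divide_distrib ev_FF by (intro sum.cong refl) (simp add: tau_def parts_def)
    finally show ?thesis .
  qed
  moreover have "(\<Sum>lam\<in>parts n 0. f lam) = 0"
  proof (rule sum.neutral, rule ballI)
    fix lam assume "lam \<in> parts n 0"
    then have "psize n lam = 0" by (simp add: parts_def)
    moreover from this have "\<And>i. i \<in> {1..n} \<Longrightarrow> lam i = 0" by (simp add: psize_def)
    then have "rho n (1 / \<gamma>) lam = 0" unfolding rho_def by (intro sum.neutral) auto
    ultimately show "f lam = 0" by (simp add: f_def)
  qed
  ultimately have "(\<lambda>k. p1 x * ev (FF k) x) sums infsum f (partitions n)"
    using s sums_Suc_iff[of "\<lambda>k. \<Sum>lam\<in>parts n k. f lam" "infsum f (partitions n)"] by simp
  moreover have "(\<lambda>k. p1 x * ev (FF k) x) sums (p1 x * hypergeom (1 / \<gamma>) [] [c] x)"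
    unfolding ev_FF hypergeom_0F1[OF n] by (intro sums_mult sums_by_size tau_summable n)
  ultimately show ?thesis unfolding f_def by (rule sums_unique2[symmetric])
qed

lemma E1_0F1:
  fixes x :: "complex ^ 'n::finite"
  assumes n: "n = CARD('n)"
  shows "E1 (hypergeom (1 / \<gamma>) [] [c]) x = infsum (\<lambda>lam. of_nat (psize n lam) * tau lam x) (partitions n)"
proof -
  define F where "F = (hypergeom (1 / \<gamma>) [] [c] :: complex ^ 'n \<Rightarrow> complex)"
  have Fsums: "(\<lambda>k. ev (FF k) y) sums F y" for y :: "complex ^ 'n"
    unfolding ev_FF F_def hypergeom_0F1[OF n] by (intro sums_by_size tau_summable n)
  obtain R0 where R0: "R0 \<ge> 0" "\<forall>i. norm (x $ i) \<le> R0" using coordinate_bound by blast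
  \<comment> \<open>Room for moving one coordinate within the unit disc when
    differentiating.\<close>
  have R: "R0 + 1 \<ge> 0" using R0 by simp
  obtain N0 B where N0: "N0 > 0" "B \<ge> 0" and B: "\<And>lam y. lam \<in> partitions n \<Longrightarrow> \<forall>i. norm (y $ i) \<le> R0 + 1 \<Longrightarrow>
    (\<Prod>p\<in>bx lam. 1 + (1 / real N0) * norm (wt 0 0 p)) * norm (tau lam (y :: complex ^ 'n)) \<le> B * (1/2) ^ psize n lam"
    using tau_bound[OF n R, of 0 0] by blast
  define h where "h = (\<lambda>k. \<Sum>lam\<in>parts n k. B * (1/2 :: real) ^ psize n lam)"
  have h: "summable h"
    unfolding h_def using sums_by_size[OF summable_on_cmult_right[OF summable_on_partitions]] by (rule sums_summable)
  have h0: "0 \<le> h k" for k unfolding h_def using N0 by (intro sum_nonneg) auto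
  have bound: "norm (ev (FF k) y) \<le> h k" if "\<forall>i. norm (y $ i) \<le> R0 + 1" for k and y :: "complex ^ 'n"
    unfolding ev_FF h_def
  proof (rule order_trans[OF norm_sum sum_mono])
    fix lam assume "lam \<in> parts n k"
    then have "lam \<in> partitions n" by (simp add: parts_def)
    from B[OF this that] show "norm (tau lam y) \<le> B * (1/2) ^ psize n lam"
      using mult_right_mono[OF one_le_prod_wt[of N0 0 0 lam], of "norm (tau lam y)"] by simp
  qed
  have part: "(\<lambda>k. ev (dd i (FF k)) x) sums partial i F x" for i
  proof -
    have der: "((\<lambda>t. ev (FF k) (x + axis i t)) has_field_derivative ev (dd i (FF k)) (x + axis i t)) (at t)" for k t
    proof -
      have "((\<lambda>s. ev (FF k) ((x + axis i t) + axis i s)) has_field_derivative ev (dd i (FF k)) (x + axis i t)) (at (t - t))"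
        using dd_deriv[of "FF k" "x + axis i t" i] by simp
      then have "((\<lambda>s. ev (FF k) ((x + axis i t) + axis i (s - t))) has_field_derivative ev (dd i (FF k)) (x + axis i t)) (at t)"
        using DERIV_shift[of "\<lambda>s. ev (FF k) ((x + axis i t) + axis i s)" _ t "- t"] by simp
      moreover have "(x + axis i t) + axis i (s - t) = x + axis i s" for s by (simp add: vec_eq_iff axis_def)
      ultimately show ?thesis by simp
    qed
    \<comment> \<open>The terms are entire in t, so a summable majorant of the functions themselves
      justifies termwise differentiation.\<close>
    have "\<exists>g g'. \<forall>t\<in>ball 0 1. ((\<lambda>k. ev (FF k) (x + axis i t)) sums g t) \<and>
        ((\<lambda>k. ev (dd i (FF k)) (x + axis i t)) sums g' t) \<and> (g has_field_derivative g' t) (at t)"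
    proof (rule series_and_derivative_comparison_complex[OF open_ball der])
      fix t :: complex
      show "\<exists>d h. 0 < d \<and> summable h \<and> range h \<subseteq> \<real>\<^sub>\<ge>\<^sub>0 \<and>
        (\<forall>\<^sub>F k in sequentially. \<forall>y\<in>ball t d \<inter> ball 0 1. cmod (ev (FF k) (x + axis i y)) \<le> cmod (h k))"
      proof (intro exI conjI)
        show "0 < (1::real)" by simp
        show "summable (\<lambda>k. complex_of_real (h k))" using h by (rule summable_of_real)
        show "range (\<lambda>k. complex_of_real (h k)) \<subseteq> \<real>\<^sub>\<ge>\<^sub>0" using h0 by auto
        have "norm (ev (FF k) (x + axis i y)) \<le> norm (complex_of_real (h k))" if "y \<in> ball 0 1" for k y
        proof -
          have "norm ((x + axis i y) $ j) \<le> R0 + 1" for j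
          proof -
            have "norm (axis i y $ j) \<le> 1" using that by (auto simp: axis_def)
            then show ?thesis using norm_triangle_ineq[of "x $ j" "axis i y $ j"] R0(2) by (simp add: add_mono order_trans)
          qed
          then show ?thesis using bound[of "x + axis i y" k] h0[of k] by simp
        qed
        then show "\<forall>\<^sub>F k in sequentially. \<forall>y\<in>ball t 1 \<inter> ball 0 1. cmod (ev (FF k) (x + axis i y)) \<le> cmod (complex_of_real (h k))"
          by simp
      qed
    qed
    then obtain g g' where g: "\<And>t. t \<in> ball 0 1 \<Longrightarrow> (\<lambda>k. ev (FF k) (x + axis i t)) sums g t"
      "\<And>t. t \<in> ball 0 1 \<Longrightarrow> (\<lambda>k. ev (dd i (FF k)) (x + axis i t)) sums g' t"
      "\<And>t. t \<in> ball 0 1 \<Longrightarrow> (g has_field_derivative g' t) (at t)" by blast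
    have gF: "g t = F (x + axis i t)" if "t \<in> ball 0 1" for t
      using sums_unique2[OF g(1)[OF that] Fsums] .
    have "(g has_field_derivative g' 0) (at 0)" by (rule g(3)) simp
    then have "((\<lambda>t. F (x + axis i t)) has_field_derivative g' 0) (at 0)"
      by (rule has_field_derivative_transform_within_open[OF _ open_ball, of _ _ _ 0 1]) (auto simp: gF)
    then have "partial i F x = g' 0" unfolding partial_def by (rule DERIV_imp_deriv)
    moreover have "x + axis i 0 = x" by (simp add: vec_eq_iff axis_def)
    ultimately show ?thesis using g(2)[of 0] by (simp only:) simp
  qed
  have "(\<lambda>k. \<Sum>i\<in>UNIV. x $ i * ev (dd i (FF k)) x) sums E1 F x"
    unfolding E1_def by (intro sums_sum sums_mult part)
  moreover have "(\<Sum>i\<in>UNIV. x $ i * ev (dd i (FF k)) x) = (\<Sum>lam\<in>parts n k. of_nat (psize n lam) * tau lam x)" for k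
  proof -
    have "(\<Sum>i\<in>UNIV. x $ i * ev (dd i (FF k)) x) = of_nat k * ev (FF k) x"
      using arg_cong[OF euler_identity[OF homi_FF[OF n, of k]], of "\<lambda>p. ev p x"] by simp
    also have "\<dots> = (\<Sum>lam\<in>parts n k. of_nat (psize n lam) * tau lam x)"
      unfolding ev_FF sum_distrib_left by (intro sum.cong refl) (simp add: parts_def)
    finally show ?thesis .
  qed
  ultimately have "(\<lambda>k. \<Sum>lam\<in>parts n k. of_nat (psize n lam) * tau lam x) sums E1 F x" by simp
  moreover have "(\<lambda>k. \<Sum>lam\<in>parts n k. of_nat (psize n lam) * tau lam x) sums infsum (\<lambda>lam. of_nat (psize n lam) * tau lam x) (partitions n)"
    by (intro sums_by_size tau_summable_rho n)
  ultimately show ?thesis unfolding F_def by (rule sums_unique2)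
qed

lemma hypergeom_expansion:
  fixes K :: "(complex ^ 'n::finite) set"
  assumes n: "n = CARD('n)" and K: "compact K"
  shows "\<exists>B::real. \<forall>\<^sub>F N in sequentially. \<forall>x\<in>K.
    norm (hypergeom (1 / \<gamma>) [a - of_nat N, b - of_nat N] [c] ((1 / (real N)\<^sup>2) *\<^sub>R x)
          - (hypergeom (1 / \<gamma>) [] [c] x
             + 1 / of_nat N * (c - a - b) * E1 (hypergeom (1 / \<gamma>) [] [c]) x
             - 1 / of_nat N * p1 x * hypergeom (1 / \<gamma>) [] [c] x))
    \<le> B / (real N)\<^sup>2"
proof -
  obtain R where R: "R \<ge> 0" "\<And>x. x \<in> K \<Longrightarrow> norm x \<le> R"
    using compact_imp_bounded[OF K] unfolding bounded_iff by (metis norm_ge_zero order_trans linear)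
  obtain N0 B where N0: "N0 > 0" "B \<ge> 0" and B: "\<And>lam x. lam \<in> partitions n \<Longrightarrow> \<forall>i. norm (x $ i) \<le> R \<Longrightarrow>
    (\<Prod>p\<in>bx lam. 1 + (1 / real N0) * norm (wt a b p)) * norm (tau lam (x :: complex ^ 'n)) \<le> B * (1/2) ^ psize n lam"
    using tau_bound[OF n R(1), of a b] by blast
  define S where "S = infsum (\<lambda>lam. (1 / 2 :: real) ^ psize n lam) (partitions n)"
  have "norm (hypergeom (1 / \<gamma>) [a - of_nat N, b - of_nat N] [c] ((1 / (real N)\<^sup>2) *\<^sub>R x)
          - (hypergeom (1 / \<gamma>) [] [c] x
             + 1 / of_nat N * (c - a - b) * E1 (hypergeom (1 / \<gamma>) [] [c]) x
             - 1 / of_nat N * p1 x * hypergeom (1 / \<gamma>) [] [c] x))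
    \<le> ((real N0)\<^sup>2 * B * S) / (real N)\<^sup>2" if N: "N0 \<le> N" and x: "x \<in> K" for N x
  proof -
    have N': "N > 0" using N N0 by simp
    have xR: "\<forall>i. norm (x $ i) \<le> R" using R(2)[OF x] Finite_Cartesian_Product.norm_nth_le[of x] by (meson order_trans)
    define s where "s = 1 / real N"
    define P where "P = (\<lambda>lam. \<Prod>p\<in>bx lam. 1 + complex_of_real s * wt a b p)"
    define Q where "Q = (\<lambda>lam. \<Sum>p\<in>bx lam. wt a b p)"
    \<comment> \<open>The terms of the error after removing the constant and linear parts in s =
      1/N; \<open>prod_second_order\<close> with s0 = 1/N0 bounds them by multiples of s^2.\<close>
    define D where "D = (\<lambda>lam. (P lam - 1 - of_real s * Q lam) * tau lam x)"
    have Dle: "norm (D lam) \<le> ((real N0 * s)\<^sup>2 * B) * (1/2) ^ psize n lam" if lam: "lam \<in> partitions n" for lam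
    proof -
      have "norm (P lam - 1 - of_real s * Q lam) \<le> (s / (1 / real N0))\<^sup>2 * (\<Prod>p\<in>bx lam. 1 + (1 / real N0) * norm (wt a b p))"
        unfolding P_def Q_def using N N0 by (intro prod_second_order) (auto simp: s_def frac_le)
      then have "norm (D lam) \<le> (s / (1 / real N0))\<^sup>2 * (\<Prod>p\<in>bx lam. 1 + (1 / real N0) * norm (wt a b p)) * norm (tau lam x)"
        unfolding D_def norm_mult by (rule mult_right_mono) simp
      also have "\<dots> \<le> (s / (1 / real N0))\<^sup>2 * (B * (1/2) ^ psize n lam)"
        unfolding mult.assoc by (rule mult_left_mono[OF B[OF lam xR]]) simp
      finally show ?thesis by (simp add: mult_ac)
    qed
    note Dsum = summable_on_partitions_bound[OF Dle]
    have tausum: "(\<lambda>lam. tau lam x) summable_on partitions n" "(\<lambda>lam. Q lam * tau lam x) summable_on partitions n"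
      unfolding Q_def by (intro tau_summable n)+
    have lin: "(\<lambda>lam. tau lam x + of_real s * (Q lam * tau lam x)) summable_on partitions n"
      by (intro summable_on_add summable_on_cmult_right tausum)
    have "infsum (\<lambda>lam. P lam * tau lam x) (partitions n) = infsum (\<lambda>lam. D lam + (tau lam x + of_real s * (Q lam * tau lam x))) (partitions n)"
      by (rule infsum_cong) (simp add: D_def algebra_simps)
    also have "\<dots> = infsum D (partitions n) + infsum (\<lambda>lam. tau lam x + of_real s * (Q lam * tau lam x)) (partitions n)"
      by (rule infsum_add[OF Dsum(1) lin])
    also have "infsum (\<lambda>lam. tau lam x + of_real s * (Q lam * tau lam x)) (partitions n)
      = infsum (\<lambda>lam. tau lam x) (partitions n) + of_real s * infsum (\<lambda>lam. Q lam * tau lam x) (partitions n)"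
      by (subst infsum_add) (auto intro: tausum summable_on_cmult_right simp: infsum_cmult_right')
    \<comment> \<open>The weights sum to -(a+b)|lam| - rho = (c-a-b)|lam| - (rho + c|lam|), which
      splits into the Euler term and the term with p_1.\<close>
    also have "infsum (\<lambda>lam. Q lam * tau lam x) (partitions n) = infsum (\<lambda>lam. (c - a - b) * (of_nat (psize n lam) * tau lam x)
       + (-1) * ((of_real (rho n (1 / \<gamma>) lam) + c * of_nat (psize n lam)) * tau lam x)) (partitions n)"
      unfolding Q_def sum_wt by (rule infsum_cong) (simp add: algebra_simps)
    also have "\<dots> = (c - a - b) * infsum (\<lambda>lam. of_nat (psize n lam) * tau lam x) (partitions n)
       - infsum (\<lambda>lam. (of_real (rho n (1 / \<gamma>) lam) + c * of_nat (psize n lam)) * tau lam x) (partitions n)"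
    proof -
      have "(\<lambda>lam. of_real (rho n (1 / \<gamma>) lam) * tau lam x + c * (of_nat (psize n lam) * tau lam x)) summable_on partitions n"
        by (intro summable_on_add summable_on_cmult_right tau_summable_rho n)
      then have "(\<lambda>lam. (of_real (rho n (1 / \<gamma>) lam) + c * of_nat (psize n lam)) * tau lam x) summable_on partitions n"
        by (simp add: algebra_simps)
      then show ?thesis
        by (subst infsum_add[OF summable_on_cmult_right[OF tau_summable_rho(2)[OF n]] summable_on_cmult_right])
          (simp_all only: infsum_cmult_right' mult_minus1 infsum_uminus add_uminus_conv_diff)
    qed
    finally have "infsum (\<lambda>lam. P lam * tau lam x) (partitions n) = infsum D (partitions n) +
      (hypergeom (1 / \<gamma>) [] [c] x + of_real s * ((c - a - b) * E1 (hypergeom (1 / \<gamma>) [] [c]) x - p1 x * hypergeom (1 / \<gamma>) [] [c] x))"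
      unfolding E1_0F1[OF n] p1_0F1[OF n] unfolding hypergeom_0F1[OF n] .
    moreover have "hypergeom (1 / \<gamma>) [a - of_nat N, b - of_nat N] [c] ((1 / (real N)\<^sup>2) *\<^sub>R x) = infsum (\<lambda>lam. P lam * tau lam x) (partitions n)"
      unfolding hypergeom_2F1[OF n N'] P_def s_def ..
    moreover have "1 / of_nat N = complex_of_real s" by (simp add: s_def)
    ultimately have "hypergeom (1 / \<gamma>) [a - of_nat N, b - of_nat N] [c] ((1 / (real N)\<^sup>2) *\<^sub>R x)
          - (hypergeom (1 / \<gamma>) [] [c] x
             + 1 / of_nat N * (c - a - b) * E1 (hypergeom (1 / \<gamma>) [] [c]) x
             - 1 / of_nat N * p1 x * hypergeom (1 / \<gamma>) [] [c] x) = infsum D (partitions n)"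
      by (simp only:) (simp add: algebra_simps)
    moreover have "norm (infsum D (partitions n)) \<le> (real N0 * s)\<^sup>2 * B * S" unfolding S_def by (rule Dsum(2))
    ultimately show ?thesis by (simp add: s_def power_divide)
  qed
  then show ?thesis by (intro exI[of _ "(real N0)\<^sup>2 * B * S"] eventually_mono[OF eventually_ge_at_top[of N0]] ballI)
qed

end

theorem theorem4p1:
  fixes a b c :: complex and \<sigma> :: real and K :: "(complex ^ 'n::finite) set"
  assumes "\<sigma> > 0"
    and "\<And>i. i \<in> {1..CARD('n)} \<Longrightarrow> c - of_real ((real i - 1) / \<sigma>) \<notin> \<int>\<^sub>\<le>\<^sub>0"
    and "compact K"
  shows "\<exists>B::real. \<forall>\<^sub>F N in sequentially. \<forall>x\<in>K.
    norm (hypergeom \<sigma> [a - of_nat N, b - of_nat N] [c] ((1 / (real N)\<^sup>2) *\<^sub>R x)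
          - (hypergeom \<sigma> [] [c] x
             + 1 / of_nat N * (c - a - b) * E1 (hypergeom \<sigma> [] [c]) x
             - 1 / of_nat N * p1 x * hypergeom \<sigma> [] [c] x))
    \<le> B / (real N)\<^sup>2"
proof -
  have "jack_param (1 / \<sigma>) CARD('n) c"
    by unfold_locales (use assms(1,2) in auto)
  from jack_param.hypergeom_expansion[OF this refl assms(3), of a b] show ?thesis by simp
qed

end
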